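(* Consider the nonparametric regression model $Y_i=f(X_i)+\epsilon_i$, $\epsilon_i\sim\mathrm N(0,\sigma^2)$ i.i.d., $i=1,\dots,n$. Assume the covariates $X_i$ are drawn i.i.d. from the Gaussian density $\rho(x)=\sqrt{2b/\pi}\,e^{-2bx^2}$ on $\mathbb R$. Let $f\sim\mathrm{GP}(0,\sigma^2K)$ with squared-exponential covariance kernel $K(x,x')=K_a(x,x')=\exp(-a^2|x-x'|^2)$, and choose $a\equiv a_n=n^{1/(2\alpha+1)}$. Assume the true function $f_0$ belongs to $$\mathcal F=\Big\{f_0:\ f_0=\sum_{j=1}^\infty\theta_{0j}\phi_j,\ \boldsymbol\theta_0=(\theta_{01},\theta_{02},\dots)\in\Theta_\alpha\Big\}$$ with $\alpha>1/\{4(1-2b)\}$. Then an upper bound to the posterior contraction rate in the $L^2_\rho$ norm is $\epsilon_n=n^{-\alpha/(2\alpha+1)}\log n$; that is, for a sufficiently large constant $M>0$, $$\lim_{n\to\infty}\mathbb E_0\,\Pi\big(\|f-f_0\|_{2,\rho}>M\epsilon_n\mid Y,X\big)=0 .$$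
   Context: $\|g\|_{2,\rho}^2=\int g(x)^2\rho(x)\,dx$. $\Theta_\alpha=\{\boldsymbol\theta\in\ell_2:\sum_{j\ge1}j^{2\alpha}\theta_j^2<\infty\}$ is the Sobolev space of sequences with smoothness $\alpha>0$. $\sigma^2>0$ is known and $b>0$ is fixed. $\{\phi_j\}$ are the eigenfunctions of $K_a$ with respect to $\rho$ with inverse-bandwidth $a=a_n$ (so they depend on $n$): with $c=\sqrt{b^2+2ba^2}$, $$\phi_j(x)=\frac{(c/b)^{1/4}}{\sqrt{2^{j-1}(j-1)!}}\,e^{-(c-b)x^2}H_{j-1}(\sqrt{2c}\,x),\qquad j=1,2,\dots,$$ where $H_k(x)=(-1)^ke^{x^2}\frac{d^k}{dx^k}e^{-x^2}$ are the (physicist's) Hermite polynomials. They are orthonormal in $L^2_\rho(\mathbb R)$. The coefficient sequence $\boldsymbol\theta_0$ is fixed, with $f_0=\sum_j\theta_{0j}\phi_j$ formed with $a=a_n$ (convergence in $L^2_\rho$). $\Pi(\cdot\mid Y,X)$ is the posterior of $f$. $\mathbb E_0$ is expectation under the true joint law of $(Y,X)$: $X_i$ i.i.d. from $\rho$ and, given $X$, $Y_i\sim\mathrm N(f_0(X_i),\sigma^2)$ independently. *)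

theory Defs
  imports "HOL-Probability.Probability"
begin

definition rho :: "real \<Rightarrow> real \<Rightarrow> real" where
  "rho b x = sqrt (2 * b / pi) * exp (- 2 * b * x\<^sup>2)"

text \<open>The norm takes values in the extended non-negative reals: functions that are not
  square integrable have norm infinity rather than the default value 0 of a Bochner integral.\<close>

definition norm2_rho :: "real \<Rightarrow> (real \<Rightarrow> real) \<Rightarrow> ennreal" where
  "norm2_rho b g =
     (let I = \<integral>\<^sup>+ x. ennreal ((g x)\<^sup>2 * rho b x) \<partial>lborel
      in if I = \<infinity> then \<infinity> else ennreal (sqrt (enn2real I)))"

definition hermite :: "nat \<Rightarrow> real \<Rightarrow> real" where
  "hermite k x = (- 1) ^ k * exp (x\<^sup>2) * (deriv ^^ k) (\<lambda>t. exp (- (t\<^sup>2))) x"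

text \<open>Eigenfunctions, indexed by \<open>j \<ge> 1\<close>; the value at \<open>j = 0\<close> is never used.\<close>

definition eigfun :: "real \<Rightarrow> real \<Rightarrow> nat \<Rightarrow> real \<Rightarrow> real" where
  "eigfun b a j x =
     (let c = sqrt (b\<^sup>2 + 2 * b * a\<^sup>2)
      in (c / b) powr (1 / 4) / sqrt (2 ^ (j - 1) * fact (j - 1))
         * exp (- (c - b) * x\<^sup>2) * hermite (j - 1) (sqrt (2 * c) * x))"

definition sobolev :: "real \<Rightarrow> (nat \<Rightarrow> real) set" where
  "sobolev \<alpha> = {\<theta>. (\<lambda>j. (\<theta> j)\<^sup>2) summable_on {1..} \<and>
                   (\<lambda>j. real j powr (2 * \<alpha>) * (\<theta> j)\<^sup>2) summable_on {1..}}"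

text \<open>\<open>g\<close> is a Borel version of the \<open>L\<^sup>2\<close>-limit of the series.\<close>

definition is_eig_series :: "real \<Rightarrow> real \<Rightarrow> (nat \<Rightarrow> real) \<Rightarrow> (real \<Rightarrow> real) \<Rightarrow> bool" where
  "is_eig_series b a \<theta> g \<longleftrightarrow> g \<in> borel_measurable borel \<and>
     (\<lambda>N. norm2_rho b (\<lambda>x. g x - (\<Sum>j=1..N. \<theta> j * eigfun b a j x))) \<longlonglongrightarrow> 0"

definition se_kernel :: "real \<Rightarrow> real \<Rightarrow> real \<Rightarrow> real" where
  "se_kernel a x x' = exp (- (a\<^sup>2) * \<bar>x - x'\<bar>\<^sup>2)"

definition normal_law :: "real \<Rightarrow> real \<Rightarrow> real measure" where
  "normal_law m v =
     (if v = 0 then return borel m else density lborel (\<lambda>x. ennreal (normal_density m (sqrt v) x)))"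

definition path_space :: "(real \<Rightarrow> real) measure" where
  "path_space = restrict_space (\<Pi>\<^sub>M x\<in>UNIV. borel) {f. continuous_on UNIV f}"

text \<open>The law, on the space of continuous paths with the \<open>\<sigma>\<close>-algebra generated by the point
  evaluations, of a Gaussian process with mean function \<open>m\<close> and covariance function \<open>k\<close>:
  all finite-dimensional distributions are multivariate normal, i.e. all linear combinations of
  finitely many evaluations are (possibly degenerate) univariate normal.  There is at most one
  such law; for the squared-exponential kernel it exists, as that process has a continuous version.\<close>

definition GP_law :: "(real \<Rightarrow> real) \<Rightarrow> (real \<Rightarrow> real \<Rightarrow> real) \<Rightarrow> (real \<Rightarrow> real) measure \<Rightarrow> bool" where
  "GP_law m k P \<longleftrightarrow> prob_space P \<and> space P = space path_space \<and> sets P = sets path_space \<and>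
     (\<forall>I u. finite I \<longrightarrow>
        distr P borel (\<lambda>f. \<Sum>x\<in>I. u x * f x) =
        normal_law (\<Sum>x\<in>I. u x * m x) (\<Sum>x\<in>I. \<Sum>x'\<in>I. u x * u x' * k x x'))"

definition likelihood ::
  "real \<Rightarrow> nat \<Rightarrow> (nat \<Rightarrow> real) \<Rightarrow> (nat \<Rightarrow> real) \<Rightarrow> (real \<Rightarrow> real) \<Rightarrow> real" where
  "likelihood \<sigma> n X Y f = (\<Prod>i\<in>{1..n}. normal_density (f (X i)) \<sigma> (Y i))"

text \<open>Bayes' formula.\<close>

definition posterior ::
  "real \<Rightarrow> (real \<Rightarrow> real) measure \<Rightarrow> nat \<Rightarrow> (nat \<Rightarrow> real) \<Rightarrow> (nat \<Rightarrow> real) \<Rightarrow> (real \<Rightarrow> real) measure" where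
  "posterior \<sigma> P n X Y =
     density P (\<lambda>f. ennreal (likelihood \<sigma> n X Y f) /
                    (\<integral>\<^sup>+ g. ennreal (likelihood \<sigma> n X Y g) \<partial>P))"

text \<open>Joint law of \<open>(X, Y)\<close> in the regression model with regression function \<open>f\<close>: design points
  and errors are independent, and \<open>Y i = f (X i) + \<epsilon> i\<close>.\<close>

definition data_law ::
  "real \<Rightarrow> real \<Rightarrow> nat \<Rightarrow> (real \<Rightarrow> real) \<Rightarrow> ((nat \<Rightarrow> real) \<times> (nat \<Rightarrow> real)) measure" where
  "data_law b \<sigma> n f =
     distr ((\<Pi>\<^sub>M i\<in>{1..n}. density lborel (\<lambda>x. ennreal (rho b x))) \<Otimes>\<^sub>M
            (\<Pi>\<^sub>M i\<in>{1..n}. density lborel (\<lambda>e. ennreal (normal_density 0 \<sigma> e))))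
           ((\<Pi>\<^sub>M i\<in>{1..n}. borel) \<Otimes>\<^sub>M (\<Pi>\<^sub>M i\<in>{1..n}. borel))
           (\<lambda>(X, \<epsilon>). (X, \<lambda>i\<in>{1..n}. f (X i) + \<epsilon> i))"

definition bandwidth :: "real \<Rightarrow> nat \<Rightarrow> real" where
  "bandwidth \<alpha> n = real n powr (1 / (2 * \<alpha> + 1))"

definition rate :: "real \<Rightarrow> nat \<Rightarrow> real" where
  "rate \<alpha> n = real n powr (- \<alpha> / (2 * \<alpha> + 1)) * ln (real n)"

end

theory Submission
  imports Defs "HOL-Computational_Algebra.Polynomial" "HOL-Real_Asymp.Real_Asymp"
begin

text \<open>By Markov's inequality it suffices to bound the expected posterior second moment of
  \<open>\<parallel>f - f\<^sub>0\<parallel>\<^sup>2\<close>.  The posterior is again a Gaussian process (\<open>posterior_GP_law\<close>), with mean linear in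
  \<open>Y\<close> and a covariance that does not depend on \<open>Y\<close>; so at a point \<open>x\<close> this second moment is squared
  bias plus noise variance plus posterior variance, and the noise variance is at most the posterior
  variance \<open>\<sigma>\<^sup>2 s(x)\<close>.  What must be controlled is therefore \<open>bias(x)\<^sup>2 + 2\<sigma>\<^sup>2 s(x)\<close> at a fresh point
  \<open>x\<close> drawn from \<open>\<rho>\<close>, on average over the design (\<open>expected_posterior_tail\<close>).

  The fresh point together with the \<open>n\<close> design points is an exchangeable sample of size \<open>n + 1\<close>, so the
  average over the fresh point equals \<open>1/(n+1)\<close> times a sum of leave-one-out quantities of one sample.
  Leave-one-out quantities are in-sample quantities up to a factor: with \<open>G\<close> the Gram matrix of all
  \<open>n + 1\<close> points and \<open>T = (I + G)\<^sup>-\<^sup>1\<close>, one has \<open>1 + s\<^sub>i = 1/T\<^sub>i\<^sub>i\<close> and \<open>bias\<^sub>i = (T f\<^sub>0)\<^sub>i/T\<^sub>i\<^sub>i\<close>, while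
  \<open>s\<^sub>i \<le> K(x\<^sub>i,x\<^sub>i) = 1\<close> makes the factor at most \<open>2\<close>.  Hence, for every sample,
  \<open>\<Sum> bias\<^sub>i\<^sup>2 \<le> 4 f\<^sub>0\<^sup>T T f\<^sub>0 \<le> 4(\<parallel>h\<parallel>\<^sub>H\<^sup>2 + \<Sum> (f\<^sub>0 - h)(x\<^sub>i)\<^sup>2)\<close> for every \<open>h\<close> in the reproducing kernel space, and
  \<open>\<Sum> s\<^sub>i \<le> 2 tr(G T) \<le> 2(J + \<Sum> R\<^sub>J(x\<^sub>i,x\<^sub>i))\<close>, where \<open>R\<^sub>J\<close> is the kernel minus its first \<open>J\<close> eigenterms.

  The eigenvalues of the kernel are geometric, \<open>\<mu>\<^sub>k = (1 - B) B\<^sup>k\<close> with \<open>1 - B\<close> of order \<open>1/a\<close>, so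
  \<open>R\<^sub>J\<close> has trace \<open>B\<^sup>J\<close>.  Taking \<open>J\<close> of order \<open>a log n\<close> makes the variance part \<open>O(a log n / n)\<close>; truncating
  \<open>f\<^sub>0\<close> after about \<open>a\<close> terms gives \<open>\<parallel>h\<parallel>\<^sub>H\<^sup>2 = O(a)\<close> and a remainder of squared norm
  \<open>O(a\<^sup>-\<^sup>2\<^sup>\<alpha>) = O(a/n)\<close>.  As \<open>\<epsilon>\<^sub>n\<^sup>2 = (a/n) (log n)\<^sup>2\<close>, the probability in question is \<open>O(1/log n)\<close>.\<close>

section \<open>Positive semidefinite kernels and leave-one-out systems\<close>

definition psd_on :: "'a set \<Rightarrow> ('a \<Rightarrow> 'a \<Rightarrow> real) \<Rightarrow> bool" where
  "psd_on I G \<longleftrightarrow> (\<forall>x\<in>I. \<forall>y\<in>I. G x y = G y x) \<and>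
     (\<forall>z. 0 \<le> (\<Sum>x\<in>I. \<Sum>y\<in>I. z x * z y * G x y))"

lemma psd_onI:
  assumes "\<And>x y. x \<in> I \<Longrightarrow> y \<in> I \<Longrightarrow> G x y = G y x"
    and "\<And>z. 0 \<le> (\<Sum>x\<in>I. \<Sum>y\<in>I. z x * z y * G x y)"
  shows "psd_on I G"
  using assms unfolding psd_on_def by blast

lemma psd_onD:
  assumes "psd_on I G"
  shows "x \<in> I \<Longrightarrow> y \<in> I \<Longrightarrow> G x y = G y x"
    and "0 \<le> (\<Sum>x\<in>I. \<Sum>y\<in>I. z x * z y * G x y)"
  using assms unfolding psd_on_def by blast+

lemma sum_swap3:
  fixes f :: "'x \<Rightarrow> 'a \<Rightarrow> 'b \<Rightarrow> real"
  shows "(\<Sum>i\<in>N. \<Sum>k\<in>N'. \<Sum>m\<in>A. f m i k) = (\<Sum>m\<in>A. \<Sum>i\<in>N. \<Sum>k\<in>N'. f m i k)"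
proof -
  have "(\<Sum>i\<in>N. \<Sum>k\<in>N'. \<Sum>m\<in>A. f m i k) = (\<Sum>i\<in>N. \<Sum>m\<in>A. \<Sum>k\<in>N'. f m i k)"
    by (intro sum.cong refl sum.swap)
  also have "\<dots> = (\<Sum>m\<in>A. \<Sum>i\<in>N. \<Sum>k\<in>N'. f m i k)" by (rule sum.swap)
  finally show ?thesis .
qed

lemma quad_insert:
  fixes G :: "'a \<Rightarrow> 'a \<Rightarrow> real"
  assumes "finite I" "p \<notin> I" "\<And>x. x \<in> I \<Longrightarrow> G x p = G p x"
  shows "(\<Sum>x\<in>insert p I. \<Sum>y\<in>insert p I. z x * z y * G x y) =
    (\<Sum>x\<in>I. \<Sum>y\<in>I. z x * z y * G x y) + 2 * z p * (\<Sum>x\<in>I. z x * G p x) + (z p)\<^sup>2 * G p p"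
proof -
  have "(\<Sum>x\<in>I. z x * z p * G x p) = z p * (\<Sum>x\<in>I. z x * G p x)"
    by (simp add: sum_distrib_left assms(3) mult_ac)
  moreover have "(\<Sum>x\<in>I. z p * z x * G p x) = z p * (\<Sum>x\<in>I. z x * G p x)"
    by (simp add: sum_distrib_left mult_ac)
  ultimately show ?thesis
    using assms(1,2) by (simp add: sum.distrib power2_eq_square algebra_simps)
qed

lemma psd_on_diag:
  assumes "psd_on I G" "finite I" "p \<in> I"
  shows "0 \<le> G p p"
proof -
  have "(\<Sum>x\<in>I. \<Sum>y\<in>I. (if x = p then 1 else 0) * (if y = p then 1 else 0) * G x y) = G p p"
    using assms(2,3) by (simp add: sum.remove[of I p])
  then show ?thesis using psd_onD(2)[OF assms(1), of "\<lambda>x. if x = p then 1 else 0"] by simp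
qed

text \<open>The quadratic form of \<open>s z + t e\<^sub>p\<close> is a nonnegative binary quadratic form in \<open>(s, t)\<close>; its discriminant gives
  the Cauchy--Schwarz inequality for the semi-inner product defined by \<open>G\<close>.\<close>

lemma psd_on_insert_cs:
  fixes G :: "'a \<Rightarrow> 'a \<Rightarrow> real"
  assumes fin: "finite I" and p: "p \<notin> I" and psd: "psd_on (insert p I) G"
  shows "(\<Sum>x\<in>I. z x * G p x)\<^sup>2 \<le> G p p * (\<Sum>x\<in>I. \<Sum>y\<in>I. z x * z y * G x y)"
    and "0 \<le> (\<Sum>x\<in>I. \<Sum>y\<in>I. z x * z y * G x y)"
proof -
  define A where "A = (\<Sum>x\<in>I. \<Sum>y\<in>I. z x * z y * G x y)"
  define c where "c = (\<Sum>x\<in>I. z x * G p x)"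
  have quad: "0 \<le> s\<^sup>2 * A + 2 * s * t * c + t\<^sup>2 * G p p" for s t
  proof -
    define w where "w x = (if x = p then t else s * z x)" for x
    have "0 \<le> (\<Sum>x\<in>insert p I. \<Sum>y\<in>insert p I. w x * w y * G x y)"
      using psd by (rule psd_onD)
    also have "\<dots> = (\<Sum>x\<in>I. \<Sum>y\<in>I. w x * w y * G x y)
        + 2 * w p * (\<Sum>x\<in>I. w x * G p x) + (w p)\<^sup>2 * G p p"
      using psd_onD(1)[OF psd] by (intro quad_insert fin p) blast
    also have "(\<Sum>x\<in>I. \<Sum>y\<in>I. w x * w y * G x y) = s\<^sup>2 * A"
      unfolding A_def sum_distrib_left using p
      by (intro sum.cong refl) (auto simp: w_def power2_eq_square)
    also have "(\<Sum>x\<in>I. w x * G p x) = s * c"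
      unfolding c_def sum_distrib_left using p by (intro sum.cong refl) (auto simp: w_def)
    finally show ?thesis by (simp add: w_def algebra_simps)
  qed
  have "0 \<le> G p p" using quad[of 0 1] by simp
  show "0 \<le> (\<Sum>x\<in>I. \<Sum>y\<in>I. z x * z y * G x y)"
    using quad[of 1 0] by (simp add: A_def)
  show "(\<Sum>x\<in>I. z x * G p x)\<^sup>2 \<le> G p p * (\<Sum>x\<in>I. \<Sum>y\<in>I. z x * z y * G x y)"
  proof (cases "G p p = 0")
    case True
    have "c = 0"
    proof (rule ccontr)
      \<comment> \<open>for \<open>s = 1\<close> the form is affine in \<open>t\<close>; the chosen \<open>t\<close> gives it the value \<open>- 1\<close>\<close>
      assume "c \<noteq> 0"
      then show False using quad[of 1 "- (A + 1) / (2 * c)"] True by (simp add: field_simps)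
    qed
    then show ?thesis using True by (simp add: c_def)
  next
    case False
    then have pos: "G p p > 0" using \<open>0 \<le> G p p\<close> by simp
    have "0 \<le> G p p * (G p p * A - c\<^sup>2)"
      using quad[of "G p p" "- c"] by (simp add: power2_eq_square algebra_simps)
    then have "0 \<le> G p p * A - c\<^sup>2" using pos by (simp add: zero_le_mult_iff)
    then show ?thesis by (simp add: A_def c_def)
  qed
qed

text \<open>Points of a design may coincide, so kernels must be evaluated on families of points.  Coinciding
  points merely have their coefficients added, and so positivity on sets of distinct points suffices.\<close>

lemma psd_on_pullback:
  fixes K :: "'b \<Rightarrow> 'b \<Rightarrow> real"
  assumes "finite I" "psd_on (p ` I) K"
  shows "psd_on I (\<lambda>i j. K (p i) (p j))"
proof (rule psd_onI)
  show "0 \<le> (\<Sum>i\<in>I. \<Sum>j\<in>I. z i * z j * K (p i) (p j))" for z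
  proof -
    define Z where "Z y = (\<Sum>i\<in>{i\<in>I. p i = y}. z i)" for y
    have push: "(\<Sum>i\<in>I. z i * h (p i)) = (\<Sum>y\<in>p ` I. Z y * h y)" for h
      unfolding sum.image_gen[OF assms(1), where g=p] Z_def sum_distrib_right by simp
    have "(\<Sum>i\<in>I. \<Sum>j\<in>I. z i * z j * K (p i) (p j)) = (\<Sum>i\<in>I. z i * (\<Sum>j\<in>I. z j * K (p i) (p j)))"
      by (simp only: sum_distrib_left mult.assoc)
    also have "\<dots> = (\<Sum>i\<in>I. z i * (\<Sum>y\<in>p ` I. Z y * K (p i) y))"
      by (simp only: push)
    also have "\<dots> = (\<Sum>x\<in>p ` I. Z x * (\<Sum>y\<in>p ` I. Z y * K x y))"
      by (rule push)
    also have "\<dots> = (\<Sum>x\<in>p ` I. \<Sum>y\<in>p ` I. Z x * Z y * K x y)"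
      by (simp only: sum_distrib_left mult.assoc)
    finally show ?thesis using psd_onD(2)[OF assms(2)] by simp
  qed
qed (use psd_onD(1)[OF assms(2)] in blast)

text \<open>Cholesky decomposition, by induction on the index set: subtract the rank-one form built from the
  column of the new index \<open>p\<close>; what is left is positive semidefinite and vanishes on \<open>p\<close>.  When
  \<open>R p p = 0\<close> that whole column vanishes and the convention \<open>x / 0 = 0\<close> makes the rank-one form zero.\<close>

lemma psd_factorization:
  fixes R :: "'a \<Rightarrow> 'a \<Rightarrow> real"
  assumes "finite I" "psd_on I R"
  shows "\<exists>L. \<forall>x\<in>I. \<forall>y\<in>I. R x y = (\<Sum>k\<in>I. L k x * L k y)"
  using assms
proof (induction I arbitrary: R rule: finite_induct)
  case empty
  then show ?case by simp
next
  case (insert p I)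
  have sym: "\<And>x y. x \<in> insert p I \<Longrightarrow> y \<in> insert p I \<Longrightarrow> R x y = R y x"
    using insert.prems by (rule psd_onD)
  have diag: "R p p \<ge> 0"
    using insert.prems insert.hyps by (intro psd_on_diag[of "insert p I"]) auto
  define q where "q x = R p x / sqrt (R p p)" for x
  define R' where "R' x y = R x y - q x * q y" for x y
  have pcol: "q p * q x = R p x" if "x \<in> insert p I" for x
  proof (cases "R p p = 0")
    case True
    have "R p x = 0"
    proof (cases "x = p")
      case False
      then have "x \<in> I" using that by simp
      then have "(\<Sum>y\<in>I. (if y = x then 1 else 0) * R p y) = R p x"
        using \<open>finite I\<close> by (subst sum.remove[of I x]) auto
      with psd_on_insert_cs(1)[OF insert.hyps insert.prems, of "\<lambda>y. if y = x then 1 else 0"] True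
      show ?thesis by simp
    qed (use True in simp)
    then show ?thesis by (simp add: q_def)
  next
    case False
    then show ?thesis using diag by (simp add: q_def)
  qed
  have "psd_on I R'"
  proof (rule psd_onI)
    show "R' x y = R' y x" if "x \<in> I" "y \<in> I" for x y
      using that by (simp add: R'_def sym mult.commute)
    show "0 \<le> (\<Sum>x\<in>I. \<Sum>y\<in>I. z x * z y * R' x y)" for z
    proof -
      define A where "A = (\<Sum>x\<in>I. \<Sum>y\<in>I. z x * z y * R x y)"
      have A0: "A \<ge> 0"
        unfolding A_def by (rule psd_on_insert_cs(2)[OF insert.hyps insert.prems])
      have cs: "(\<Sum>x\<in>I. z x * R p x)\<^sup>2 \<le> R p p * A"
        unfolding A_def by (rule psd_on_insert_cs(1)[OF insert.hyps insert.prems])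
      have "(\<Sum>x\<in>I. z x * q x) = (\<Sum>x\<in>I. z x * R p x) / sqrt (R p p)"
        by (simp add: q_def sum_divide_distrib)
      then have "(\<Sum>x\<in>I. z x * q x)\<^sup>2 = (\<Sum>x\<in>I. z x * R p x)\<^sup>2 / R p p"
        using diag by (simp add: power_divide)
      also have "\<dots> \<le> A"
      proof (cases "R p p = 0")
        case False
        then show ?thesis using cs diag by (simp add: divide_le_eq mult.commute)
      qed (use A0 in simp)
      finally have le: "(\<Sum>x\<in>I. z x * q x)\<^sup>2 \<le> A" .
      have "(\<Sum>x\<in>I. \<Sum>y\<in>I. z x * z y * R' x y) = A - (\<Sum>x\<in>I. z x * q x)\<^sup>2"
        by (simp add: A_def R'_def power2_eq_square sum_product right_diff_distrib sum_subtractf mult_ac)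
      with le show ?thesis by simp
    qed
  qed
  from insert.IH[OF this] obtain L where L: "\<forall>x\<in>I. \<forall>y\<in>I. R' x y = (\<Sum>k\<in>I. L k x * L k y)"
    by blast
  define L' where "L' k x = (if k = p then q x else if x = p then 0 else L k x)" for k x
  have "R x y = (\<Sum>k\<in>insert p I. L' k x * L' k y)" if "x \<in> insert p I" "y \<in> insert p I" for x y
  proof -
    have "(\<Sum>k\<in>insert p I. L' k x * L' k y)
        = q x * q y + (\<Sum>k\<in>I. L' k x * L' k y)"
      using insert.hyps by (simp add: L'_def)
    also have "(\<Sum>k\<in>I. L' k x * L' k y) = R x y - q x * q y"
    proof (cases "x = p \<or> y = p")
      case True
      have "(\<Sum>k\<in>I. L' k x * L' k y) = 0"
        using True insert.hyps by (intro sum.neutral) (auto simp: L'_def)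
      moreover have "R x y = q x * q y"
        using True that pcol[of x] pcol[of y] sym[of x y] by (auto simp: mult.commute)
      ultimately show ?thesis by simp
    next
      case False
      then have "(\<Sum>k\<in>I. L' k x * L' k y) = (\<Sum>k\<in>I. L k x * L k y)"
        using insert.hyps by (intro sum.cong refl) (auto simp: L'_def)
      also have "\<dots> = R' x y" using False that L by auto
      finally show ?thesis by (simp add: R'_def)
    qed
    finally show ?thesis by simp
  qed
  then show ?case by blast
qed

text \<open>For each left-out index \<open>i\<close> the vector \<open>v i\<close> is \<open>1\<close> at \<open>i\<close> and minus the regression weights of the other
  indices, so \<open>\<Sum>\<^sub>k v i k * F k\<close> is the error of predicting \<open>F i\<close> from the other values, and \<open>s i\<close> is the
  corresponding residual variance.  The normal equations of all these regressions together say that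
  \<open>(I + G) (v i) = (1 + s i) e\<^sub>i\<close>: up to scaling, the vectors \<open>v i\<close> are the columns of \<open>(I + G)\<^sup>-\<^sup>1\<close>.\<close>

locale leave_one_out =
  fixes N :: "'a set" and G :: "'a \<Rightarrow> 'a \<Rightarrow> real" and v :: "'a \<Rightarrow> 'a \<Rightarrow> real" and s :: "'a \<Rightarrow> real"
  assumes fin: "finite N" and psd: "psd_on N G"
    and one: "i \<in> N \<Longrightarrow> v i i = 1"
    and eq: "i \<in> N \<Longrightarrow> j \<in> N \<Longrightarrow> v i j + (\<Sum>k\<in>N. G j k * v i k) = (if j = i then 1 + s i else 0)"
begin

abbreviation quad :: "('a \<Rightarrow> real) \<Rightarrow> real" where
  "quad z \<equiv> (\<Sum>i\<in>N. \<Sum>j\<in>N. z i * z j * G i j)"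

lemma s_nonneg: assumes "i \<in> N" shows "0 \<le> s i"
proof -
  have "1 \<le> (\<Sum>j\<in>N. (v i j)\<^sup>2)"
    using member_le_sum[of i N "\<lambda>j. (v i j)\<^sup>2"] fin assms by (simp add: one)
  also have "\<dots> \<le> (\<Sum>j\<in>N. (v i j)\<^sup>2) + quad (v i)" using psd_onD(2)[OF psd] by simp
  also have "\<dots> = (\<Sum>j\<in>N. v i j * (v i j + (\<Sum>k\<in>N. G j k * v i k)))"
    by (simp add: sum.distrib[symmetric] sum_distrib_left algebra_simps power2_eq_square)
  also have "\<dots> = (\<Sum>j\<in>N. v i j * (if j = i then 1 + s i else 0))"
    by (intro sum.cong refl arg_cong2[where f="(*)"] eq assms)
  also have "\<dots> = 1 + s i" using assms fin by (simp add: one if_distrib cong: if_cong)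
  finally show ?thesis by simp
qed

text \<open>The inverse of \<open>I + G\<close>.\<close>

definition T :: "'a \<Rightarrow> 'a \<Rightarrow> real" where "T i k = v i k / (1 + s i)"

lemma T_eq: "i \<in> N \<Longrightarrow> j \<in> N \<Longrightarrow> T i j + (\<Sum>k\<in>N. G j k * T i k) = (if j = i then 1 else 0)"
  using eq[of i j] s_nonneg[of i]
  by (simp add: T_def sum_divide_distrib[symmetric] add_divide_distrib[symmetric])

text \<open>Evaluate the bilinear form of \<open>I + G\<close> at the columns \<open>T l\<close> and \<open>T i\<close> in both ways.\<close>

lemma T_sym: assumes "i \<in> N" "l \<in> N" shows "T i l = T l i"
proof -
  have *: "(\<Sum>j\<in>N. T l j * (T i j + (\<Sum>k\<in>N. G j k * T i k))) = T l i" if "i \<in> N" "l \<in> N" for i l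
    using that fin by (simp add: T_eq if_distrib cong: if_cong)
  have "T l i = (\<Sum>j\<in>N. T l j * T i j) + (\<Sum>j\<in>N. \<Sum>k\<in>N. T l j * G j k * T i k)"
    using *[OF assms] by (simp add: algebra_simps sum.distrib sum_distrib_left)
  also have "(\<Sum>j\<in>N. \<Sum>k\<in>N. T l j * G j k * T i k) = (\<Sum>j\<in>N. \<Sum>k\<in>N. T i j * G j k * T l k)"
    by (subst sum.swap, intro sum.cong refl) (simp add: psd_onD(1)[OF psd] mult_ac)
  also have "(\<Sum>j\<in>N. T l j * T i j) + \<dots> = T i l"
    using *[OF assms(2,1)] by (simp add: algebra_simps sum.distrib sum_distrib_left)
  finally show ?thesis by simp
qed

text \<open>The solution of \<open>(I + G) z = F\<close>.\<close>

definition sol :: "('a \<Rightarrow> real) \<Rightarrow> 'a \<Rightarrow> real" where "sol F k = (\<Sum>i\<in>N. F i * T k i)"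

lemma sol_eq:
  assumes "j \<in> N"
  shows "sol F j + (\<Sum>k\<in>N. G j k * sol F k) = F j"
proof -
  have "sol F j + (\<Sum>k\<in>N. G j k * sol F k) =
      (\<Sum>i\<in>N. F i * T j i) + (\<Sum>k\<in>N. \<Sum>i\<in>N. F i * (G j k * T k i))"
    by (simp add: sol_def sum_distrib_left mult_ac)
  also have "(\<Sum>k\<in>N. \<Sum>i\<in>N. F i * (G j k * T k i)) = (\<Sum>i\<in>N. F i * (\<Sum>k\<in>N. G j k * T k i))"
    by (subst sum.swap) (simp add: sum_distrib_left)
  also have "(\<Sum>i\<in>N. F i * T j i) + \<dots> = (\<Sum>i\<in>N. F i * (T i j + (\<Sum>k\<in>N. G j k * T i k)))"
    using assms by (simp add: sum.distrib[symmetric] algebra_simps T_sym cong: sum.cong)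
  also have "\<dots> = F j" using assms fin by (simp add: T_eq if_distrib cong: if_cong)
  finally show ?thesis .
qed

lemma sol_energy: "(\<Sum>i\<in>N. sol F i * F i) = (\<Sum>i\<in>N. (sol F i)\<^sup>2) + quad (sol F)"
proof -
  have "(\<Sum>i\<in>N. sol F i * F i) = (\<Sum>i\<in>N. sol F i * (sol F i + (\<Sum>k\<in>N. G i k * sol F k)))"
    by (simp add: sol_eq)
  then show ?thesis
    by (simp add: algebra_simps sum.distrib sum_distrib_left power2_eq_square)
qed

lemma sol_quad_T: "(\<Sum>i\<in>N. sol F i * F i) = (\<Sum>i\<in>N. \<Sum>k\<in>N. F i * F k * T i k)"
  by (simp add: sol_def sum_distrib_left sum_distrib_right mult_ac)

text \<open>The value \<open>F\<^sup>T (I + G)\<^sup>-\<^sup>1 F\<close> is the minimum of \<open>\<parallel>h\<parallel>\<^sub>H\<^sup>2 + |F - h|\<^sup>2\<close> over \<open>h\<close>; the condition on \<open>H\<close> expresses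
  \<open>\<parallel>h\<parallel>\<^sub>H\<^sup>2 \<le> H\<close> by duality.  With \<open>z = (I + G)\<^sup>-\<^sup>1 F\<close>, the terms of \<open>z\<cdot>F = z\<cdot>h + z\<cdot>r\<close> are bounded by the
  arithmetic-geometric mean inequality and half of the energy \<open>z\<cdot>F = |z|\<^sup>2 + z\<^sup>T G z\<close> is absorbed.\<close>

lemma energy_bound:
  assumes F: "\<And>i. i \<in> N \<Longrightarrow> F i = h i + r i"
    and h: "\<And>z. (\<Sum>i\<in>N. z i * h i)\<^sup>2 \<le> H * quad z" and H: "0 \<le> H"
  shows "(\<Sum>i\<in>N. sol F i * F i) \<le> H + (\<Sum>i\<in>N. (r i)\<^sup>2)"
proof -
  let ?z = "sol F"
  have q0: "0 \<le> quad ?z" using psd by (rule psd_onD)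
  have "(\<Sum>i\<in>N. ?z i * h i) \<le> sqrt (H * quad ?z)"
    by (intro real_le_rsqrt h)
  also have "\<dots> \<le> (H + quad ?z) / 2" using arith_geo_mean_sqrt[OF H q0] .
  finally have 1: "(\<Sum>i\<in>N. ?z i * h i) \<le> (H + quad ?z) / 2" .
  have "(\<Sum>i\<in>N. ?z i * r i) \<le> (\<Sum>i\<in>N. ((?z i)\<^sup>2 + (r i)\<^sup>2) / 2)"
  proof (intro sum_mono)
    show "?z i * r i \<le> ((?z i)\<^sup>2 + (r i)\<^sup>2) / 2" for i
      using sum_squares_bound[of "?z i" "r i"] by (simp add: field_simps)
  qed
  then have 2: "(\<Sum>i\<in>N. ?z i * r i) \<le> ((\<Sum>i\<in>N. (?z i)\<^sup>2) + (\<Sum>i\<in>N. (r i)\<^sup>2)) / 2"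
    by (simp add: sum_divide_distrib sum.distrib add_divide_distrib)
  have "(\<Sum>i\<in>N. ?z i * F i) = (\<Sum>i\<in>N. ?z i * h i) + (\<Sum>i\<in>N. ?z i * r i)"
    by (simp add: F sum.distrib algebra_simps)
  with 1 2 sol_energy[of F] show ?thesis by (simp add: field_simps)
qed

text \<open>The prediction error at \<open>i\<close> is \<open>(1 + s i)\<close> times the \<open>i\<close>-th entry of \<open>(I + G)\<^sup>-\<^sup>1 F\<close>, and
  \<open>|(I + G)\<^sup>-\<^sup>1 F|\<^sup>2\<close> is at most the energy.\<close>

lemma bias_bound:
  assumes le1: "\<And>i. i \<in> N \<Longrightarrow> s i \<le> 1"
    and F: "\<And>i. i \<in> N \<Longrightarrow> F i = h i + r i"
    and h: "\<And>z. (\<Sum>i\<in>N. z i * h i)\<^sup>2 \<le> H * quad z" and H: "0 \<le> H"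
  shows "(\<Sum>i\<in>N. (\<Sum>k\<in>N. v i k * F k)\<^sup>2) \<le> 4 * (H + (\<Sum>i\<in>N. (r i)\<^sup>2))"
proof -
  have "(\<Sum>i\<in>N. (\<Sum>k\<in>N. v i k * F k)\<^sup>2) \<le> (\<Sum>i\<in>N. 4 * (sol F i)\<^sup>2)"
  proof (intro sum_mono)
    fix i assume i: "i \<in> N"
    have "(\<Sum>k\<in>N. v i k * F k) = (1 + s i) * sol F i"
      using s_nonneg[OF i] by (simp add: sol_def T_def sum_distrib_left mult_ac)
    then have "(\<Sum>k\<in>N. v i k * F k)\<^sup>2 = (1 + s i)\<^sup>2 * (sol F i)\<^sup>2" by (simp add: power_mult_distrib)
    also have "\<dots> \<le> 2\<^sup>2 * (sol F i)\<^sup>2"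
      using le1[OF i] s_nonneg[OF i] by (intro mult_right_mono power_mono) auto
    finally show "(\<Sum>k\<in>N. v i k * F k)\<^sup>2 \<le> 4 * (sol F i)\<^sup>2" by simp
  qed
  also have "\<dots> \<le> 4 * (\<Sum>i\<in>N. sol F i * F i)"
    using psd_onD(2)[OF psd] by (simp add: sol_energy sum_distrib_left[symmetric])
  also have "\<dots> \<le> 4 * (H + (\<Sum>i\<in>N. (r i)\<^sup>2))"
    using energy_bound[OF F h H] by simp
  finally show ?thesis .
qed

text \<open>Since \<open>T\<^sub>i\<^sub>i = 1/(1 + s\<^sub>i)\<close>, the sum of the \<open>s\<^sub>i\<close> is at most \<open>2 tr(I - T) = 2 tr(G T)\<close>.  Splitting \<open>G\<close> into
  rank-one terms \<open>L L\<^sup>T\<close>, each contributes \<open>L\<^sup>T T L\<close>, which is at most \<open>1\<close> because \<open>I + G\<close> dominates \<open>L L\<^sup>T\<close>, and at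
  most \<open>|L|\<^sup>2\<close> because \<open>I + G\<close> dominates \<open>I\<close>.  The first estimate is used for the \<open>\<Phi> m\<close>, the second for a
  Cholesky decomposition of \<open>R\<close>.\<close>

lemma trace_bound:
  fixes \<Phi> :: "'m \<Rightarrow> 'a \<Rightarrow> real" and R :: "'a \<Rightarrow> 'a \<Rightarrow> real"
  assumes le1: "\<And>i. i \<in> N \<Longrightarrow> s i \<le> 1"
    and M: "finite M"
    and G: "\<And>i j. i \<in> N \<Longrightarrow> j \<in> N \<Longrightarrow> G i j = (\<Sum>m\<in>M. \<Phi> m i * \<Phi> m j) + R i j"
    and R: "psd_on N R"
  shows "(\<Sum>i\<in>N. s i) \<le> 2 * (card M + (\<Sum>i\<in>N. R i i))"
proof -
  let ?Q = "\<lambda>F. \<Sum>i\<in>N. \<Sum>k\<in>N. F i * F k * T i k"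
  obtain L where L: "\<forall>x\<in>N. \<forall>y\<in>N. R x y = (\<Sum>k\<in>N. L k x * L k y)"
    using psd_factorization[OF fin R] by blast
  have "(\<Sum>i\<in>N. s i) \<le> (\<Sum>i\<in>N. 2 * (1 - T i i))"
  proof (intro sum_mono)
    fix i assume i: "i \<in> N"
    have "s i * (1 + s i) \<le> s i * 2"
      using le1[OF i] s_nonneg[OF i] by (intro mult_left_mono) auto
    then show "s i \<le> 2 * (1 - T i i)"
      using s_nonneg[OF i] by (simp add: T_def one[OF i] field_simps)
  qed
  also have "\<dots> = (\<Sum>i\<in>N. 2 * (\<Sum>k\<in>N. G i k * T i k))"
  proof (intro sum.cong refl)
    fix i assume "i \<in> N"
    then show "2 * (1 - T i i) = 2 * (\<Sum>k\<in>N. G i k * T i k)" using T_eq[of i i] by simp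
  qed
  also have "\<dots> = 2 * (\<Sum>i\<in>N. \<Sum>k\<in>N. (\<Sum>m\<in>M. \<Phi> m i * \<Phi> m k * T i k) + (\<Sum>m\<in>N. L m i * L m k * T i k))"
    unfolding sum_distrib_left[symmetric]
    by (intro arg_cong2[where f="(*)"] sum.cong refl) (simp add: G L sum_distrib_right distrib_right)
  also have "\<dots> = 2 * ((\<Sum>m\<in>M. ?Q (\<Phi> m)) + (\<Sum>m\<in>N. ?Q (L m)))"
  proof -
    have "(\<Sum>i\<in>N. \<Sum>k\<in>N. (\<Sum>m\<in>M. \<Phi> m i * \<Phi> m k * T i k) + (\<Sum>m\<in>N. L m i * L m k * T i k)) =
        (\<Sum>i\<in>N. \<Sum>k\<in>N. \<Sum>m\<in>M. \<Phi> m i * \<Phi> m k * T i k) + (\<Sum>i\<in>N. \<Sum>k\<in>N. \<Sum>m\<in>N. L m i * L m k * T i k)"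
      by (simp only: sum.distrib)
    also have "\<dots> = (\<Sum>m\<in>M. ?Q (\<Phi> m)) + (\<Sum>m\<in>N. ?Q (L m))"
      by (intro arg_cong2[where f="(+)"] sum_swap3)
    finally show ?thesis by (rule arg_cong)
  qed
  also have "\<dots> \<le> 2 * ((\<Sum>m\<in>M. 1) + (\<Sum>m\<in>N. \<Sum>i\<in>N. (L m i)\<^sup>2))"
  proof -
    have h1: "?Q (\<Phi> m) \<le> 1" if m: "m \<in> M" for m
    proof -
    let ?z = "sol (\<Phi> m)" let ?q = "\<Sum>i\<in>N. ?z i * \<Phi> m i"
    \<comment> \<open>the energy \<open>z\<cdot>\<Phi>\<close> dominates its own square, hence is at most \<open>1\<close>\<close>
    have "?q\<^sup>2 \<le> (\<Sum>l\<in>M. (\<Sum>i\<in>N. ?z i * \<Phi> l i)\<^sup>2)"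
      using m M by (intro member_le_sum) auto
    also have "\<dots> + (\<Sum>i\<in>N. \<Sum>j\<in>N. ?z i * ?z j * R i j) = quad ?z"
    proof -
      have "(\<Sum>i\<in>N. \<Sum>j\<in>N. ?z i * ?z j * G i j) =
        (\<Sum>i\<in>N. \<Sum>j\<in>N. (\<Sum>l\<in>M. ?z i * \<Phi> l i * (?z j * \<Phi> l j)) + ?z i * ?z j * R i j)"
        by (intro sum.cong refl) (simp add: G sum_distrib_left algebra_simps)
      also have "\<dots> = (\<Sum>i\<in>N. \<Sum>j\<in>N. (\<Sum>l\<in>M. ?z i * \<Phi> l i * (?z j * \<Phi> l j))) + (\<Sum>i\<in>N. \<Sum>j\<in>N. ?z i * ?z j * R i j)"
        by (simp add: sum.distrib)
      also have "(\<Sum>i\<in>N. \<Sum>j\<in>N. (\<Sum>l\<in>M. ?z i * \<Phi> l i * (?z j * \<Phi> l j))) = (\<Sum>l\<in>M. (\<Sum>i\<in>N. ?z i * \<Phi> l i)\<^sup>2)"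
        by (simp only: power2_eq_square sum_product sum_swap3[where A=M])
      finally show ?thesis by simp
    qed
    finally have "?q\<^sup>2 \<le> quad ?z" using psd_onD(2)[OF R, of ?z] by simp
    also have "\<dots> \<le> ?q" by (simp add: sol_energy sum_nonneg)
    finally have "?q * ?q \<le> 1 * ?q" by (simp add: power2_eq_square)
    then have "?q \<le> 1" by (cases "?q > 0") (simp_all add: mult_le_cancel_right)
    then show ?thesis by (simp add: sol_quad_T)
    qed
    have h2: "?Q (L m) \<le> (\<Sum>i\<in>N. (L m i)\<^sup>2)" for m
    proof -
    have "(\<Sum>i\<in>N. sol (L m) i * L m i) \<le> 0 + (\<Sum>i\<in>N. (L m i)\<^sup>2)"
      by (rule energy_bound[where h="\<lambda>_. 0"]) auto
    then show ?thesis by (simp add: sol_quad_T)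
    qed
    show ?thesis by (intro mult_left_mono add_mono sum_mono[OF h1] sum_mono[OF h2]) auto
  qed
  also have "(\<Sum>m\<in>N. \<Sum>i\<in>N. (L m i)\<^sup>2) = (\<Sum>i\<in>N. R i i)"
    using L by (subst sum.swap) (simp add: power2_eq_square)
  finally show ?thesis by simp
qed

end

section \<open>Gaussian processes conditioned on noisy observations\<close>

lemma normal_density_affine_std:
  assumes "\<tau> > 0"
  shows "\<tau> * normal_density m \<tau> (m + \<tau> * x) = std_normal_density x"
  using assms by (simp add: normal_density_def real_sqrt_mult power_mult_distrib)

lemma exp_diff_of_real: "exp (z - of_real y) = exp z * of_real (exp (- y))" for z :: complex
  by (simp add: exp_diff exp_minus exp_of_real divide_inverse)

lemma integral_normal_iexp:
  assumes "\<tau> > 0"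
  shows "(\<integral>x. normal_density m \<tau> x *\<^sub>R iexp (t * x) \<partial>lborel)
    = exp (\<i> * of_real (t * m) - of_real (t\<^sup>2 * \<tau>\<^sup>2 / 2))"
proof -
  have "(\<integral>x. normal_density m \<tau> x *\<^sub>R iexp (t * x) \<partial>lborel)
      = \<bar>\<tau>\<bar> *\<^sub>R (\<integral>x. normal_density m \<tau> (m + \<tau> * x) *\<^sub>R iexp (t * (m + \<tau> * x)) \<partial>lborel)"
    using assms by (intro lborel_integral_real_affine) auto
  also have "\<dots> = (\<integral>x. (\<tau> * normal_density m \<tau> (m + \<tau> * x)) *\<^sub>R iexp (t * (m + \<tau> * x)) \<partial>lborel)"
    using assms by (subst integral_scaleR_right[symmetric]) simp
  also have "\<dots> = (\<integral>x. iexp (t * m) * (std_normal_density x *\<^sub>R iexp ((t * \<tau>) * x)) \<partial>lborel)"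
    unfolding normal_density_affine_std[OF assms]
    by (intro Bochner_Integration.integral_cong refl) (simp add: exp_add[symmetric] algebra_simps)
  also have "\<dots> = iexp (t * m) * (\<integral>x. std_normal_density x *\<^sub>R iexp ((t * \<tau>) * x) \<partial>lborel)"
    by (rule integral_mult_right_zero)
  also have "(\<integral>x. std_normal_density x *\<^sub>R iexp ((t * \<tau>) * x) \<partial>lborel) = char std_normal_distribution (t * \<tau>)"
    unfolding char_def by (subst integral_density) auto
  finally show ?thesis
    by (simp only: char_std_normal_distribution exp_diff_of_real) (simp add: power_mult_distrib)
qed

lemma normal_density_exp_form:
  assumes "S > 0"
  shows "exp (\<kappa> * \<xi> - S * \<xi>\<^sup>2 / 2) = sqrt (2 * pi / S) * exp (\<kappa>\<^sup>2 / (2 * S)) * normal_density (\<kappa> / S) (1 / sqrt S) \<xi>"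
proof -
  have "\<kappa> * \<xi> - S * \<xi>\<^sup>2 / 2 = \<kappa>\<^sup>2 / (2 * S) - (\<xi> - \<kappa> / S)\<^sup>2 / (2 * (1 / sqrt S)\<^sup>2)"
    using assms by (simp add: power_divide power2_diff field_simps power2_eq_square)
  then have "exp (\<kappa> * \<xi> - S * \<xi>\<^sup>2 / 2) = exp (\<kappa>\<^sup>2 / (2 * S)) * exp (- (\<xi> - \<kappa> / S)\<^sup>2 / (2 * (1 / sqrt S)\<^sup>2))"
    by (simp add: exp_add[symmetric])
  moreover have "sqrt (2 * pi / S) * (1 / sqrt (2 * pi * (1 / sqrt S)\<^sup>2)) = 1"
    using assms by (simp add: power_divide)
  ultimately show ?thesis unfolding normal_density_def by (simp add: mult_ac)
qed

lemma integrable_exp_quadratic: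
  assumes "S > 0"
  shows "integrable lborel (\<lambda>\<xi>. exp (\<kappa> * \<xi> - S * \<xi>\<^sup>2 / 2) :: real)"
  unfolding normal_density_exp_form[OF assms] using assms by (intro integrable_mult_right) auto

text \<open>Up to normalisation the real exponential is the density of \<open>N(\<kappa>/S, 1/S)\<close>, so this is the characteristic
  function of a normal law.\<close>

lemma integral_exp_quadratic_iexp:
  assumes "S > 0"
  shows "(\<integral>\<xi>. exp (\<kappa> * \<xi> - S * \<xi>\<^sup>2 / 2) *\<^sub>R iexp (z * \<xi>) \<partial>lborel) =
    of_real (sqrt (2 * pi / S) * exp ((\<kappa>\<^sup>2 - z\<^sup>2) / (2 * S))) * iexp (z * \<kappa> / S)"
proof -
  have "(\<integral>\<xi>. exp (\<kappa> * \<xi> - S * \<xi>\<^sup>2 / 2) *\<^sub>R iexp (z * \<xi>) \<partial>lborel) =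
     (\<integral>\<xi>. (sqrt (2 * pi / S) * exp (\<kappa>\<^sup>2 / (2 * S))) *\<^sub>R (normal_density (\<kappa> / S) (1 / sqrt S) \<xi> *\<^sub>R iexp (z * \<xi>)) \<partial>lborel)"
    unfolding normal_density_exp_form[OF assms] by simp
  also have "\<dots> = (sqrt (2 * pi / S) * exp (\<kappa>\<^sup>2 / (2 * S))) *\<^sub>R
      (\<integral>\<xi>. normal_density (\<kappa> / S) (1 / sqrt S) \<xi> *\<^sub>R iexp (z * \<xi>) \<partial>lborel)"
    by (rule integral_scaleR_right)
  also have "(\<integral>\<xi>. normal_density (\<kappa> / S) (1 / sqrt S) \<xi> *\<^sub>R iexp (z * \<xi>) \<partial>lborel) =
      exp (\<i> * of_real (z * (\<kappa> / S)) - of_real (z\<^sup>2 * (1 / sqrt S)\<^sup>2 / 2))"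
    using assms by (intro integral_normal_iexp) simp
  also have "\<dots> = iexp (z * \<kappa> / S) * of_real (exp (- z\<^sup>2 / (2 * S)))"
    unfolding exp_diff_of_real using assms by (simp add: power_divide mult_ac)
  also have "(sqrt (2 * pi / S) * exp (\<kappa>\<^sup>2 / (2 * S))) *\<^sub>R (iexp (z * \<kappa> / S) * of_real (exp (- z\<^sup>2 / (2 * S))))
      = of_real (sqrt (2 * pi / S) * (exp (\<kappa>\<^sup>2 / (2 * S)) * exp (- z\<^sup>2 / (2 * S)))) * iexp (z * \<kappa> / S)"
    by (simp only: scaleR_conv_of_real of_real_mult mult_ac)
  also have "exp (\<kappa>\<^sup>2 / (2 * S)) * exp (- z\<^sup>2 / (2 * S)) = exp ((\<kappa>\<^sup>2 - z\<^sup>2) / (2 * S))"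
    by (simp add: exp_add[symmetric] diff_divide_distrib)
  finally show ?thesis .
qed

text \<open>Written as a superposition of exponentials, the likelihood of one observation can be averaged over
  a Gaussian process by means of characteristic functions of linear functionals alone.\<close>

lemma normal_density_fourier:
  assumes "\<sigma> > 0"
  shows "of_real (2 * pi * normal_density \<mu> \<sigma> y) =
    (\<integral>\<xi>. exp (- \<sigma>\<^sup>2 * \<xi>\<^sup>2 / 2) *\<^sub>R iexp ((y - \<mu>) * \<xi>) \<partial>lborel)"
proof -
  have "2 * pi * normal_density \<mu> \<sigma> y = sqrt (2 * pi / \<sigma>\<^sup>2) * exp (- (y - \<mu>)\<^sup>2 / (2 * \<sigma>\<^sup>2))"
    using assms by (simp add: normal_density_def real_sqrt_mult real_sqrt_divide field_simps)
  with integral_exp_quadratic_iexp[of "\<sigma>\<^sup>2" 0 "y - \<mu>"] assms show ?thesis by simp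
qed

lemma real_distribution_normal_law:
  assumes "v \<ge> 0"
  shows "real_distribution (normal_law m v)"
proof (cases "v = 0")
  case True
  then show ?thesis
    by (auto simp: normal_law_def real_distribution_def real_distribution_axioms_def intro!: prob_space_return)
next
  case False
  then show ?thesis using assms
    by (auto simp: normal_law_def real_distribution_def real_distribution_axioms_def
        intro!: prob_space_normal_density)
qed

lemma char_normal_law:
  assumes "v \<ge> 0"
  shows "char (normal_law m v) t = exp (\<i> * of_real (t * m) - of_real (t\<^sup>2 * v / 2))"
proof (cases "v = 0")
  case True
  then show ?thesis unfolding char_def normal_law_def by (simp add: integral_return)
next
  case False
  then have "v > 0" using assms by simp
  have "char (normal_law m v) t = (\<integral>x. normal_density m (sqrt v) x *\<^sub>R iexp (t * x) \<partial>lborel)"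
    unfolding char_def normal_law_def using False by (simp add: integral_density)
  also have "\<dots> = exp (\<i> * of_real (t * m) - of_real (t\<^sup>2 * (sqrt v)\<^sup>2 / 2))"
    using \<open>v > 0\<close> by (intro integral_normal_iexp) simp
  finally show ?thesis using assms by simp
qed

lemma nn_integral_normal_law_sq:
  assumes "v \<ge> 0"
  shows "(\<integral>\<^sup>+x. ennreal ((x - t)\<^sup>2) \<partial>normal_law m v) = ennreal ((m - t)\<^sup>2 + v)"
proof (cases "v = 0")
  case True
  then show ?thesis by (simp add: normal_law_def nn_integral_return)
next
  case False
  then have s: "sqrt v > 0" using assms by simp
  let ?d = "normal_density m (sqrt v)"
  have d: "has_bochner_integral lborel ?d 1"
    using integrable_normal_density[OF s] integral_normal_density[OF s] by (simp add: has_bochner_integral_iff)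
  have "has_bochner_integral lborel (\<lambda>x. ?d x * (x - m) ^ 2 + (2 * (m - t)) * (?d x * (x - m) ^ 1) + (m - t)\<^sup>2 * ?d x)
      (v + (2 * (m - t)) * 0 + (m - t)\<^sup>2 * 1)"
    using normal_moment_even[OF s, of m 1] normal_moment_odd[OF s, of m 0] assms d
    by (intro has_bochner_integral_add has_bochner_integral_mult_right) auto
  also have "(\<lambda>x. ?d x * (x - m) ^ 2 + (2 * (m - t)) * (?d x * (x - m) ^ 1) + (m - t)\<^sup>2 * ?d x) = (\<lambda>x. ?d x * (x - t)\<^sup>2)"
    by (auto simp: fun_eq_iff power2_eq_square algebra_simps)
  finally have *: "has_bochner_integral lborel (\<lambda>x. ?d x * (x - t)\<^sup>2) ((m - t)\<^sup>2 + v)"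
    by (simp add: add.commute)
  have "(\<integral>\<^sup>+x. ennreal ((x - t)\<^sup>2) \<partial>normal_law m v) = (\<integral>\<^sup>+x. ennreal (?d x * (x - t)\<^sup>2) \<partial>lborel)"
    using False by (simp add: normal_law_def nn_integral_density ennreal_mult)
  also have "\<dots> = ennreal ((m - t)\<^sup>2 + v)"
    using * by (subst nn_integral_eq_integral) (auto simp: has_bochner_integral_iff)
  finally show ?thesis .
qed

text \<open>The point \<open>p\<close> may or may not lie in \<open>I\<close>; the coefficients on the left represent the functional
  \<open>\<Sum>\<^sub>x u x * f x - \<xi> * f p\<close> over distinct points in both cases.\<close>

lemma sum_insert_signed:
  fixes g :: "'a \<Rightarrow> real"
  assumes "finite I"
  shows "(\<Sum>x\<in>insert p I. ((if x \<in> I then u x else 0) - (if x = p then \<xi> else 0)) * g x)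
     = (\<Sum>x\<in>I. u x * g x) - \<xi> * g p"
proof -
  have "(\<Sum>x\<in>insert p I. ((if x \<in> I then u x else 0) - (if x = p then \<xi> else 0)) * g x)
      = (\<Sum>x\<in>insert p I. if x \<in> I then u x * g x else 0) - (\<Sum>x\<in>insert p I. if x = p then \<xi> * g x else 0)"
    unfolding sum_subtractf[symmetric] by (intro sum.cong refl) (auto simp: algebra_simps)
  also have "(\<Sum>x\<in>insert p I. if x \<in> I then u x * g x else 0) = (\<Sum>x\<in>I. u x * g x)"
    using assms by (subst sum.inter_restrict[symmetric]) (auto intro!: sum.cong)
  finally show ?thesis using assms by simp
qed

lemma quad_insert_signed:
  fixes k :: "'a \<Rightarrow> 'a \<Rightarrow> real" and u :: "'a \<Rightarrow> real" and \<xi> :: real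
  assumes I: "finite I" and sym: "\<And>x. x \<in> I \<Longrightarrow> k p x = k x p"
  defines "w \<equiv> \<lambda>x. (if x \<in> I then u x else 0) - (if x = p then \<xi> else 0)"
  shows "(\<Sum>x\<in>insert p I. \<Sum>y\<in>insert p I. w x * w y * k x y) =
    (\<Sum>x\<in>I. \<Sum>y\<in>I. u x * u y * k x y) - 2 * \<xi> * (\<Sum>x\<in>I. u x * k x p) + \<xi>\<^sup>2 * k p p"
proof -
  have "(\<Sum>x\<in>insert p I. \<Sum>y\<in>insert p I. w x * w y * k x y)
      = (\<Sum>x\<in>insert p I. w x * (\<Sum>y\<in>insert p I. w y * k x y))"
    by (simp only: sum_distrib_left mult.assoc)
  also have "\<dots> = (\<Sum>x\<in>insert p I. w x * ((\<Sum>y\<in>I. u y * k x y) - \<xi> * k x p))"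
    unfolding w_def sum_insert_signed[OF I] ..
  also have "\<dots> = (\<Sum>x\<in>I. u x * ((\<Sum>y\<in>I. u y * k x y) - \<xi> * k x p)) - \<xi> * ((\<Sum>y\<in>I. u y * k p y) - \<xi> * k p p)"
    unfolding w_def sum_insert_signed[OF I] ..
  also have "(\<Sum>y\<in>I. u y * k p y) = (\<Sum>y\<in>I. u y * k y p)"
    by (simp add: sym)
  also have "(\<Sum>x\<in>I. u x * ((\<Sum>y\<in>I. u y * k x y) - \<xi> * k x p))
      = (\<Sum>x\<in>I. \<Sum>y\<in>I. u x * u y * k x y) - \<xi> * (\<Sum>x\<in>I. u x * k x p)"
    by (simp add: right_diff_distrib sum_subtractf sum_distrib_left mult_ac)
  finally show ?thesis by (simp add: power2_eq_square algebra_simps)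
qed

lemma quad_minus_rank_one:
  fixes k :: "'a \<Rightarrow> 'a \<Rightarrow> real"
  assumes "\<And>y. y \<in> I \<Longrightarrow> k p y = k y p"
  shows "(\<Sum>x\<in>I. \<Sum>y\<in>I. z x * z y * (k x y - k x p * k p y / S)) =
    (\<Sum>x\<in>I. \<Sum>y\<in>I. z x * z y * k x y) - (\<Sum>x\<in>I. z x * k x p)\<^sup>2 / S"
proof -
  have "(\<Sum>x\<in>I. \<Sum>y\<in>I. z x * z y * (k x p * k p y / S)) = (\<Sum>x\<in>I. \<Sum>y\<in>I. (z x * k x p) * (z y * k y p)) / S"
    by (simp add: sum_divide_distrib assms mult_ac)
  also have "\<dots> = (\<Sum>x\<in>I. z x * k x p)\<^sup>2 / S" by (simp add: power2_eq_square sum_product)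
  finally show ?thesis by (simp add: right_diff_distrib sum_subtractf)
qed

lemma GP_law_measurable:
  assumes "GP_law m k P"
  shows "(\<lambda>f. f x) \<in> borel_measurable P"
proof -
  have "(\<lambda>f. f x) \<in> borel_measurable path_space"
    unfolding path_space_def
    by (intro measurable_restrict_space1 measurable_component_singleton) auto
  then show ?thesis using assms measurable_cong_sets[of P path_space borel borel] by (auto simp: GP_law_def)
qed

text \<open>Positivity of the covariance is needed here because \<open>normal_law\<close> reads a negative variance \<open>v\<close> as \<open>\<bar>v\<bar>\<close>.\<close>

lemma GP_law_char:
  assumes GP: "GP_law m k P" and psd: "psd_on I k" and I: "finite I"
  shows "(\<integral>f. iexp (\<Sum>x\<in>I. u x * f x) \<partial>P) =
    exp (\<i> * of_real (\<Sum>x\<in>I. u x * m x) - of_real ((\<Sum>x\<in>I. \<Sum>y\<in>I. u x * u y * k x y) / 2))"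
proof -
  note [measurable] = GP_law_measurable[OF GP]
  have "(\<integral>f. iexp (\<Sum>x\<in>I. u x * f x) \<partial>P) = char (distr P borel (\<lambda>f. \<Sum>x\<in>I. u x * f x)) 1"
    unfolding char_def by (subst integral_distr) auto
  also have "distr P borel (\<lambda>f. \<Sum>x\<in>I. u x * f x)
      = normal_law (\<Sum>x\<in>I. u x * m x) (\<Sum>x\<in>I. \<Sum>x'\<in>I. u x * u x' * k x x')"
    using GP I unfolding GP_law_def by blast
  finally show ?thesis
    by (simp add: char_normal_law psd_onD(2)[OF psd])
qed

text \<open>Use positivity at the coefficient vector that subtracts from \<open>\<Sum>\<^sub>x z x f(x)\<close> the multiple \<open>c/S\<close> of \<open>f(p)\<close>,
  where \<open>c\<close> is the covariance of the two.\<close>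

lemma psd_update:
  fixes k :: "'a \<Rightarrow> 'a \<Rightarrow> real"
  assumes psd: "psd_on (insert p I) k" and I: "finite I" and S: "k p p < S"
  shows "psd_on I (\<lambda>x y. k x y - k x p * k p y / S)"
proof (rule psd_onI)
  note sym = psd_onD(1)[OF psd]
  show "k x y - k x p * k p y / S = k y x - k y p * k p x / S" if "x \<in> I" "y \<in> I" for x y
    using that sym[of x y] sym[of p x] sym[of p y] by simp
  have "0 \<le> k p p" using psd_on_diag[OF psd] I by simp
  show "0 \<le> (\<Sum>x\<in>I. \<Sum>y\<in>I. z x * z y * (k x y - k x p * k p y / S))" for z
  proof -
    define c where "c = (\<Sum>x\<in>I. z x * k x p)"
    define q where "q = (\<Sum>x\<in>I. \<Sum>y\<in>I. z x * z y * k x y)"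
    have S0: "S > 0" using S \<open>0 \<le> k p p\<close> by simp
    have "0 \<le> q - 2 * (c / S) * c + (c / S)\<^sup>2 * k p p"
      using psd_onD(2)[OF psd, of "\<lambda>x. (if x \<in> I then z x else 0) - (if x = p then c / S else 0)"]
      unfolding c_def q_def by (subst (asm) quad_insert_signed[OF I]) (auto simp: sym)
    moreover have "(c / S)\<^sup>2 * k p p \<le> (c / S)\<^sup>2 * S"
      using S by (intro mult_left_mono) auto
    moreover have "(c / S)\<^sup>2 * S = c\<^sup>2 / S" using S0 by (simp add: power2_eq_square)
    ultimately have "0 \<le> q - c\<^sup>2 / S" by (simp add: power2_eq_square)
    moreover have "(\<Sum>x\<in>I. \<Sum>y\<in>I. z x * z y * (k x y - k x p * k p y / S)) = q - c\<^sup>2 / S"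
      unfolding q_def c_def by (rule quad_minus_rank_one) (simp add: sym)
    ultimately show ?thesis by simp
  qed
qed

lemma iexp_merge:
  fixes a q r w :: real
  shows "exp (\<i> * of_real a - of_real (q / 2)) * (of_real (exp (r / 2)) * iexp w) =
    exp (\<i> * of_real (a + w) - of_real ((q - r) / 2))"
  by (simp add: exp_of_real[symmetric] exp_add[symmetric] algebra_simps diff_divide_distrib)

lemma fourier_integrand_measurable:
  fixes c d \<sigma> y :: real
  shows "(\<lambda>\<xi>. exp (- \<sigma>\<^sup>2 * \<xi>\<^sup>2 / 2) *\<^sub>R (iexp ((y - c) * \<xi>) * iexp d)) \<in> borel_measurable lborel"
  by measurable

text \<open>Insert the Fourier representation of the likelihood and exchange the integrals: for each frequency
  the inner integral is the characteristic function of one linear functional of the process, and the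
  remaining one-dimensional Gaussian integral in the frequency completes the square.  Thus only the
  laws of linear combinations of evaluations enter, which is what \<open>GP_law\<close> provides.\<close>

lemma GP_law_tilt:
  fixes p y \<sigma> :: real
  assumes GP: "GP_law m k P" and psd: "psd_on (insert p I) k" and I: "finite I" and \<sigma>: "\<sigma> > 0"
    and kp: "0 \<le> k p p"
  defines "S \<equiv> \<sigma>\<^sup>2 + k p p"
  shows "(\<integral>f. normal_density (f p) \<sigma> y *\<^sub>R iexp (\<Sum>x\<in>I. u x * f x) \<partial>P) =
    normal_density (m p) (sqrt S) y *\<^sub>R
      exp (\<i> * of_real (\<Sum>x\<in>I. u x * (m x + k x p / S * (y - m p)))
        - of_real ((\<Sum>x\<in>I. \<Sum>x'\<in>I. u x * u x' * (k x x' - k x p * k p x' / S)) / 2))"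
proof -
  note [measurable] = GP_law_measurable[OF GP]
  interpret P: prob_space P using GP by (simp add: GP_law_def)
  interpret pair_sigma_finite P lborel ..
  note sym = psd_onD(1)[OF psd]
  have S0: "S > 0" using \<sigma> kp by (simp add: S_def add_pos_nonneg)
  define c where "c = (\<Sum>x\<in>I. u x * k x p)"
  define q where "q = (\<Sum>x\<in>I. \<Sum>y\<in>I. u x * u y * k x y)"
  define a where "a = (\<Sum>x\<in>I. u x * m x)"
  define F where "F f \<xi> = exp (- \<sigma>\<^sup>2 * \<xi>\<^sup>2 / 2) *\<^sub>R (iexp ((y - f p) * \<xi>) * iexp (\<Sum>x\<in>I. u x * f x))" for f \<xi>
  have [measurable]: "case_prod F \<in> borel_measurable (P \<Otimes>\<^sub>M lborel)"
    unfolding F_def by measurable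
  have nF: "norm (F f \<xi>) = exp (0 * \<xi> - \<sigma>\<^sup>2 * \<xi>\<^sup>2 / 2)" for f \<xi> by (simp add: F_def norm_mult)
  have gi: "integrable lborel (\<lambda>\<xi>. exp (0 * \<xi> - \<sigma>\<^sup>2 * \<xi>\<^sup>2 / 2) :: real)"
    using \<sigma> by (intro integrable_exp_quadratic) simp
  have int: "integrable (P \<Otimes>\<^sub>M lborel) (case_prod F)"
  proof (rule Fubini_integrable)
    show "integrable P (\<lambda>f. \<integral>\<xi>. norm (case_prod F (f, \<xi>)) \<partial>lborel)"
      by (simp add: nF del: mult_zero_left)
    show "AE f in P. integrable lborel (\<lambda>\<xi>. case_prod F (f, \<xi>))"
    proof (rule AE_I2)
      fix f assume "f \<in> space P"
      have "(\<lambda>\<xi>. F f \<xi>) \<in> borel_measurable lborel"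
        unfolding F_def by (rule fourier_integrand_measurable)
      then show "integrable lborel (\<lambda>\<xi>. case_prod F (f, \<xi>))"
        by (intro Bochner_Integration.integrable_bound[OF gi]) (auto simp: nF)
    qed
  qed simp
  have "(2 * pi) *\<^sub>R (\<integral>f. normal_density (f p) \<sigma> y *\<^sub>R iexp (\<Sum>x\<in>I. u x * f x) \<partial>P)
      = (\<integral>f. of_real (2 * pi * normal_density (f p) \<sigma> y) * iexp (\<Sum>x\<in>I. u x * f x) \<partial>P)"
    by (subst integral_scaleR_right[symmetric]) (simp add: scaleR_conv_of_real mult.assoc)
  also have "\<dots> = (\<integral>f. (\<integral>\<xi>. F f \<xi> \<partial>lborel) \<partial>P)"
    unfolding normal_density_fourier[OF \<sigma>] F_def
    by (subst integral_mult_left_zero[symmetric]) simp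
  also have "\<dots> = (\<integral>\<xi>. (\<integral>f. F f \<xi> \<partial>P) \<partial>lborel)"
    using Fubini_integral[OF int] by simp
  also have "\<dots> = (\<integral>\<xi>. exp (\<i> * of_real a - of_real (q / 2)) * (exp (c * \<xi> - S * \<xi>\<^sup>2 / 2) *\<^sub>R iexp ((y - m p) * \<xi>)) \<partial>lborel)"
  proof (intro Bochner_Integration.integral_cong refl)
    fix \<xi> :: real
    let ?w = "\<lambda>x. (if x \<in> I then u x else 0) - (if x = p then \<xi> else 0)"
    have "(\<integral>f. F f \<xi> \<partial>P) = (\<integral>f. (exp (- \<sigma>\<^sup>2 * \<xi>\<^sup>2 / 2) *\<^sub>R iexp (y * \<xi>)) * iexp (\<Sum>x\<in>insert p I. ?w x * f x) \<partial>P)"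
      unfolding F_def sum_insert_signed[OF I]
      by (intro Bochner_Integration.integral_cong refl) (simp add: exp_add[symmetric] algebra_simps)
    also have "\<dots> = (exp (- \<sigma>\<^sup>2 * \<xi>\<^sup>2 / 2) *\<^sub>R iexp (y * \<xi>)) * (\<integral>f. iexp (\<Sum>x\<in>insert p I. ?w x * f x) \<partial>P)"
      by simp
    also have "(\<integral>f. iexp (\<Sum>x\<in>insert p I. ?w x * f x) \<partial>P)
        = exp (\<i> * of_real (a - \<xi> * m p) - of_real ((q - 2 * \<xi> * c + \<xi>\<^sup>2 * k p p) / 2))"
      unfolding a_def q_def c_def
      by (subst GP_law_char[OF GP psd], simp add: I, subst sum_insert_signed[OF I], subst quad_insert_signed[OF I])
        (auto simp: sym)
    finally show "(\<integral>f. F f \<xi> \<partial>P) = exp (\<i> * of_real a - of_real (q / 2)) * (exp (c * \<xi> - S * \<xi>\<^sup>2 / 2) *\<^sub>R iexp ((y - m p) * \<xi>))"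
      by (simp add: scaleR_conv_of_real exp_of_real[symmetric] exp_add[symmetric] S_def field_simps)
  qed
  also have "\<dots> = exp (\<i> * of_real a - of_real (q / 2)) *
      (of_real (sqrt (2 * pi / S) * exp ((c\<^sup>2 - (y - m p)\<^sup>2) / (2 * S))) * iexp ((y - m p) * c / S))"
    by (subst integral_mult_right_zero, subst integral_exp_quadratic_iexp[OF S0]) (rule refl)
  also have "\<dots> = (2 * pi * normal_density (m p) (sqrt S) y) *\<^sub>R
      exp (\<i> * of_real (a + c / S * (y - m p)) - of_real ((q - c\<^sup>2 / S) / 2))"
  proof -
    have "sqrt (2 * pi / S) * exp ((c\<^sup>2 - (y - m p)\<^sup>2) / (2 * S)) = 2 * pi * normal_density (m p) (sqrt S) y * exp (c\<^sup>2 / S / 2)"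
    proof -
      have "sqrt (2 * pi / S) = sqrt ((2 * pi)\<^sup>2 / (2 * pi * S))"
        by (simp add: power2_eq_square)
      also have "\<dots> = 2 * pi / sqrt (2 * pi * S)"
        by (subst real_sqrt_divide, subst real_sqrt_abs) simp
      finally have 1: "sqrt (2 * pi / S) = 2 * pi / sqrt (2 * pi * S)" .
      have 2: "exp ((c\<^sup>2 - (y - m p)\<^sup>2) / (2 * S)) = exp (- (y - m p)\<^sup>2 / (2 * S)) * exp (c\<^sup>2 / S / 2)"
        by (simp add: exp_add[symmetric] diff_divide_distrib)
      show ?thesis unfolding 1 2 normal_density_def using S0 by simp
    qed
    moreover have "(y - m p) * c / S = c / S * (y - m p)" by simp
    ultimately show ?thesis
      unfolding iexp_merge[symmetric] by (simp only: scaleR_conv_of_real of_real_mult mult_ac)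
  qed
  also have "a + c / S * (y - m p) = (\<Sum>x\<in>I. u x * (m x + k x p / S * (y - m p)))"
    by (simp add: a_def c_def distrib_left sum.distrib sum_distrib_right sum_divide_distrib mult.assoc)
  also have "q - c\<^sup>2 / S = (\<Sum>x\<in>I. \<Sum>x'\<in>I. u x * u x' * (k x x' - k x p * k p x' / S))"
    unfolding q_def c_def by (rule quad_minus_rank_one[symmetric]) (simp add: sym)
  finally show ?thesis by (simp add: scaleR_conv_of_real)
qed


text \<open>Conditioning on one noisy observation \<open>y\<close> at \<open>p\<close>.  The previous lemma gives all characteristic functions
  of the reweighted process, which identify the law of each linear functional; the empty functional
  gives the normalising constant.\<close>

lemma GP_law_update:
  fixes p y \<sigma> :: real
  assumes GP: "GP_law m k P" and psd: "\<And>I. finite I \<Longrightarrow> psd_on I k" and \<sigma>: "\<sigma> > 0"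
  defines "S \<equiv> \<sigma>\<^sup>2 + k p p"
  defines "z \<equiv> normal_density (m p) (sqrt S) y"
  shows "z > 0"
    and "(\<integral>\<^sup>+f. ennreal (normal_density (f p) \<sigma> y) \<partial>P) = ennreal z"
    and "GP_law (\<lambda>x. m x + k x p / S * (y - m p)) (\<lambda>x x'. k x x' - k x p * k p x' / S)
      (density P (\<lambda>f. ennreal (normal_density (f p) \<sigma> y / z)))"
proof -
  note GP_law_measurable[OF GP, measurable]
  interpret P: prob_space P using GP by (simp add: GP_law_def)
  have kp: "0 \<le> k p p" using psd_on_diag[OF psd[of "{p}"], of p] by simp
  have S: "S > k p p" "S > 0" using \<sigma> kp by (auto simp: S_def add_pos_nonneg)
  show z: "z > 0" using S unfolding z_def by (intro normal_density_pos) simp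
  define L where "L f = normal_density (f p) \<sigma> y" for f
  have [measurable]: "L \<in> borel_measurable P" unfolding L_def normal_density_def by measurable
  have L0: "L f \<ge> 0" for f by (simp add: L_def)
  have intL: "integrable P L"
  proof (rule P.integrable_const_bound[where B="1 / sqrt (2 * pi * \<sigma>\<^sup>2)"])
    show "AE f in P. norm (L f) \<le> 1 / sqrt (2 * pi * \<sigma>\<^sup>2)"
      using \<sigma> by (intro AE_I2) (auto simp: L_def normal_density_def intro!: divide_right_mono)
  qed simp
  \<comment> \<open>the total mass of the reweighted process, from the empty linear functional\<close>
  have "complex_of_real (\<integral>f. L f \<partial>P) = (\<integral>f. normal_density (f p) \<sigma> y *\<^sub>R iexp (\<Sum>x\<in>{}. 0 * f x) \<partial>P)"
    by (simp add: L_def scaleR_conv_of_real)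
  also have "\<dots> = of_real z"
    by (subst GP_law_tilt[OF GP psd _ \<sigma> kp]) (auto simp: z_def S_def scaleR_conv_of_real)
  finally have iL: "(\<integral>f. L f \<partial>P) = z" by (simp only: of_real_eq_iff)
  have nL: "(\<integral>\<^sup>+f. ennreal (L f) \<partial>P) = ennreal z"
    using nn_integral_eq_integral[OF intL] L0 iL by simp
  then show nn: "(\<integral>\<^sup>+f. ennreal (normal_density (f p) \<sigma> y) \<partial>P) = ennreal z"
    unfolding L_def .
  let ?P = "density P (\<lambda>f. ennreal (normal_density (f p) \<sigma> y / z))"
  have P': "?P = density P (\<lambda>f. ennreal (L f / z))" by (simp add: L_def)
  have "emeasure ?P (space ?P) = (\<integral>\<^sup>+f. ennreal (L f / z) \<partial>P)"
    unfolding P' by (subst emeasure_density) (auto intro!: nn_integral_cong)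
  also have "\<dots> = (\<integral>\<^sup>+f. ennreal (L f) * ennreal (inverse z) \<partial>P)"
    using z L0 by (intro nn_integral_cong) (simp add: ennreal_mult[symmetric] divide_inverse)
  also have "\<dots> = ennreal z * ennreal (inverse z)"
    by (subst nn_integral_multc) (simp_all add: nL)
  also have "\<dots> = 1" using z by (simp add: ennreal_mult[symmetric])
  finally interpret P': prob_space ?P by (rule prob_spaceI)
  show "GP_law (\<lambda>x. m x + k x p / S * (y - m p)) (\<lambda>x x'. k x x' - k x p * k p x' / S) ?P"
    unfolding GP_law_def
  proof (intro conjI allI impI)
    show "prob_space ?P" by (rule P'.prob_space_axioms)
    show "space ?P = space path_space" "sets ?P = sets path_space"
      using GP by (auto simp: GP_law_def)
    fix I :: "real set" and u assume I: "finite I"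
    define a where "a = (\<Sum>x\<in>I. u x * (m x + k x p / S * (y - m p)))"
    define q where "q = (\<Sum>x\<in>I. \<Sum>x'\<in>I. u x * u x' * (k x x' - k x p * k p x' / S))"
    have q0: "q \<ge> 0"
      unfolding q_def using psd_update[OF psd I S(1)] I by (intro psd_onD(2)[where G="\<lambda>x x'. k x x' - k x p * k p x' / S"]) auto
    have meas: "(\<lambda>f. \<Sum>x\<in>I. u x * f x) \<in> measurable ?P borel" by simp
    show "distr ?P borel (\<lambda>f. \<Sum>x\<in>I. u x * f x) = normal_law a q"
    proof (rule Levy_uniqueness)
      show "real_distribution (distr ?P borel (\<lambda>f. \<Sum>x\<in>I. u x * f x))"
        using P'.prob_space_distr[OF meas] by (simp add: real_distribution_def real_distribution_axioms_def)
      show "real_distribution (normal_law a q)" by (rule real_distribution_normal_law[OF q0])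
      show "char (distr ?P borel (\<lambda>f. \<Sum>x\<in>I. u x * f x)) = char (normal_law a q)"
      proof
        fix t
        have "char (distr ?P borel (\<lambda>f. \<Sum>x\<in>I. u x * f x)) t = (\<integral>f. iexp (t * (\<Sum>x\<in>I. u x * f x)) \<partial>?P)"
          unfolding char_def by (subst integral_distr[OF meas]) auto
        also have "\<dots> = (\<integral>f. (L f / z) *\<^sub>R iexp (t * (\<Sum>x\<in>I. u x * f x)) \<partial>P)"
          unfolding P' using L0 z by (subst integral_density) auto
        also have "\<dots> = (\<integral>f. inverse z *\<^sub>R (normal_density (f p) \<sigma> y *\<^sub>R iexp (\<Sum>x\<in>I. (t * u x) * f x)) \<partial>P)"
          by (intro Bochner_Integration.integral_cong refl)
            (simp add: L_def divide_inverse sum_distrib_left mult_ac)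
        also have "\<dots> = inverse z *\<^sub>R (\<integral>f. normal_density (f p) \<sigma> y *\<^sub>R iexp (\<Sum>x\<in>I. (t * u x) * f x) \<partial>P)"
          by (rule integral_scaleR_right)
        also have "(\<integral>f. normal_density (f p) \<sigma> y *\<^sub>R iexp (\<Sum>x\<in>I. (t * u x) * f x) \<partial>P) =
          z *\<^sub>R exp (\<i> * of_real (t * a) - of_real (t\<^sup>2 * q / 2))"
        proof -
          have "(\<Sum>x\<in>I. (t * u x) * (m x + k x p / S * (y - m p))) = t * a"
            unfolding a_def sum_distrib_left by (simp only: mult_ac)
          moreover have "(\<Sum>x\<in>I. \<Sum>x'\<in>I. (t * u x) * (t * u x') * (k x x' - k x p * k p x' / S)) = t\<^sup>2 * q"
            unfolding q_def sum_distrib_left power2_eq_square by (simp only: mult_ac)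
          ultimately show ?thesis
            using GP_law_tilt[OF GP psd[of "insert p I"] I \<sigma> kp, of y "\<lambda>x. t * u x"] I
            unfolding z_def S_def by (simp only: finite_insert simp_thms)
        qed
        finally show "char (distr ?P borel (\<lambda>f. \<Sum>x\<in>I. u x * f x)) t = char (normal_law a q) t"
          using z by (simp add: char_normal_law[OF q0])
      qed
    qed
  qed
qed

lemma GP_law_second_moment:
  assumes GP: "GP_law m k P" and k: "k x x \<ge> 0"
  shows "(\<integral>\<^sup>+f. ennreal ((f x - t)\<^sup>2) \<partial>P) = ennreal ((m x - t)\<^sup>2 + k x x)"
proof -
  note [measurable] = GP_law_measurable[OF GP]
  have "\<forall>I u. finite I \<longrightarrow> distr P borel (\<lambda>f. \<Sum>x\<in>I. u x * f x) =
      normal_law (\<Sum>x\<in>I. u x * m x) (\<Sum>x\<in>I. \<Sum>x'\<in>I. u x * u x' * k x x')"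
    using GP unfolding GP_law_def by blast
  from this[rule_format, of "{x}" "\<lambda>_. 1"]
  have d: "distr P borel (\<lambda>f. f x) = normal_law (m x) (k x x)" by simp
  have "(\<integral>\<^sup>+f. ennreal ((f x - t)\<^sup>2) \<partial>P) = (\<integral>\<^sup>+y. ennreal ((y - t)\<^sup>2) \<partial>distr P borel (\<lambda>f. f x))"
    by (subst nn_integral_distr) auto
  then show ?thesis unfolding d using nn_integral_normal_law_sq[OF k] by simp
qed

text \<open>Posterior covariance after observing at \<open>X 1, ..., X n\<close> with unit noise variance, one observation at a
  time.  The recursion avoids inverting a Gram matrix and makes measurability in the design immediate.\<close>

primrec post_cov :: "('a \<Rightarrow> 'a \<Rightarrow> real) \<Rightarrow> (nat \<Rightarrow> 'a) \<Rightarrow> nat \<Rightarrow> 'a \<Rightarrow> 'a \<Rightarrow> real" where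
  "post_cov K X 0 = K"
| "post_cov K X (Suc n) = (\<lambda>x x'. post_cov K X n x x' -
     post_cov K X n x (X (Suc n)) * post_cov K X n (X (Suc n)) x' / (1 + post_cov K X n (X (Suc n)) (X (Suc n))))"

text \<open>Weights of the observations in the posterior mean: a new observation adds the gain \<open>g\<close> times its
  deviation from its current prediction, and that prediction has weights of its own.\<close>

primrec post_weight :: "('a \<Rightarrow> 'a \<Rightarrow> real) \<Rightarrow> (nat \<Rightarrow> 'a) \<Rightarrow> nat \<Rightarrow> 'a \<Rightarrow> nat \<Rightarrow> real" where
  "post_weight K X 0 = (\<lambda>x i. 0)"
| "post_weight K X (Suc n) = (\<lambda>x i.
     (let g = post_cov K X n x (X (Suc n)) / (1 + post_cov K X n (X (Suc n)) (X (Suc n)))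
      in if i = Suc n then g else post_weight K X n x i - g * post_weight K X n (X (Suc n)) i))"

lemma psd_post_cov:
  assumes "\<And>I. finite I \<Longrightarrow> psd_on I K" "finite I"
  shows "psd_on I (post_cov K X n)"
  using assms(2)
proof (induction n arbitrary: I)
  case 0
  then show ?case using assms by simp
next
  case (Suc n)
  then show ?case
    unfolding post_cov.simps by (intro psd_update) auto
qed

lemma post_cov_sym:
  assumes "\<And>I. finite I \<Longrightarrow> psd_on I K"
  shows "post_cov K X n x y = post_cov K X n y x"
  using psd_onD(1)[OF psd_post_cov[OF assms, of "{x, y}" X n], of x y] by simp

lemma post_cov_diag_nonneg:
  assumes "\<And>I. finite I \<Longrightarrow> psd_on I K"
  shows "0 \<le> post_cov K X n x x"
  using psd_on_diag[OF psd_post_cov[OF assms, of "{x}" X n], of x] by simp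

lemma post_cov_diag_le:
  assumes K: "\<And>I. finite I \<Longrightarrow> psd_on I K"
  shows "post_cov K X n x x \<le> K x x"
proof (induction n)
  case (Suc n)
  have "post_cov K X n x (X (Suc n)) * post_cov K X n (X (Suc n)) x = (post_cov K X n x (X (Suc n)))\<^sup>2"
    by (simp add: post_cov_sym[OF K, of X n x] power2_eq_square)
  then have "0 \<le> post_cov K X n x (X (Suc n)) * post_cov K X n (X (Suc n)) x / (1 + post_cov K X n (X (Suc n)) (X (Suc n)))"
    using post_cov_diag_nonneg[OF K, of X n "X (Suc n)"] by simp
  with Suc show ?case by simp
qed simp

lemma post_cov_eq:
  assumes K: "\<And>I. finite I \<Longrightarrow> psd_on I K"
  shows "post_cov K X n x x' = K x x' - (\<Sum>i=1..n. post_weight K X n x i * K (X i) x')"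
proof (induction n arbitrary: x x')
  case (Suc n)
  define p where "p = X (Suc n)"
  define g where "g = post_cov K X n x p / (1 + post_cov K X n p p)"
  have "(\<Sum>i=1..Suc n. post_weight K X (Suc n) x i * K (X i) x')
      = (\<Sum>i=1..n. (post_weight K X n x i - g * post_weight K X n p i) * K (X i) x') + g * K p x'"
    by (simp add: g_def p_def Let_def)
  also have "\<dots> = (\<Sum>i=1..n. post_weight K X n x i * K (X i) x') + g * (K p x' - (\<Sum>i=1..n. post_weight K X n p i * K (X i) x'))"
    by (simp add: left_diff_distrib right_diff_distrib sum_subtractf sum_distrib_left mult_ac)
  also have "\<dots> = K x x' - post_cov K X n x x' + g * post_cov K X n p x'"
    unfolding Suc[of p x', symmetric] using Suc[of x x'] by simp
  finally show ?case by (simp add: g_def p_def)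
qed simp

text \<open>With \<open>post_cov_eq\<close> this says that the weights solve the normal equations \<open>(I + G) w = K(X, x)\<close>.\<close>

lemma post_weight_normal_eq:
  assumes K: "\<And>I. finite I \<Longrightarrow> psd_on I K" and j: "j \<in> {1..n}"
  shows "post_weight K X n x j = post_cov K X n x (X j)"
  using j
proof (induction n arbitrary: x)
  case (Suc n)
  define p where "p = X (Suc n)"
  have pos: "1 + post_cov K X n p p > 0" using post_cov_diag_nonneg[OF K, of X n p] by simp
  show ?case
  proof (cases "j = Suc n")
    case True
    then show ?thesis using pos by (simp add: p_def[symmetric] Let_def field_simps)
  next
    case False
    then have "j \<in> {1..n}" using Suc.prems by auto
    with False show ?thesis
      by (simp add: Suc.IH[symmetric] Let_def p_def[symmetric])
  qed
qed simp

text \<open>The posterior variance is the mean squared prediction error under the prior, namely the prior variance of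
  \<open>f(x) - \<Sum> w\<^sub>i f(X\<^sub>i)\<close> plus the noise variance \<open>\<Sum> w\<^sub>i\<^sup>2\<close> of the estimator.\<close>

lemma post_weight_sq_le:
  assumes K: "\<And>I. finite I \<Longrightarrow> psd_on I K"
  shows "(\<Sum>i=1..n. (post_weight K X n x i)\<^sup>2) \<le> post_cov K X n x x"
proof -
  define w where "w = post_weight K X n x"
  define Z where "Z = X(Suc n := x)"
  define c where "c = (\<Sum>i=1..n. w i * K x (X i))"
  define q where "q = (\<Sum>i=1..n. \<Sum>j=1..n. w i * w j * K (X i) (X j))"
  have sym: "K y z = K z y" for y z using post_cov_sym[OF K, of X 0] by simp
  have psd: "psd_on (insert (Suc n) {1..n}) (\<lambda>i j. K (Z i) (Z j))"
    by (rule psd_on_pullback[where p=Z]) (auto intro: K)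
  have "0 \<le> (\<Sum>i\<in>insert (Suc n) {1..n}. \<Sum>j\<in>insert (Suc n) {1..n}.
      (if i = Suc n then 1 else - w i) * (if j = Suc n then 1 else - w j) * K (Z i) (Z j))"
    by (rule psd_onD(2)[OF psd])
  also have "\<dots> = q - 2 * c + K x x"
    by (subst quad_insert) (auto simp: q_def c_def Z_def sym sum_negf intro!: sum.cong arg_cong2[where f="(+)"])
  finally have "2 * c - q \<le> K x x" by simp
  moreover have "(\<Sum>i=1..n. (w i)\<^sup>2) = c - q"
  proof -
    have "(\<Sum>j=1..n. (w j)\<^sup>2) = (\<Sum>j=1..n. w j * (K x (X j) - (\<Sum>i=1..n. w i * K (X i) (X j))))"
    proof (intro sum.cong refl)
      fix j assume "j \<in> {1..n}"
      then have "w j = K x (X j) - (\<Sum>i=1..n. w i * K (X i) (X j))"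
        using post_weight_normal_eq[OF K, of j n X x] post_cov_eq[OF K, of X n x "X j"] by (simp add: w_def)
      then show "(w j)\<^sup>2 = w j * (K x (X j) - (\<Sum>i=1..n. w i * K (X i) (X j)))"
        by (simp add: power2_eq_square)
    qed
    also have "\<dots> = c - (\<Sum>j=1..n. \<Sum>i=1..n. w i * w j * K (X i) (X j))"
      by (simp add: c_def right_diff_distrib sum_subtractf sum_distrib_left mult_ac)
    also have "(\<Sum>j=1..n. \<Sum>i=1..n. w i * w j * K (X i) (X j)) = q"
      unfolding q_def by (rule sum.swap)
    finally show ?thesis .
  qed
  moreover have "post_cov K X n x x = K x x - c"
    using post_cov_eq[OF K, of X n x x] by (simp add: c_def w_def sym[of x "X i" for i])
  ultimately show ?thesis unfolding w_def[symmetric] by simp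
qed

lemma likelihood_Suc:
  "likelihood \<sigma> (Suc n) X Y f = likelihood \<sigma> n X Y f * normal_density (f (X (Suc n))) \<sigma> (Y (Suc n))"
  by (simp add: likelihood_def)

text \<open>With prior covariance \<open>\<sigma>\<^sup>2 K\<close> and noise variance \<open>\<sigma>\<^sup>2\<close> the noise level scales out of the weights and
  enters the covariance only as a factor.\<close>

lemma GP_law_iterated:
  assumes GP: "GP_law (\<lambda>x. 0) (\<lambda>x x'. \<sigma>\<^sup>2 * K x x') P" and K: "\<And>I. finite I \<Longrightarrow> psd_on I K" and \<sigma>: "\<sigma> > 0"
  shows "\<exists>z>0. (\<integral>\<^sup>+f. ennreal (likelihood \<sigma> n X Y f) \<partial>P) = ennreal z \<and>
    GP_law (\<lambda>x. \<Sum>i=1..n. post_weight K X n x i * Y i) (\<lambda>x x'. \<sigma>\<^sup>2 * post_cov K X n x x')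
      (density P (\<lambda>f. ennreal (likelihood \<sigma> n X Y f / z)))"
proof (induction n)
  case 0
  interpret prob_space P using GP by (simp add: GP_law_def)
  show ?case using GP emeasure_space_1
    by (intro exI[of _ 1]) (simp add: likelihood_def density_1)
next
  case (Suc n)
  then obtain z where z: "z > 0" and nz: "(\<integral>\<^sup>+f. ennreal (likelihood \<sigma> n X Y f) \<partial>P) = ennreal z"
    and GPn: "GP_law (\<lambda>x. \<Sum>i=1..n. post_weight K X n x i * Y i) (\<lambda>x x'. \<sigma>\<^sup>2 * post_cov K X n x x')
      (density P (\<lambda>f. ennreal (likelihood \<sigma> n X Y f / z)))" (is "GP_law ?m ?k ?P") by blast
  note [measurable] = GP_law_measurable[OF GP]
  define p where "p = X (Suc n)"
  define y where "y = Y (Suc n)"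
  define L where "L = likelihood \<sigma> n X Y"
  define l where "l f = normal_density (f p) \<sigma> y" for f
  have [measurable]: "L \<in> borel_measurable P" unfolding L_def likelihood_def normal_density_def by measurable
  have [measurable]: "l \<in> borel_measurable P" unfolding l_def normal_density_def by measurable
  have L0: "L f \<ge> 0" "l f \<ge> 0" for f by (simp_all add: L_def l_def likelihood_def prod_nonneg)
  have psdk: "psd_on I ?k" if "finite I" for I
  proof (rule psd_onI)
    fix zz :: "real \<Rightarrow> real"
    have "(\<Sum>x\<in>I. \<Sum>y\<in>I. zz x * zz y * (\<sigma>\<^sup>2 * post_cov K X n x y)) = \<sigma>\<^sup>2 * (\<Sum>x\<in>I. \<Sum>y\<in>I. zz x * zz y * post_cov K X n x y)"
      by (simp add: sum_distrib_left mult_ac)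
    then show "0 \<le> (\<Sum>x\<in>I. \<Sum>y\<in>I. zz x * zz y * (\<sigma>\<^sup>2 * post_cov K X n x y))"
      using psd_onD(2)[OF psd_post_cov[OF K that]] by simp
  qed (simp add: post_cov_sym[OF K, of X n])
  define S where "S = \<sigma>\<^sup>2 + ?k p p"
  define w where "w = normal_density (?m p) (sqrt S) y"
  have w: "w > 0" and nw: "(\<integral>\<^sup>+f. ennreal (l f) \<partial>?P) = ennreal w"
    and GPS: "GP_law (\<lambda>x. ?m x + ?k x p / S * (y - ?m p)) (\<lambda>x x'. ?k x x' - ?k x p * ?k p x' / S)
      (density ?P (\<lambda>f. ennreal (l f / w)))"
    using GP_law_update[OF GPn psdk \<sigma>, of p y] unfolding w_def S_def l_def by auto
  have Lik: "likelihood \<sigma> (Suc n) X Y = (\<lambda>f. L f * l f)"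
    by (auto simp: L_def l_def p_def y_def likelihood_Suc)
  have "ennreal w = (\<integral>\<^sup>+f. ennreal (L f / z) * ennreal (l f) \<partial>P)"
    unfolding nw[symmetric] L_def[symmetric] by (subst nn_integral_density) auto
  also have "\<dots> = (\<integral>\<^sup>+f. ennreal (L f * l f) * ennreal (inverse z) \<partial>P)"
    using z L0 by (intro nn_integral_cong) (simp add: ennreal_mult[symmetric] divide_inverse mult_ac)
  also have "\<dots> = (\<integral>\<^sup>+f. ennreal (L f * l f) \<partial>P) * ennreal (inverse z)"
    by (rule nn_integral_multc) simp
  finally have "ennreal w * ennreal z = (\<integral>\<^sup>+f. ennreal (L f * l f) \<partial>P) * (ennreal (inverse z) * ennreal z)"
    by (simp add: mult.assoc)
  then have nwz: "(\<integral>\<^sup>+f. ennreal (L f * l f) \<partial>P) = ennreal (w * z)"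
    using z w by (simp add: ennreal_mult[symmetric])
  have dens: "density ?P (\<lambda>f. ennreal (l f / w)) = density P (\<lambda>f. ennreal (L f * l f / (w * z)))"
    unfolding L_def[symmetric] using z w L0
    by (subst density_density_eq) (auto simp: ennreal_mult[symmetric] mult_ac)
  have S': "S = \<sigma>\<^sup>2 * (1 + post_cov K X n p p)" by (simp add: S_def algebra_simps)
  have mean: "?m x + ?k x p / S * (y - ?m p) = (\<Sum>i=1..Suc n. post_weight K X (Suc n) x i * Y i)" for x
  proof -
    define g where "g = post_cov K X n x p / (1 + post_cov K X n p p)"
    have "(\<Sum>i=1..Suc n. post_weight K X (Suc n) x i * Y i)
      = (\<Sum>i=1..n. (post_weight K X n x i - g * post_weight K X n p i) * Y i) + g * y"
      by (simp add: g_def p_def y_def Let_def)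
    also have "\<dots> = ?m x + g * (y - ?m p)"
      by (simp add: left_diff_distrib right_diff_distrib sum_subtractf sum_distrib_left mult_ac)
    also have "g = ?k x p / S" using \<sigma> by (simp add: S' g_def)
    finally show ?thesis by simp
  qed
  have cov: "?k x x' - ?k x p * ?k p x' / S = \<sigma>\<^sup>2 * post_cov K X (Suc n) x x'" for x x'
    using \<sigma> by (simp add: S' p_def[symmetric] right_diff_distrib power2_eq_square)
  show ?case
    using z w nwz GPS unfolding Lik dens mean cov by (intro exI[of _ "w * z"]) simp
qed

lemma posterior_GP_law:
  assumes GP: "GP_law (\<lambda>x. 0) (\<lambda>x x'. \<sigma>\<^sup>2 * K x x') P" and K: "\<And>I. finite I \<Longrightarrow> psd_on I K" and \<sigma>: "\<sigma> > 0"
  shows "GP_law (\<lambda>x. \<Sum>i=1..n. post_weight K X n x i * Y i) (\<lambda>x x'. \<sigma>\<^sup>2 * post_cov K X n x x')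
      (posterior \<sigma> P n X Y)"
proof -
  obtain z where z: "z > 0" and nz: "(\<integral>\<^sup>+f. ennreal (likelihood \<sigma> n X Y f) \<partial>P) = ennreal z"
    and GPn: "GP_law (\<lambda>x. \<Sum>i=1..n. post_weight K X n x i * Y i) (\<lambda>x x'. \<sigma>\<^sup>2 * post_cov K X n x x')
      (density P (\<lambda>f. ennreal (likelihood \<sigma> n X Y f / z)))"
    using GP_law_iterated[OF GP K \<sigma>, of n X Y] by blast
  have "posterior \<sigma> P n X Y = density P (\<lambda>f. ennreal (likelihood \<sigma> n X Y f / z))"
    unfolding posterior_def nz using z
    by (simp add: divide_ennreal likelihood_def prod_nonneg)
  with GPn show ?thesis by simp
qed

section \<open>Hermite polynomials and the eigenexpansion of the squared-exponential kernel\<close>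

primrec herm :: "nat \<Rightarrow> real poly" where
  "herm 0 = 1"
| "herm (Suc k) = [:0, 2:] * herm k - pderiv (herm k)"

lemma deriv_gauss: "(deriv ^^ k) (\<lambda>t. exp (- (t\<^sup>2))) = (\<lambda>x. (- 1) ^ k * poly (herm k) x * exp (- (x\<^sup>2)))"
proof (induction k)
  case (Suc k)
  show ?case
  proof
    fix x :: real
    have "((\<lambda>x. (- 1) ^ k * poly (herm k) x * exp (- (x\<^sup>2))) has_real_derivative
        (- 1) ^ Suc k * poly (herm (Suc k)) x * exp (- (x\<^sup>2))) (at x)"
      by (auto intro!: derivative_eq_intros simp: algebra_simps)
    then show "(deriv ^^ Suc k) (\<lambda>t. exp (- (t\<^sup>2))) x = (- 1) ^ Suc k * poly (herm (Suc k)) x * exp (- (x\<^sup>2))"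
      by (simp add: Suc DERIV_imp_deriv)
  qed
qed simp

lemma hermite_eq_poly: "hermite k x = poly (herm k) x"
proof -
  have "((- 1) ^ k * (- 1) ^ k :: real) = 1" by (simp add: power_mult_distrib[symmetric])
  then have "hermite k x = poly (herm k) x * (exp (x\<^sup>2) * exp (- (x\<^sup>2)))"
    unfolding hermite_def deriv_gauss by (simp add: mult_ac)
  then show ?thesis by (simp add: exp_minus)
qed

lemma pderiv_herm: "pderiv (herm (Suc k)) = smult (2 * (real k + 1)) (herm k)"
proof (induction k)
  case 0
  show ?case by (simp add: pderiv_pCons)
next
  case (Suc k)
  have "pderiv (herm (Suc (Suc k))) = smult 2 (herm (Suc k)) + [:0, 2:] * pderiv (herm (Suc k)) - pderiv (pderiv (herm (Suc k)))"
    unfolding herm.simps(2)[of "Suc k"] pderiv_diff pderiv_mult by (simp add: pderiv_pCons)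
  also have "\<dots> = smult 2 (herm (Suc k)) + smult (2 * (real k + 1)) (herm (Suc k))"
    unfolding Suc by (simp add: pderiv_smult smult_diff_right del: mult_pCons_left)
  also have "\<dots> = smult (2 * (real (Suc k) + 1)) (herm (Suc k))"
    by (simp add: smult_add_left[symmetric] algebra_simps)
  finally show ?case .
qed

lemma herm_rec: "poly (herm (Suc (Suc k))) x = 2 * x * poly (herm (Suc k)) x - 2 * (real k + 1) * poly (herm k) x"
  unfolding herm.simps(2)[of "Suc k"] pderiv_herm by simp

lemma integrable_std_normal_poly: "integrable lborel (\<lambda>z. std_normal_density z * poly p z)"
proof -
  have "integrable lborel (\<lambda>z. \<Sum>i\<le>degree p. coeff p i * (std_normal_density z * z ^ i))"
    by (intro Bochner_Integration.integrable_sum integrable_mult_right integrable_std_normal_moment)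
  also have "(\<lambda>z. \<Sum>i\<le>degree p. coeff p i * (std_normal_density z * z ^ i)) = (\<lambda>z. std_normal_density z * poly p z)"
    by (simp add: poly_altdef sum_distrib_left mult_ac)
  finally show ?thesis .
qed

text \<open>Both sides are known moments: zero for even \<open>i\<close>, double factorials for odd \<open>i\<close>.\<close>

lemma stein_power:
  "(\<integral>z. std_normal_density z * z ^ Suc i \<partial>lborel) = real i * (\<integral>z. std_normal_density z * z ^ (i - 1) \<partial>lborel)"
proof (cases "even i")
  case True
  then obtain m where i: "i = 2 * m" by (elim evenE)
  show ?thesis
  proof (cases m)
    case 0
    then show ?thesis using integral_std_normal_moment_odd[of 0] i by simp
  next
    case (Suc m')
    then have "i - 1 = 2 * m' + 1" by (simp add: i)
    then show ?thesis
      using integral_std_normal_moment_odd[of m] integral_std_normal_moment_odd[of m'] by (simp only: i) simp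
  qed
next
  case False
  then obtain m where i: "i = 2 * m + 1" by (elim oddE)
  have "(\<integral>z. std_normal_density z * z ^ Suc i \<partial>lborel) = fact (2 * Suc m) / (2 ^ Suc m * fact (Suc m))"
    using integral_std_normal_moment_even[of "Suc m"] by (simp add: i)
  also have "\<dots> = real i * (fact (2 * m) / (2 ^ m * fact m))"
  proof -
    have "fact (2 * Suc m) = (2 * real m + 2) * ((2 * real m + 1) * fact (2 * m))"
      by (simp add: fact_reduce algebra_simps)
    moreover have "(2::real) ^ Suc m * fact (Suc m) = (2 * real m + 2) * (2 ^ m * fact m)"
      by (simp add: algebra_simps)
    ultimately show ?thesis by (simp add: i del: fact_Suc power_Suc)
  qed
  finally show ?thesis using integral_std_normal_moment_even[of m] by (simp add: i)
qed

lemma pderiv_sum_poly: "pderiv (\<Sum>i\<in>A. f i) = (\<Sum>i\<in>A. pderiv (f i))"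
  by (induction A rule: infinite_finite_induct) (simp_all add: pderiv_add)

text \<open>Gaussian integration by parts, obtained for monomials from the moments.\<close>

lemma stein_poly:
  "(\<integral>z. std_normal_density z * (z * poly p z) \<partial>lborel) = (\<integral>z. std_normal_density z * poly (pderiv p) z \<partial>lborel)"
proof -
  have "pderiv p = pderiv (\<Sum>i\<le>degree p. monom (coeff p i) i)"
    by (simp only: poly_as_sum_of_monoms)
  then have pd: "pderiv p = (\<Sum>i\<le>degree p. monom (real i * coeff p i) (i - 1))"
    by (simp add: pderiv_sum_poly pderiv_monom)
  have "(\<integral>z. std_normal_density z * (z * poly p z) \<partial>lborel)
      = (\<integral>z. (\<Sum>i\<le>degree p. coeff p i * (std_normal_density z * z ^ Suc i)) \<partial>lborel)"
    by (simp add: poly_altdef sum_distrib_left mult_ac)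
  also have "\<dots> = (\<Sum>i\<le>degree p. coeff p i * (\<integral>z. std_normal_density z * z ^ Suc i \<partial>lborel))"
    by (subst Bochner_Integration.integral_sum, intro integrable_mult_right integrable_std_normal_moment)
      (simp only: integral_mult_right_zero)
  also have "\<dots> = (\<Sum>i\<le>degree p. (real i * coeff p i) * (\<integral>z. std_normal_density z * z ^ (i - 1) \<partial>lborel))"
    unfolding stein_power by (simp only: mult_ac)
  also have "\<dots> = (\<integral>z. (\<Sum>i\<le>degree p. (real i * coeff p i) * (std_normal_density z * z ^ (i - 1))) \<partial>lborel)"
    by (subst Bochner_Integration.integral_sum, intro integrable_mult_right integrable_std_normal_moment)
      (simp only: integral_mult_right_zero)
  also have "\<dots> = (\<integral>z. std_normal_density z * poly (pderiv p) z \<partial>lborel)"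
    unfolding pd by (simp add: poly_sum poly_monom sum_distrib_left mult_ac)
  finally show ?thesis .
qed

definition gauss_exp :: "real \<Rightarrow> real \<Rightarrow> real poly \<Rightarrow> real" where
  "gauss_exp y \<tau> p = (\<integral>z. std_normal_density z * poly p (y + \<tau> * z) \<partial>lborel)"

lemma integrable_gauss_exp: "integrable lborel (\<lambda>z. std_normal_density z * poly p (y + \<tau> * z))"
  using integrable_std_normal_poly[of "pcompose p [:y, \<tau>:]"] by (simp add: poly_pcompose mult_ac)

lemma gauss_exp_add: "gauss_exp y \<tau> (p + q) = gauss_exp y \<tau> p + gauss_exp y \<tau> q"
  unfolding gauss_exp_def poly_add distrib_left
  by (rule Bochner_Integration.integral_add integrable_gauss_exp)+

lemma gauss_exp_diff: "gauss_exp y \<tau> (p - q) = gauss_exp y \<tau> p - gauss_exp y \<tau> q"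
  unfolding gauss_exp_def poly_diff right_diff_distrib
  by (rule Bochner_Integration.integral_diff integrable_gauss_exp)+

lemma gauss_exp_smult: "gauss_exp y \<tau> (smult c p) = c * gauss_exp y \<tau> p"
proof -
  have "gauss_exp y \<tau> (smult c p) = (\<integral>z. c * (std_normal_density z * poly p (y + \<tau> * z)) \<partial>lborel)"
    by (simp add: gauss_exp_def mult_ac)
  also have "\<dots> = c * gauss_exp y \<tau> p" unfolding gauss_exp_def by (rule integral_mult_right_zero)
  finally show ?thesis .
qed

lemma gauss_exp_one: "gauss_exp y \<tau> 1 = 1"
  using integral_normal_density[of 1 0] by (simp add: gauss_exp_def)

lemma gauss_exp_X: "gauss_exp y \<tau> ([:0, 1:] * p) = y * gauss_exp y \<tau> p + \<tau>\<^sup>2 * gauss_exp y \<tau> (pderiv p)"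
proof -
  let ?p = "pcompose p [:y, \<tau>:]"
  have st: "(\<integral>z. std_normal_density z * (z * poly ?p z) \<partial>lborel) = \<tau> * gauss_exp y \<tau> (pderiv p)"
  proof -
    have "pderiv ?p = smult \<tau> (pcompose (pderiv p) [:y, \<tau>:])"
      by (simp add: pderiv_pcompose pderiv_pCons mult.commute)
    then have "(\<integral>z. std_normal_density z * (z * poly ?p z) \<partial>lborel)
        = (\<integral>z. std_normal_density z * poly (smult \<tau> (pcompose (pderiv p) [:y, \<tau>:])) z \<partial>lborel)"
      by (simp only: stein_poly)
    also have "\<dots> = gauss_exp y \<tau> (smult \<tau> (pderiv p))"
      by (simp add: gauss_exp_def poly_pcompose mult_ac)
    finally show ?thesis by (simp only: gauss_exp_smult)
  qed
  have i1: "integrable lborel (\<lambda>z. std_normal_density z * (z * poly ?p z))"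
    using integrable_std_normal_poly[of "[:0, 1:] * ?p"] by simp
  have "gauss_exp y \<tau> ([:0, 1:] * p) = (\<integral>z. y * (std_normal_density z * poly p (y + \<tau> * z)) + \<tau> * (std_normal_density z * (z * poly ?p z)) \<partial>lborel)"
    unfolding gauss_exp_def
    by (intro Bochner_Integration.integral_cong refl) (simp add: poly_pcompose algebra_simps)
  also have "\<dots> = y * gauss_exp y \<tau> p + \<tau> * (\<tau> * gauss_exp y \<tau> (pderiv p))"
    unfolding st[symmetric] unfolding gauss_exp_def
    by (subst Bochner_Integration.integral_add, intro integrable_mult_right integrable_gauss_exp,
        intro integrable_mult_right i1) (simp only: integral_mult_right_zero)
  finally show ?thesis by (simp add: power2_eq_square)
qed

lemma herm_Suc_X: "herm (Suc k) = smult 2 ([:0, 1:] * herm k) - pderiv (herm k)"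
  by simp

text \<open>By Gaussian integration by parts, \<open>H\<^sub>k\<^sub>+\<^sub>1 = 2x H\<^sub>k - H\<^sub>k'\<close> is the adjoint of differentiation applied to \<open>H\<^sub>k\<close>.\<close>

lemma gauss_exp_herm_mult:
  assumes "\<tau>\<^sup>2 = 1 / 2"
  shows "gauss_exp 0 \<tau> (herm (Suc k) * p) = gauss_exp 0 \<tau> (herm k * pderiv p)"
proof -
  have "herm (Suc k) * p = smult 2 ([:0, 1:] * (herm k * p)) - pderiv (herm k) * p"
    unfolding herm_Suc_X by (simp add: left_diff_distrib)
  then have "gauss_exp 0 \<tau> (herm (Suc k) * p)
      = gauss_exp 0 \<tau> (pderiv (herm k * p)) - gauss_exp 0 \<tau> (pderiv (herm k) * p)"
    by (simp only: gauss_exp_diff gauss_exp_smult gauss_exp_X assms) simp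
  also have "\<dots> = gauss_exp 0 \<tau> (herm k * pderiv p)"
    by (simp add: pderiv_mult gauss_exp_add mult.commute)
  finally show ?thesis .
qed

lemma herm_orthogonal:
  assumes "\<tau>\<^sup>2 = 1 / 2"
  shows "gauss_exp 0 \<tau> (herm k * herm l) = (if k = l then 2 ^ k * fact k else 0)"
proof (induction k arbitrary: l)
  case 0
  show ?case
  proof (cases l)
    case 0
    then show ?thesis by (simp add: gauss_exp_one)
  next
    case (Suc l')
    have "gauss_exp 0 \<tau> (herm l * 1) = gauss_exp 0 \<tau> (smult 0 1)"
      unfolding Suc gauss_exp_herm_mult[OF assms] by simp
    then show ?thesis using Suc unfolding gauss_exp_smult by simp
  qed
next
  case (Suc k)
  show ?case
  proof (cases l)
    case 0
    have "gauss_exp 0 \<tau> (herm (Suc k) * herm l) = gauss_exp 0 \<tau> (smult 0 1)"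
      unfolding gauss_exp_herm_mult[OF assms] 0 by simp
    then show ?thesis using 0 unfolding gauss_exp_smult by simp
  next
    case (Suc l')
    have "gauss_exp 0 \<tau> (herm (Suc k) * herm l) = (2 * (real l' + 1)) * gauss_exp 0 \<tau> (herm k * herm l')"
      unfolding gauss_exp_herm_mult[OF assms] unfolding Suc pderiv_herm mult_smult_right gauss_exp_smult ..
    then show ?thesis unfolding Suc.IH using Suc by simp
  qed
qed

text \<open>The heat semigroup maps a Hermite polynomial to a rescaled one: both sides satisfy the same
  three-term recursion, with \<open>1 - 2\<tau>\<^sup>2\<close> appearing after integration by parts.\<close>

lemma gauss_exp_herm:
  fixes r :: real
  assumes r: "r\<^sup>2 = 1 - 2 * \<tau>\<^sup>2" "r \<noteq> 0"
  shows "gauss_exp y \<tau> (herm k) = r ^ k * poly (herm k) (y / r)"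
proof -
  have "gauss_exp y \<tau> (herm k) = r ^ k * poly (herm k) (y / r) \<and>
    gauss_exp y \<tau> (herm (Suc k)) = r ^ Suc k * poly (herm (Suc k)) (y / r)"
  proof (induction k)
    case 0
    have "gauss_exp y \<tau> (herm (Suc 0)) = 2 * y"
      unfolding herm_Suc_X gauss_exp_diff gauss_exp_smult gauss_exp_X
      using gauss_exp_smult[of y \<tau> 0 1] by (simp add: gauss_exp_one pderiv_1)
    then show ?case using r by (simp add: gauss_exp_one)
  next
    case (Suc k)
    have "gauss_exp y \<tau> (herm (Suc (Suc k)))
        = 2 * (y * gauss_exp y \<tau> (herm (Suc k)) + \<tau>\<^sup>2 * (2 * (real k + 1) * gauss_exp y \<tau> (herm k)))
          - 2 * (real k + 1) * gauss_exp y \<tau> (herm k)"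
      unfolding herm_Suc_X[of "Suc k"] gauss_exp_diff gauss_exp_smult gauss_exp_X pderiv_herm ..
    also have "\<dots> = 2 * y * gauss_exp y \<tau> (herm (Suc k)) - 2 * (real k + 1) * r\<^sup>2 * gauss_exp y \<tau> (herm k)"
      unfolding r(1) by (simp add: algebra_simps)
    also have "\<dots> = r ^ Suc (Suc k) * poly (herm (Suc (Suc k))) (y / r)"
      unfolding conjunct1[OF Suc] conjunct2[OF Suc] herm_rec
      using r(2) by (simp add: power2_eq_square field_simps del: herm.simps)
    finally show ?case using Suc by blast
  qed
  then show ?thesis ..
qed

lemma has_bochner_integral_normal_poly:
  assumes "\<tau> > 0"
  shows "has_bochner_integral lborel (\<lambda>s. normal_density m \<tau> s * poly p (\<gamma> * s)) (gauss_exp (\<gamma> * m) (\<gamma> * \<tau>) p)"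
proof -
  have "has_bochner_integral lborel (\<lambda>z. std_normal_density z * poly p (\<gamma> * m + \<gamma> * \<tau> * z)) (gauss_exp (\<gamma> * m) (\<gamma> * \<tau>) p)"
    using integrable_gauss_exp by (simp add: has_bochner_integral_iff gauss_exp_def)
  then have "has_bochner_integral lborel (\<lambda>z. (\<tau> * normal_density m \<tau> (m + \<tau> * z)) * poly p (\<gamma> * (m + \<tau> * z))) (gauss_exp (\<gamma> * m) (\<gamma> * \<tau>) p)"
    unfolding normal_density_affine_std[OF assms] by (simp add: algebra_simps)
  from has_bochner_integral_mult_right[OF this, of "inverse \<tau>"]
  have "has_bochner_integral lborel (\<lambda>z. normal_density m \<tau> (m + \<tau> * z) * poly p (\<gamma> * (m + \<tau> * z))) (inverse \<tau> * gauss_exp (\<gamma> * m) (\<gamma> * \<tau>) p)"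
    using assms by (simp add: mult.assoc[symmetric])
  then show ?thesis
    using assms by (subst lborel_has_bochner_integral_real_affine_iff[where c=\<tau> and t=m]) (auto simp: divide_inverse)
qed


lemma psd_gram:
  fixes M :: "'i \<Rightarrow> 'i \<Rightarrow> real"
  assumes A: "finite A" and M: "\<And>i j. i \<in> A \<Longrightarrow> j \<in> A \<Longrightarrow> has_bochner_integral N (\<lambda>s. g i s * g j s) (M i j)"
  shows "0 \<le> (\<Sum>i\<in>A. \<Sum>j\<in>A. u i * u j * M i j)"
proof -
  have "has_bochner_integral N (\<lambda>s. \<Sum>i\<in>A. \<Sum>j\<in>A. u i * u j * (g i s * g j s)) (\<Sum>i\<in>A. \<Sum>j\<in>A. u i * u j * M i j)"
    by (intro has_bochner_integral_sum has_bochner_integral_mult_right M)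
  also have "(\<lambda>s. \<Sum>i\<in>A. \<Sum>j\<in>A. u i * u j * (g i s * g j s)) = (\<lambda>s. (\<Sum>i\<in>A. u i * g i s)\<^sup>2)"
    by (simp add: power2_eq_square sum_product mult_ac)
  finally have "(\<Sum>i\<in>A. \<Sum>j\<in>A. u i * u j * M i j) = (\<integral>s. (\<Sum>i\<in>A. u i * g i s)\<^sup>2 \<partial>N)"
    by (simp add: has_bochner_integral_iff)
  then show ?thesis by simp
qed

text \<open>If \<open>K\<close> is a Gram kernel of features \<open>F x\<close>, then \<open>\<beta> k x\<close> is the coefficient of \<open>F x\<close> along the orthonormal
  \<open>\<psi> k\<close>, and the difference is the Gram kernel of the projections of \<open>F x\<close> to the orthogonal complement.\<close>

lemma psd_bessel:
  fixes K :: "'i \<Rightarrow> 'i \<Rightarrow> real"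
  assumes I: "finite I"
    and K: "\<And>x y. has_bochner_integral N (\<lambda>s. F x s * F y s) (K x y)"
    and on: "\<And>k l. has_bochner_integral N (\<lambda>s. \<psi> k s * \<psi> l s) (if k = l then 1 else 0)"
    and co: "\<And>x k. has_bochner_integral N (\<lambda>s. F x s * \<psi> k s) (\<beta> k x)"
  shows "psd_on I (\<lambda>x y. K x y - (\<Sum>k<J::nat. \<beta> k x * \<beta> k y))"
proof (rule psd_onI)
  have Ks: "K x y = K y x" for x y
    using K[of x y] K[of y x] by (simp add: mult.commute has_bochner_integral_iff)
  then show "K x y - (\<Sum>k<J. \<beta> k x * \<beta> k y) = K y x - (\<Sum>k<J. \<beta> k y * \<beta> k x)" for x y
    by (simp add: mult.commute)
  show "0 \<le> (\<Sum>x\<in>I. \<Sum>y\<in>I. z x * z y * (K x y - (\<Sum>k<J. \<beta> k x * \<beta> k y)))" for z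
  proof -
    define d where "d k = (\<Sum>x\<in>I. z x * \<beta> k x)" for k
    define g where "g i = (case i of Inl x \<Rightarrow> F x | Inr k \<Rightarrow> \<psi> k)" for i
    define u where "u i = (case i of Inl x \<Rightarrow> z x | Inr k \<Rightarrow> - d k)" for i
    define M where "M i j = (case i of
        Inl x \<Rightarrow> (case j of Inl y \<Rightarrow> K x y | Inr k \<Rightarrow> \<beta> k x)
      | Inr k \<Rightarrow> (case j of Inl y \<Rightarrow> \<beta> k y | Inr l \<Rightarrow> (if k = l then 1 else 0)))" for i j
    have co': "has_bochner_integral N (\<lambda>s. \<psi> k s * F x s) (\<beta> k x)" for x k
      using co[of x k] by (simp add: mult.commute)
    have "0 \<le> (\<Sum>i\<in>I <+> {..<J}. \<Sum>j\<in>I <+> {..<J}. u i * u j * M i j)"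
    proof (rule psd_gram[where g=g and N=N])
      show "has_bochner_integral N (\<lambda>s. g i s * g j s) (M i j)" for i j
        unfolding g_def M_def using K co co' on by (cases i; cases j) auto
    qed (use I in simp)
    also have "\<dots> = (\<Sum>x\<in>I. (\<Sum>y\<in>I. z x * z y * K x y) + (\<Sum>k<J. - z x * d k * \<beta> k x))
        + (\<Sum>k<J. (\<Sum>y\<in>I. - d k * z y * \<beta> k y) + (\<Sum>l<J. d k * d l * (if k = l then 1 else 0)))"
      using I by (simp add: sum.Plus u_def M_def comp_def)
    also have "(\<Sum>k<J. (\<Sum>y\<in>I. - d k * z y * \<beta> k y) + (\<Sum>l<J. d k * d l * (if k = l then 1 else 0)))
       = (\<Sum>k<J. - (d k)\<^sup>2 + (d k)\<^sup>2)"
    proof (intro sum.cong refl arg_cong2[where f="(+)"])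
      fix k assume "k \<in> {..<J}"
      show "(\<Sum>y\<in>I. - d k * z y * \<beta> k y) = - (d k)\<^sup>2"
        by (simp add: d_def[of k] power2_eq_square sum_negf sum_distrib_left[symmetric] mult.assoc)
      show "(\<Sum>l<J. d k * d l * (if k = l then 1 else 0)) = (d k)\<^sup>2"
        using \<open>k \<in> {..<J}\<close> by (simp add: if_distrib[of "\<lambda>t. _ * t"] power2_eq_square cong: if_cong)
    qed
    also have "(\<Sum>x\<in>I. (\<Sum>y\<in>I. z x * z y * K x y) + (\<Sum>k<J. - z x * d k * \<beta> k x))
      = (\<Sum>x\<in>I. \<Sum>y\<in>I. z x * z y * (K x y - (\<Sum>k<J. \<beta> k x * \<beta> k y)))"
    proof -
      have "(\<Sum>x\<in>I. \<Sum>y\<in>I. z x * z y * (\<Sum>k<J. \<beta> k x * \<beta> k y)) = (\<Sum>x\<in>I. \<Sum>k<J. z x * d k * \<beta> k x)"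
      proof (intro sum.cong refl)
        fix x
        have "(\<Sum>y\<in>I. z x * z y * (\<Sum>k<J. \<beta> k x * \<beta> k y)) = (\<Sum>y\<in>I. \<Sum>k<J. z x * \<beta> k x * (z y * \<beta> k y))"
          by (simp add: sum_distrib_left mult_ac)
        also have "\<dots> = (\<Sum>k<J. \<Sum>y\<in>I. z x * \<beta> k x * (z y * \<beta> k y))" by (rule sum.swap)
        also have "\<dots> = (\<Sum>k<J. z x * d k * \<beta> k x)"
          by (simp add: d_def sum_distrib_left mult_ac)
        finally show "(\<Sum>y\<in>I. z x * z y * (\<Sum>k<J. \<beta> k x * \<beta> k y)) = (\<Sum>k<J. z x * d k * \<beta> k x)" .
      qed
      then show ?thesis by (simp add: right_diff_distrib sum_subtractf sum.distrib sum_negf)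
    qed
    finally show ?thesis by simp
  qed
qed

locale se_eigensystem =
  fixes a b c :: real
  assumes a: "a > 0" and b: "b > 0"
  defines "c \<equiv> sqrt (b\<^sup>2 + 2 * b * a\<^sup>2)"
begin

lemma c_sq: "c\<^sup>2 = b\<^sup>2 + 2 * b * a\<^sup>2"
  using a b by (simp add: c_def)

lemma c_gt: "b < c"
  unfolding c_def using a b by (intro real_less_rsqrt) simp

lemma c_pos: "0 < c"
  using c_gt b by simp

lemma c_diff: "(c - b) * (c + b) = 2 * b * a\<^sup>2"
  using c_sq by (simp add: power2_eq_square algebra_simps)

text \<open>The eigenfunctions, counted from \<open>0\<close> like the Hermite polynomials.\<close>

abbreviation \<phi> :: "nat \<Rightarrow> real \<Rightarrow> real" where "\<phi> k \<equiv> eigfun b a (Suc k)"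

text \<open>The ratio of consecutive eigenvalues, usually written \<open>a\<^sup>2/(b + a\<^sup>2 + c)\<close>.  The present form shows that
  \<open>1 - B = 2b/(c + b)\<close> is also the first eigenvalue, so that the eigenvalues sum to \<open>1 = K(x,x)\<close>.\<close>

definition B :: real where "B = (c - b) / (c + b)"

definition eigval :: "nat \<Rightarrow> real" where "eigval k = (1 - B) * B ^ k"

text \<open>The scale at which Hermite functions in the feature variable \<open>s\<close> are mapped to multiples of the
  \<open>eigfun\<close>; it is forced by matching both the Gaussian factor and the argument of the Hermite polynomial
  in \<open>feat_hfun\<close>.\<close>

definition \<gamma> :: real where "\<gamma> = 2 * a * sqrt (b / c)"

text \<open>Convolving two such Gaussians gives the squared-exponential kernel; this is a real feature map into
  square-integrable functions of \<open>s\<close>.\<close>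

definition feat :: "real \<Rightarrow> real \<Rightarrow> real" where
  "feat x s = sqrt (2 * a / sqrt pi) * exp (- 2 * a\<^sup>2 * (x - s)\<^sup>2)"

text \<open>The orthonormal Hermite functions, rescaled by \<open>\<gamma>\<close>.\<close>

definition hfun :: "nat \<Rightarrow> real \<Rightarrow> real" where
  "hfun k s = sqrt (\<gamma> / sqrt pi) / sqrt (2 ^ k * fact k) * poly (herm k) (\<gamma> * s) * exp (- (\<gamma> * s)\<^sup>2 / 2)"

lemma B_bounds: "0 < B" "B < 1"
  using c_gt b by (simp_all add: B_def)

lemma one_minus_B: "1 - B = 2 * b / (c + b)"
  using c_gt b by (simp add: B_def field_simps)

lemma \<gamma>_pos: "\<gamma> > 0" using a b c_pos by (simp add: \<gamma>_def)

lemma \<gamma>_sq: "\<gamma>\<^sup>2 = 4 * a\<^sup>2 * b / c" using b c_pos by (simp add: \<gamma>_def power_mult_distrib)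

lemma herm_orthonormal_scaled:
  assumes g: "g > 0"
  shows "has_bochner_integral lborel (\<lambda>s. g / sqrt pi * exp (- (g * s)\<^sup>2) *
      (poly (herm k) (g * s) * poly (herm l) (g * s)) / (sqrt (2 ^ k * fact k) * sqrt (2 ^ l * fact l)))
    (if k = l then 1 else 0)"
proof -
  define \<tau> where "\<tau> = 1 / (sqrt 2 * g)"
  have \<tau>: "\<tau> > 0" "(g * \<tau>)\<^sup>2 = 1 / 2" "\<tau>\<^sup>2 = 1 / (2 * g\<^sup>2)" using g by (auto simp: \<tau>_def power_divide power_mult_distrib)
  have "normal_density 0 \<tau> s = g / sqrt pi * exp (- (g * s)\<^sup>2)" for s
    using g by (simp add: normal_density_def \<tau>(3) real_sqrt_divide power_mult_distrib)
  moreover have "has_bochner_integral lborel (\<lambda>s. normal_density 0 \<tau> s * poly (herm k * herm l) (g * s)) (if k = l then 2 ^ k * fact k else 0)"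
    using has_bochner_integral_normal_poly[OF \<tau>(1), of 0 "herm k * herm l" g] herm_orthogonal[OF \<tau>(2), of k l] by simp
  ultimately have "has_bochner_integral lborel (\<lambda>s. g / sqrt pi * exp (- (g * s)\<^sup>2) * (poly (herm k) (g * s) * poly (herm l) (g * s)))
      (if k = l then 2 ^ k * fact k else 0)" by simp
  from has_bochner_integral_divide[OF this, of "sqrt (2 ^ k * fact k) * sqrt (2 ^ l * fact l)"]
  show ?thesis by (cases "k = l") auto
qed

lemma hfun_orthonormal: "has_bochner_integral lborel (\<lambda>s. hfun k s * hfun l s) (if k = l then 1 else 0)"
proof -
  have "hfun k s * hfun l s = \<gamma> / sqrt pi * exp (- (\<gamma> * s)\<^sup>2) *
      (poly (herm k) (\<gamma> * s) * poly (herm l) (\<gamma> * s)) / (sqrt (2 ^ k * fact k) * sqrt (2 ^ l * fact l))" for s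
  proof -
    have 1: "sqrt (\<gamma> / sqrt pi) * sqrt (\<gamma> / sqrt pi) = \<gamma> / sqrt pi" using \<gamma>_pos by simp
    have 2: "exp (- (\<gamma> * s)\<^sup>2 / 2) * exp (- (\<gamma> * s)\<^sup>2 / 2) = exp (- (\<gamma> * s)\<^sup>2)"
      by (simp add: exp_add[symmetric])
    have "hfun k s * hfun l s = (sqrt (\<gamma> / sqrt pi) * sqrt (\<gamma> / sqrt pi)) * (exp (- (\<gamma> * s)\<^sup>2 / 2) * exp (- (\<gamma> * s)\<^sup>2 / 2)) *
      (poly (herm k) (\<gamma> * s) * poly (herm l) (\<gamma> * s)) / (sqrt (2 ^ k * fact k) * sqrt (2 ^ l * fact l))"
      by (simp add: hfun_def del: real_sqrt_mult_self)
    then show ?thesis unfolding 1 2 .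
  qed
  then show ?thesis using herm_orthonormal_scaled[OF \<gamma>_pos, of k l] by simp
qed

lemma feat_kernel: "has_bochner_integral lborel (\<lambda>s. feat x s * feat y s) (se_kernel a x y)"
proof -
  define \<tau> where "\<tau> = 1 / (sqrt 8 * a)"
  have \<tau>: "\<tau> > 0" "\<tau>\<^sup>2 = 1 / (8 * a\<^sup>2)" using a by (auto simp: \<tau>_def power_divide power_mult_distrib)
  have "feat x s * feat y s = se_kernel a x y * normal_density ((x + y) / 2) \<tau> s" for s
  proof -
    have 1: "sqrt (2 * a / sqrt pi) * sqrt (2 * a / sqrt pi) = 2 * a / sqrt pi" using a by simp
    have 2: "2 * a / sqrt pi = 1 / sqrt (2 * pi * \<tau>\<^sup>2)"
      using a by (simp add: \<tau>(2) real_sqrt_divide real_sqrt_mult)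
    have 3: "- 2 * a\<^sup>2 * (x - s)\<^sup>2 + - 2 * a\<^sup>2 * (y - s)\<^sup>2 = - (a\<^sup>2) * \<bar>x - y\<bar>\<^sup>2 + - (s - (x + y) / 2)\<^sup>2 / (2 * \<tau>\<^sup>2)"
      unfolding \<tau>(2) using a by (simp add: power2_eq_square field_simps)
    have "feat x s * feat y s = 2 * a / sqrt pi * exp (- 2 * a\<^sup>2 * (x - s)\<^sup>2 + - 2 * a\<^sup>2 * (y - s)\<^sup>2)"
    proof -
      have "feat x s * feat y s = (sqrt (2 * a / sqrt pi) * sqrt (2 * a / sqrt pi)) * exp (- 2 * a\<^sup>2 * (x - s)\<^sup>2 + - 2 * a\<^sup>2 * (y - s)\<^sup>2)"
        unfolding feat_def exp_add by (simp only: mult_ac)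
      then show ?thesis unfolding 1 .
    qed
    also have "\<dots> = 1 / sqrt (2 * pi * \<tau>\<^sup>2) * exp (- (a\<^sup>2) * \<bar>x - y\<bar>\<^sup>2 + - (s - (x + y) / 2)\<^sup>2 / (2 * \<tau>\<^sup>2))"
      by (simp only: 2 3)
    finally show ?thesis unfolding exp_add se_kernel_def normal_density_def by simp
  qed
  moreover have "has_bochner_integral lborel (\<lambda>s. se_kernel a x y * normal_density ((x + y) / 2) \<tau> s) (se_kernel a x y * 1)"
    using integrable_normal_density[OF \<tau>(1)] integral_normal_density[OF \<tau>(1)]
    by (intro has_bochner_integral_mult_right) (simp add: has_bochner_integral_iff)
  ultimately show ?thesis by simp
qed

lemma eigfun_Suc: "\<phi> k x = (c / b) powr (1 / 4) / sqrt (2 ^ k * fact k)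
    * exp (- (c - b) * x\<^sup>2) * poly (herm k) (sqrt (2 * c) * x)"
  by (simp add: eigfun_def hermite_eq_poly c_def Let_def)

lemma quarter_sq: "((c / b) powr (1 / 4))\<^sup>2 = sqrt (c / b)"
  using b c_pos by (simp add: powr_half_sqrt[symmetric] powr_power)

lemma eigfun_orthonormal:
  "has_bochner_integral lborel (\<lambda>x. rho b x * (\<phi> k x * \<phi> l x)) (if k = l then 1 else 0)"
proof -
  let ?g = "sqrt (2 * c)"
  have "rho b x * (\<phi> k x * \<phi> l x) = ?g / sqrt pi * exp (- (?g * x)\<^sup>2) *
      (poly (herm k) (?g * x) * poly (herm l) (?g * x)) / (sqrt (2 ^ k * fact k) * sqrt (2 ^ l * fact l))" for x
  proof -
    have 1: "?g / sqrt pi = sqrt (2 * b / pi) * ((c / b) powr (1 / 4))\<^sup>2"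
      unfolding quarter_sq using b c_pos by (simp add: real_sqrt_divide real_sqrt_mult)
    have 2: "- (?g * x)\<^sup>2 = - 2 * b * x\<^sup>2 + (- (c - b) * x\<^sup>2 + - (c - b) * x\<^sup>2)"
      using c_pos by (simp add: power_mult_distrib algebra_simps)
    show ?thesis unfolding 1 2 exp_add eigfun_Suc rho_def power2_eq_square[of "(c / b) powr (1 / 4)"] by simp
  qed
  then show ?thesis using herm_orthonormal_scaled[of ?g k l] c_pos by simp
qed

text \<open>Completing the square turns the product of the two Gaussian factors into \<open>exp (- (c - b) x\<^sup>2)\<close> times a normal
  density in \<open>s\<close>, and \<open>gauss_exp_herm\<close> evaluates the Hermite polynomial under that density.  This is the
  singular value decomposition of the feature map, hence the eigenexpansion of the kernel.\<close>

lemma feat_hfun: "has_bochner_integral lborel (\<lambda>s. feat x s * hfun k s) (sqrt (eigval k) * \<phi> k x)"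
proof -
  define q where "q = 2 * a\<^sup>2 * (b + c) / c"
  define m where "m = c * x / (b + c)"
  define \<tau> where "\<tau> = 1 / sqrt (2 * q)"
  have bc: "b + c > 0" using b c_pos by simp
  have q: "q > 0" using a bc c_pos by (simp add: q_def)
  have \<tau>: "\<tau> > 0" "\<tau>\<^sup>2 = 1 / (2 * q)" using q by (auto simp: \<tau>_def power_divide)
  have ex: "- 2 * a\<^sup>2 * (x - s)\<^sup>2 + - (\<gamma> * s)\<^sup>2 / 2 = - (c - b) * x\<^sup>2 + - (s - m)\<^sup>2 / (2 * \<tau>\<^sup>2)" for s
  proof -
    have cb: "c - b = 2 * a\<^sup>2 * b / (b + c)" using c_diff bc by (simp add: field_simps)
    have e1: "q * m = 2 * a\<^sup>2 * x" using bc c_pos by (simp add: q_def m_def)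
    have e2: "q = 2 * a\<^sup>2 + 2 * a\<^sup>2 * b / c" using c_pos by (simp add: q_def field_simps)
    have e3: "q * m\<^sup>2 = 2 * a\<^sup>2 * x\<^sup>2 - (c - b) * x\<^sup>2"
    proof -
      have "q * m\<^sup>2 = 2 * a\<^sup>2 * x * m" using e1 by (simp add: power2_eq_square)
      also have "\<dots> = 2 * a\<^sup>2 * x\<^sup>2 * (c / (b + c))" by (simp add: m_def power2_eq_square)
      also have "c / (b + c) = 1 - b / (b + c)" using bc by (simp add: field_simps)
      finally show ?thesis unfolding cb by (simp add: algebra_simps)
    qed
    have "- (s - m)\<^sup>2 / (2 * \<tau>\<^sup>2) = - q * s\<^sup>2 + 2 * (q * m) * s - q * m\<^sup>2"
      unfolding \<tau>(2) using q by (simp add: power2_eq_square algebra_simps)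
    also have "\<dots> = - (2 * a\<^sup>2 + 2 * a\<^sup>2 * b / c) * s\<^sup>2 + 4 * a\<^sup>2 * x * s - 2 * a\<^sup>2 * x\<^sup>2 + (c - b) * x\<^sup>2"
      unfolding e1 e3 by (subst e2) simp
    also have "\<dots> = - 2 * a\<^sup>2 * (x - s)\<^sup>2 + - (\<gamma> * s)\<^sup>2 / 2 + (c - b) * x\<^sup>2"
      unfolding power_mult_distrib \<gamma>_sq by (simp add: power2_eq_square algebra_simps)
    finally show ?thesis by (simp add: algebra_simps)
  qed
  define C where "C = sqrt (2 * a / sqrt pi) * sqrt (\<gamma> / sqrt pi) * sqrt (2 * pi * \<tau>\<^sup>2) / sqrt (2 ^ k * fact k) * exp (- (c - b) * x\<^sup>2)"
  have eq: "feat x s * hfun k s = C * (normal_density m \<tau> s * poly (herm k) (\<gamma> * s))" for s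
  proof -
    have "feat x s * hfun k s = sqrt (2 * a / sqrt pi) * (sqrt (\<gamma> / sqrt pi) / sqrt (2 ^ k * fact k))
        * (exp (- 2 * a\<^sup>2 * (x - s)\<^sup>2 + - (\<gamma> * s)\<^sup>2 / 2)) * poly (herm k) (\<gamma> * s)"
      unfolding feat_def hfun_def exp_add by (simp only: mult_ac)
    also have "\<dots> = C * (normal_density m \<tau> s * poly (herm k) (\<gamma> * s))"
      unfolding ex exp_add C_def normal_density_def using \<tau>(1) by simp
    finally show ?thesis .
  qed
  define r where "r = sqrt B"
  have r: "r\<^sup>2 = B" "r > 0" using B_bounds by (auto simp: r_def)
  have r2: "r\<^sup>2 = 1 - 2 * (\<gamma> * \<tau>)\<^sup>2"
  proof -
    have "2 * (\<gamma> * \<tau>)\<^sup>2 = 2 * b / (c + b)"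
    proof -
      have "c * q = 2 * a\<^sup>2 * (c + b)" using c_pos by (simp add: q_def)
      moreover have "2 * (\<gamma> * \<tau>)\<^sup>2 = 4 * a\<^sup>2 * b / (c * q)"
        unfolding power_mult_distrib \<gamma>_sq \<tau>(2) by simp
      moreover have "4 * a\<^sup>2 * b / (2 * a\<^sup>2 * (c + b)) = 2 * b / (c + b)"
        using mult_divide_mult_cancel_left[of "2 * a\<^sup>2" "2 * b" "c + b"] a by simp
      ultimately show ?thesis by simp
    qed
    then show ?thesis using one_minus_B r by simp
  qed
  have arg: "\<gamma> * m / r = sqrt (2 * c) * x"
  proof -
    have "\<gamma> * c / ((b + c) * r) = sqrt (2 * c)"
    proof (rule real_sqrt_unique[symmetric])
      have "(\<gamma> * c / ((b + c) * r))\<^sup>2 = 4 * a\<^sup>2 * b / c * c\<^sup>2 / ((b + c)\<^sup>2 * B)"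
        by (simp add: power_divide power_mult_distrib \<gamma>_sq r)
      also have "\<dots> = 4 * a\<^sup>2 * b * c / ((b + c)\<^sup>2 * B)" using c_pos by (simp add: power2_eq_square)
      also have "(b + c)\<^sup>2 * B = 2 * b * a\<^sup>2"
        unfolding c_diff[symmetric] B_def using bc by (simp add: power2_eq_square add.commute)
      finally show "(\<gamma> * c / ((b + c) * r))\<^sup>2 = 2 * c" using a b by simp
      show "0 \<le> \<gamma> * c / ((b + c) * r)" using \<gamma>_pos c_pos bc r by simp
    qed
    moreover have "\<gamma> * m / r = \<gamma> * c / ((b + c) * r) * x" by (simp add: m_def)
    ultimately show ?thesis by simp
  qed
  have "has_bochner_integral lborel (\<lambda>s. feat x s * hfun k s) (C * gauss_exp (\<gamma> * m) (\<gamma> * \<tau>) (herm k))"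
    unfolding eq by (intro has_bochner_integral_mult_right has_bochner_integral_normal_poly \<tau>)
  also have "C * gauss_exp (\<gamma> * m) (\<gamma> * \<tau>) (herm k) = sqrt (eigval k) * \<phi> k x"
  proof -
    have k1: "sqrt (2 * a / sqrt pi) * sqrt (\<gamma> / sqrt pi) * sqrt (2 * pi * \<tau>\<^sup>2) = sqrt (1 - B) * (c / b) powr (1 / 4)"
    proof -
      have "sqrt (2 * a / sqrt pi) * sqrt (\<gamma> / sqrt pi) * sqrt (2 * pi * \<tau>\<^sup>2) = sqrt (2 * a * \<gamma> / q)"
        unfolding \<tau>(2) real_sqrt_mult[symmetric] by simp
      also have "2 * a * \<gamma> / q = (1 - B) * sqrt (c / b)"
      proof -
        have rr: "c * (sqrt (b / c) * sqrt (b / c)) = b" using b c_pos by simp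
        have inv: "sqrt (c / b) * sqrt (b / c) = 1" using b c_pos by (simp add: real_sqrt_mult[symmetric])
        have "2 * a * \<gamma> / q = 2 * c * sqrt (b / c) / (b + c)"
        proof -
          have "q * c = 2 * a\<^sup>2 * (b + c)" using c_pos by (simp add: q_def)
          then have "2 * sqrt (b / c) * (q * c) = 2 * a * \<gamma> * (b + c)"
            by (simp add: \<gamma>_def power2_eq_square)
          then have "2 * a * \<gamma> * (b + c) = 2 * c * sqrt (b / c) * q" by (simp only: mult_ac)
          then show ?thesis using q bc by (simp add: divide_eq_eq eq_divide_eq)
        qed
        also have "\<dots> = 2 * (c * (sqrt (b / c) * sqrt (b / c))) * sqrt (c / b) / (b + c)"
        proof -
          have "2 * (c * (sqrt (b / c) * sqrt (b / c))) * sqrt (c / b) = 2 * c * sqrt (b / c) * (sqrt (c / b) * sqrt (b / c))"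
            by (simp only: mult_ac)
          then show ?thesis unfolding inv by simp
        qed
        also have "\<dots> = (1 - B) * sqrt (c / b)" unfolding rr one_minus_B by (simp add: add.commute)
        finally show ?thesis .
      qed
      also have "sqrt ((1 - B) * sqrt (c / b)) = sqrt (1 - B) * (c / b) powr (1 / 4)"
        unfolding quarter_sq[symmetric] real_sqrt_mult by simp
      finally show ?thesis .
    qed
    have k2: "sqrt (eigval k) = sqrt (1 - B) * r ^ k"
      by (simp add: eigval_def r_def real_sqrt_mult real_sqrt_power)
    have "gauss_exp (\<gamma> * m) (\<gamma> * \<tau>) (herm k) = r ^ k * poly (herm k) (sqrt (2 * c) * x)"
      using gauss_exp_herm[OF r2, of "\<gamma> * m" k] r unfolding arg by simp
    then show ?thesis unfolding C_def k1 k2 eigfun_Suc by simp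
  qed
  finally show ?thesis .
qed

lemma sqrt_eigval_mult:
  "(sqrt (eigval k) * y) * (sqrt (eigval k) * z) = eigval k * (y * z)"
proof -
  have "sqrt (eigval k) * sqrt (eigval k) = eigval k"
    using B_bounds by (simp add: eigval_def)
  then show ?thesis by (metis (no_types, lifting) mult.assoc mult.left_commute)
qed

text \<open>Bessel's inequality for the feature map: the kernel dominates its first \<open>J\<close> eigenterms.\<close>

lemma psd_remainder:
  assumes "finite I"
  shows "psd_on I (\<lambda>x y. se_kernel a x y - (\<Sum>k<J. eigval k * (\<phi> k x * \<phi> k y)))"
proof -
  have "psd_on I (\<lambda>x y. se_kernel a x y -
      (\<Sum>k<J. (sqrt (eigval k) * \<phi> k x) * (sqrt (eigval k) * \<phi> k y)))"
    by (rule psd_bessel[where F=feat and \<psi>=hfun]) (rule assms feat_kernel hfun_orthonormal feat_hfun)+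
  then show ?thesis unfolding sqrt_eigval_mult .
qed

lemma psd_se_kernel: "finite I \<Longrightarrow> psd_on I (se_kernel a)"
  using psd_remainder[of I 0] by simp

lemma eigval_sum: "(\<Sum>k<J. eigval k) = 1 - B ^ J"
  unfolding eigval_def sum_distrib_left[symmetric] using B_bounds by (simp add: sum_gp_strict)

lemma eigval_pos: "eigval k > 0" using B_bounds by (simp add: eigval_def)

end

section \<open>Reduction of posterior contraction to the risk at a fresh design point\<close>

definition design_law :: "real \<Rightarrow> real measure" where
  "design_law b = density lborel (\<lambda>x. ennreal (rho b x))"

lemma rho_normal: assumes "b > 0" shows "rho b x = normal_density 0 (1 / (2 * sqrt b)) x"
  using assms by (simp add: rho_def normal_density_def power_divide real_sqrt_divide power_mult_distrib field_simps)

lemma rho_measurable [measurable]: "rho b \<in> borel_measurable borel"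
  unfolding rho_def by measurable

lemma rho_nonneg: "b > 0 \<Longrightarrow> 0 \<le> rho b x" by (simp add: rho_normal)

lemma sets_design_law [simp, measurable_cong]: "sets (design_law b) = sets borel"
  by (simp add: design_law_def)

lemma space_design_law [simp]: "space (design_law b) = UNIV"
  by (simp add: design_law_def)

lemma measurable_design_law [simp]: "measurable M (design_law b) = borel_measurable M"
  by (rule measurable_cong_sets) auto

lemma prob_space_design_law: assumes "b > 0" shows "prob_space (design_law b)"
  using prob_space_normal_density[of "1 / (2 * sqrt b)" 0] assms
  unfolding design_law_def rho_normal[OF assms] by simp

lemma nn_integral_design_law:
  assumes "b > 0" "g \<in> borel_measurable borel"
  shows "(\<integral>\<^sup>+x. ennreal (g x) \<partial>design_law b) = (\<integral>\<^sup>+x. ennreal (g x * rho b x) \<partial>lborel)"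
  using assms unfolding design_law_def
  by (subst nn_integral_density) (auto simp: ennreal_mult' ennreal_mult'' rho_nonneg mult.commute intro!: nn_integral_cong)

text \<open>Joint measurability holds because paths are continuous: a path is the pointwise limit of its values at
  the grid points below \<open>x\<close>, and each approximation involves countably many evaluations.\<close>

lemma path_eval_measurable:
  "(\<lambda>(f, x). f x) \<in> borel_measurable (path_space \<Otimes>\<^sub>M borel)"
proof (rule borel_measurable_LIMSEQ_metric)
  fix i :: nat
  have [measurable]: "(\<lambda>f. f y) \<in> borel_measurable path_space" for y :: real
    unfolding path_space_def
    by (intro measurable_restrict_space1 measurable_component_singleton) auto
  have 1: "(\<lambda>p. fst p (real_of_int k / real (Suc i))) \<in> borel_measurable (path_space \<Otimes>\<^sub>M borel)" for k :: int
    by (rule measurable_compose[OF measurable_fst]) measurable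
  have 2: "(\<lambda>p. \<lfloor>real (Suc i) * snd p\<rfloor>) \<in> measurable (path_space \<Otimes>\<^sub>M borel) (count_space UNIV)"
    by measurable
  show "(\<lambda>p. fst p (real_of_int \<lfloor>real (Suc i) * snd p\<rfloor> / real (Suc i))) \<in> borel_measurable (path_space \<Otimes>\<^sub>M borel)"
    by (rule measurable_compose_countable[OF 1 2])
next
  fix p :: "(real \<Rightarrow> real) \<times> real" assume "p \<in> space (path_space \<Otimes>\<^sub>M borel)"
  then have cont: "continuous_on UNIV (fst p)"
    by (auto simp: space_pair_measure path_space_def space_restrict_space)
  let ?x = "snd p"
  have "(\<lambda>i. real_of_int \<lfloor>real (Suc i) * ?x\<rfloor> / real (Suc i)) \<longlonglongrightarrow> ?x"
  proof (rule tendsto_sandwich)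
    show "\<forall>\<^sub>F i in sequentially. ?x - 1 / real (Suc i) \<le> real_of_int \<lfloor>real (Suc i) * ?x\<rfloor> / real (Suc i)"
    proof (rule always_eventually, rule allI)
      fix i
      have "real (Suc i) * ?x - 1 \<le> real_of_int \<lfloor>real (Suc i) * ?x\<rfloor>" by linarith
      then have "(real (Suc i) * ?x - 1) / real (Suc i) \<le> real_of_int \<lfloor>real (Suc i) * ?x\<rfloor> / real (Suc i)"
        by (intro divide_right_mono) auto
      then show "?x - 1 / real (Suc i) \<le> real_of_int \<lfloor>real (Suc i) * ?x\<rfloor> / real (Suc i)"
        by (simp add: diff_divide_distrib)
    qed
    show "\<forall>\<^sub>F i in sequentially. real_of_int \<lfloor>real (Suc i) * ?x\<rfloor> / real (Suc i) \<le> ?x"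
    proof (rule always_eventually, rule allI)
      fix i
      have "real_of_int \<lfloor>real (Suc i) * ?x\<rfloor> / real (Suc i) \<le> (real (Suc i) * ?x) / real (Suc i)"
        by (intro divide_right_mono) auto
      then show "real_of_int \<lfloor>real (Suc i) * ?x\<rfloor> / real (Suc i) \<le> ?x" by simp
    qed
    have "(\<lambda>i. 1 / real (Suc i)) \<longlonglongrightarrow> 0" using LIMSEQ_inverse_real_of_nat by (simp add: inverse_eq_divide)
    then show "(\<lambda>i. ?x - 1 / real (Suc i)) \<longlonglongrightarrow> ?x"
      using tendsto_diff[OF tendsto_const, of "\<lambda>i. 1 / real (Suc i)" 0 sequentially ?x] by simp
  qed auto
  from isCont_tendsto_compose[OF _ this, of "fst p"] cont
  show "(\<lambda>i. fst p (real_of_int \<lfloor>real (Suc i) * ?x\<rfloor> / real (Suc i))) \<longlonglongrightarrow> (case p of (f, x) \<Rightarrow> f x)"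
    by (simp add: case_prod_beta continuous_on_eq_continuous_at)
qed

lemma norm2_rho_gt:
  assumes "norm2_rho b g > ennreal t" "0 \<le> t"
  shows "ennreal (t\<^sup>2) \<le> (\<integral>\<^sup>+x. ennreal ((g x)\<^sup>2 * rho b x) \<partial>lborel)"
proof (cases "(\<integral>\<^sup>+x. ennreal ((g x)\<^sup>2 * rho b x) \<partial>lborel) = \<infinity>")
  case False
  let ?I = "(\<integral>\<^sup>+x. ennreal ((g x)\<^sup>2 * rho b x) \<partial>lborel)"
  have "ennreal t < ennreal (sqrt (enn2real ?I))"
    using assms(1) False by (simp add: norm2_rho_def)
  then have "t < sqrt (enn2real ?I)" by (simp add: ennreal_less_iff assms(2))
  then have "t\<^sup>2 \<le> enn2real ?I"
    using assms(2) by (metis enn2real_nonneg less_eq_real_def power_mono real_sqrt_pow2)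
  then have "ennreal (t\<^sup>2) \<le> ennreal (enn2real ?I)" by (rule ennreal_leI)
  also have "ennreal (enn2real ?I) = ?I" using False by (intro ennreal_enn2real) (simp add: less_top)
  finally show ?thesis .
qed simp

text \<open>Markov's inequality for the squared norm, followed by an exchange of integrals that reduces it to the
  second moments of single evaluations.  Markov's inequality is applied to a measurable event that
  contains the event in question.\<close>

lemma GP_law_tail_bound:
  assumes GP: "GP_law m k Q" and k: "\<And>x. 0 \<le> k x x" and f0 [measurable]: "f0 \<in> borel_measurable borel"
    and t: "t > 0" and b: "b > 0"
  shows "emeasure Q {f \<in> space Q. norm2_rho b (\<lambda>x. f x - f0 x) > ennreal t}
    \<le> ennreal (1 / t\<^sup>2) * (\<integral>\<^sup>+x. ennreal ((m x - f0 x)\<^sup>2 + k x x) \<partial>design_law b)"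
proof -
  interpret Q: prob_space Q using GP by (simp add: GP_law_def)
  interpret R: prob_space "design_law b" using b by (rule prob_space_design_law)
  interpret pair_sigma_finite Q "design_law b" ..
  have sQ: "sets Q = sets path_space" "space Q = space path_space" using GP by (auto simp: GP_law_def)
  have ev: "(\<lambda>p. fst p (snd p)) \<in> borel_measurable (Q \<Otimes>\<^sub>M design_law b)"
    using path_eval_measurable measurable_cong_sets[OF sets_pair_measure_cong[OF sQ(1) sets_design_law[of b]] refl, of "borel :: real measure"]
    by (simp add: case_prod_beta')
  then have meas [measurable]: "(\<lambda>(f, x). ennreal ((f x - f0 x)\<^sup>2)) \<in> borel_measurable (Q \<Otimes>\<^sub>M design_law b)"
    by (simp add: case_prod_beta')
  define V where "V f = (\<integral>\<^sup>+x. ennreal ((f x - f0 x)\<^sup>2) \<partial>design_law b)" for f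
  have [measurable]: "V \<in> borel_measurable Q"
    unfolding V_def using R.borel_measurable_nn_integral_fst[OF meas] by simp
  have sub: "{f \<in> space Q. norm2_rho b (\<lambda>x. f x - f0 x) > ennreal t} \<subseteq> {f \<in> space Q. 1 \<le> ennreal (1 / t\<^sup>2) * V f}"
  proof safe
    fix f assume f: "f \<in> space Q" "norm2_rho b (\<lambda>x. f x - f0 x) > ennreal t"
    then have "continuous_on UNIV f" by (simp add: sQ path_space_def space_restrict_space)
    then have [measurable]: "f \<in> borel_measurable borel" by (rule borel_measurable_continuous_onI)
    have "ennreal (t\<^sup>2) \<le> V f"
      unfolding V_def using norm2_rho_gt[OF f(2)] t b by (subst nn_integral_design_law) auto
    then have "ennreal (1 / t\<^sup>2) * ennreal (t\<^sup>2) \<le> ennreal (1 / t\<^sup>2) * V f" by (rule mult_left_mono) simp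
    then show "1 \<le> ennreal (1 / t\<^sup>2) * V f" using t by (simp add: ennreal_mult[symmetric])
  qed
  have "emeasure Q {f \<in> space Q. norm2_rho b (\<lambda>x. f x - f0 x) > ennreal t}
      \<le> emeasure Q {f \<in> space Q. 1 \<le> ennreal (1 / t\<^sup>2) * V f}"
    by (rule emeasure_mono[OF sub]) measurable
  also have "\<dots> \<le> ennreal (1 / t\<^sup>2) * (\<integral>\<^sup>+f. V f * indicator (space Q) f \<partial>Q)"
    by (rule nn_integral_Markov_inequality) auto
  also have "(\<integral>\<^sup>+f. V f * indicator (space Q) f \<partial>Q) = (\<integral>\<^sup>+f. V f \<partial>Q)"
    by (intro nn_integral_cong) simp
  also have "\<dots> = (\<integral>\<^sup>+x. (\<integral>\<^sup>+f. ennreal ((f x - f0 x)\<^sup>2) \<partial>Q) \<partial>design_law b)"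
    unfolding V_def by (rule Fubini'[symmetric]) measurable
  also have "\<dots> = (\<integral>\<^sup>+x. ennreal ((m x - f0 x)\<^sup>2 + k x x) \<partial>design_law b)"
    by (simp add: GP_law_second_moment[OF GP k])
  finally show ?thesis .
qed

lemma nn_integral_noise_sq:
  assumes \<sigma>: "\<sigma> > 0" and I: "finite I"
  shows "(\<integral>\<^sup>+e. ennreal ((\<beta> + (\<Sum>i\<in>I. w i * e i))\<^sup>2) \<partial>(\<Pi>\<^sub>M i\<in>I. density lborel (\<lambda>e. ennreal (normal_density 0 \<sigma> e))))
    = ennreal (\<beta>\<^sup>2 + \<sigma>\<^sup>2 * (\<Sum>i\<in>I. (w i)\<^sup>2))"
  using I
proof (induction I arbitrary: \<beta> rule: finite_induct)
  case empty
  then show ?case by (simp add: space_PiM nn_integral_count_space_finite PiM_empty)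
next
  case (insert j I)
  let ?N = "density lborel (\<lambda>e. ennreal (normal_density 0 \<sigma> e))"
  interpret N: prob_space ?N using \<sigma> by (rule prob_space_normal_density)
  interpret product_sigma_finite "\<lambda>_. ?N" ..
  have N: "?N = normal_law 0 (\<sigma>\<^sup>2)" using \<sigma> by (simp add: normal_law_def)
  have one: "(\<integral>\<^sup>+y. ennreal ((\<delta> + w j * y)\<^sup>2) \<partial>?N) = ennreal (\<delta>\<^sup>2 + (w j)\<^sup>2 * \<sigma>\<^sup>2)" for \<delta>
  proof (cases "w j = 0")
    case True
    then show ?thesis using N.emeasure_space_1 by simp
  next
    case False
    have "(\<integral>\<^sup>+y. ennreal ((\<delta> + w j * y)\<^sup>2) \<partial>?N) = (\<integral>\<^sup>+y. ennreal ((w j)\<^sup>2) * ennreal ((y - (- \<delta> / w j))\<^sup>2) \<partial>?N)"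
      using False by (intro nn_integral_cong) (simp add: ennreal_mult[symmetric] power_mult_distrib[symmetric] algebra_simps)
    also have "\<dots> = ennreal ((w j)\<^sup>2) * (\<integral>\<^sup>+y. ennreal ((y - (- \<delta> / w j))\<^sup>2) \<partial>?N)"
      by (rule nn_integral_cmult) simp
    also have "\<dots> = ennreal ((w j)\<^sup>2 * ((\<delta> / w j)\<^sup>2 + \<sigma>\<^sup>2))"
      unfolding N by (subst nn_integral_normal_law_sq) (auto simp: ennreal_mult)
    also have "(w j)\<^sup>2 * ((\<delta> / w j)\<^sup>2 + \<sigma>\<^sup>2) = \<delta>\<^sup>2 + (w j)\<^sup>2 * \<sigma>\<^sup>2"
      using False by (simp add: power_divide distrib_left)
    finally show ?thesis .
  qed
  have "(\<integral>\<^sup>+e. ennreal ((\<beta> + (\<Sum>i\<in>insert j I. w i * e i))\<^sup>2) \<partial>(\<Pi>\<^sub>M i\<in>insert j I. ?N))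
      = (\<integral>\<^sup>+e. (\<integral>\<^sup>+y. ennreal ((\<beta> + (\<Sum>i\<in>insert j I. w i * (e(j := y)) i))\<^sup>2) \<partial>?N) \<partial>(\<Pi>\<^sub>M i\<in>I. ?N))"
    by (rule product_nn_integral_insert) (use insert.hyps in auto)
  also have "\<dots> = (\<integral>\<^sup>+e. (\<integral>\<^sup>+y. ennreal (((\<beta> + (\<Sum>i\<in>I. w i * e i)) + w j * y)\<^sup>2) \<partial>?N) \<partial>(\<Pi>\<^sub>M i\<in>I. ?N))"
  proof (intro nn_integral_cong)
    fix e y
    have "(\<Sum>i\<in>I. w i * (e(j := y)) i) = (\<Sum>i\<in>I. w i * e i)"
      using insert.hyps by (intro sum.cong) auto
    then show "ennreal ((\<beta> + (\<Sum>i\<in>insert j I. w i * (e(j := y)) i))\<^sup>2) = ennreal (((\<beta> + (\<Sum>i\<in>I. w i * e i)) + w j * y)\<^sup>2)"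
      using insert.hyps by (simp add: algebra_simps)
  qed
  also have "\<dots> = (\<integral>\<^sup>+e. ennreal ((\<beta> + (\<Sum>i\<in>I. w i * e i))\<^sup>2) + ennreal ((w j)\<^sup>2 * \<sigma>\<^sup>2) \<partial>(\<Pi>\<^sub>M i\<in>I. ?N))"
    unfolding one by simp
  also have "\<dots> = (\<integral>\<^sup>+e. ennreal ((\<beta> + (\<Sum>i\<in>I. w i * e i))\<^sup>2) \<partial>(\<Pi>\<^sub>M i\<in>I. ?N)) + ennreal ((w j)\<^sup>2 * \<sigma>\<^sup>2)"
  proof -
    interpret P: prob_space "\<Pi>\<^sub>M i\<in>I. ?N" by (intro prob_space_PiM N.prob_space_axioms)
    show ?thesis by (subst nn_integral_add) (auto simp: P.emeasure_space_1)
  qed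
  also have "\<dots> = ennreal (\<beta>\<^sup>2 + \<sigma>\<^sup>2 * (\<Sum>i\<in>insert j I. (w i)\<^sup>2))"
    unfolding insert.IH using insert.hyps
    by (subst ennreal_plus[symmetric]) (auto simp: sum_nonneg algebra_simps)
  finally show ?case .
qed


lemma post_cov_measurable:
  fixes K :: "real \<Rightarrow> real \<Rightarrow> real"
  assumes K: "(\<lambda>p. K (fst p) (snd p)) \<in> borel_measurable (borel \<Otimes>\<^sub>M borel)"
    and X: "\<And>i. i \<in> {1..n} \<Longrightarrow> (\<lambda>\<omega>. X \<omega> i) \<in> borel_measurable M"
    and f: "f \<in> borel_measurable M" and g: "g \<in> borel_measurable M"
  shows "(\<lambda>\<omega>. post_cov K (X \<omega>) n (f \<omega>) (g \<omega>)) \<in> borel_measurable M"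
  using X f g
proof (induction n arbitrary: f g)
  case 0
  have "(\<lambda>\<omega>. (f \<omega>, g \<omega>)) \<in> measurable M (borel \<Otimes>\<^sub>M borel)" using 0 by simp
  from measurable_compose[OF this K] show ?case by simp
next
  case (Suc n)
  have [measurable]: "(\<lambda>\<omega>. X \<omega> (Suc n)) \<in> borel_measurable M" using Suc.prems(1) by simp
  have IH: "(\<lambda>\<omega>. post_cov K (X \<omega>) n (f' \<omega>) (g' \<omega>)) \<in> borel_measurable M"
    if "f' \<in> borel_measurable M" "g' \<in> borel_measurable M" for f' g'
    using Suc.prems(1) that by (intro Suc.IH) auto
  show ?case
    unfolding post_cov.simps using Suc.prems
    by (intro borel_measurable_diff borel_measurable_divide borel_measurable_times borel_measurable_add IH) auto
qed

lemma post_weight_measurable: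
  fixes K :: "real \<Rightarrow> real \<Rightarrow> real"
  assumes K: "(\<lambda>p. K (fst p) (snd p)) \<in> borel_measurable (borel \<Otimes>\<^sub>M borel)"
    and X: "\<And>i. i \<in> {1..n} \<Longrightarrow> (\<lambda>\<omega>. X \<omega> i) \<in> borel_measurable M"
    and f: "f \<in> borel_measurable M"
  shows "(\<lambda>\<omega>. post_weight K (X \<omega>) n (f \<omega>) i) \<in> borel_measurable M"
  using X f
proof (induction n arbitrary: f)
  case (Suc n)
  have [measurable]: "(\<lambda>\<omega>. X \<omega> (Suc n)) \<in> borel_measurable M" using Suc.prems(1) by simp
  have pc: "(\<lambda>\<omega>. post_cov K (X \<omega>) n (f' \<omega>) (g' \<omega>)) \<in> borel_measurable M"
    if "f' \<in> borel_measurable M" "g' \<in> borel_measurable M" for f' g'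
    using Suc.prems(1) that by (intro post_cov_measurable[OF K]) auto
  have IH: "(\<lambda>\<omega>. post_weight K (X \<omega>) n (f' \<omega>) i) \<in> borel_measurable M"
    if "f' \<in> borel_measurable M" for f'
    using Suc.prems(1) that by (intro Suc.IH) auto
  show ?case
    unfolding post_weight.simps Let_def using Suc.prems
    by (cases "i = Suc n") (auto intro!: borel_measurable_diff borel_measurable_divide borel_measurable_times borel_measurable_add IH pc)
qed simp

lemma post_cov_cong:
  assumes "\<And>i. i \<in> {1..n} \<Longrightarrow> X i = X' i"
  shows "post_cov K X n = post_cov K X' n"
  using assms by (induction n) auto

lemma post_weight_cong:
  assumes "\<And>i. i \<in> {1..n} \<Longrightarrow> X i = X' i"
  shows "post_weight K X n = post_weight K X' n"
  using assms
proof (induction n)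
  case (Suc n)
  then have "post_weight K X n = post_weight K X' n" "post_cov K X n = post_cov K X' n" "X (Suc n) = X' (Suc n)"
    using post_cov_cong[of n X X'] by auto
  then show ?case by (simp only: post_weight.simps)
qed simp

text \<open>Squared bias of the posterior mean at the fresh point \<open>Z (Suc n)\<close>, given the design \<open>Z 1, ..., Z n\<close>, plus
  twice the posterior variance there: once for itself and once as a bound for the noise variance.\<close>

definition loo_risk :: "real \<Rightarrow> (real \<Rightarrow> real \<Rightarrow> real) \<Rightarrow> (real \<Rightarrow> real) \<Rightarrow> nat \<Rightarrow> (nat \<Rightarrow> real) \<Rightarrow> real" where
  "loo_risk \<sigma> K f0 n Z =
     (f0 (Z (Suc n)) - (\<Sum>i=1..n. post_weight K Z n (Z (Suc n)) i * f0 (Z i)))\<^sup>2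
     + 2 * \<sigma>\<^sup>2 * post_cov K Z n (Z (Suc n)) (Z (Suc n))"

lemma loo_risk_measurable:
  assumes K: "(\<lambda>p. K (fst p) (snd p)) \<in> borel_measurable (borel \<Otimes>\<^sub>M borel)"
    and [measurable]: "f0 \<in> borel_measurable borel"
    and X [measurable]: "\<And>i. i \<in> {1..Suc n} \<Longrightarrow> (\<lambda>\<omega>. X \<omega> i) \<in> borel_measurable M"
  shows "(\<lambda>\<omega>. loo_risk \<sigma> K f0 n (X \<omega>)) \<in> borel_measurable M"
proof -
  have [measurable]: "(\<lambda>\<omega>. X \<omega> (Suc n)) \<in> borel_measurable M" by simp
  have [measurable]: "(\<lambda>\<omega>. post_cov K (X \<omega>) n (X \<omega> (Suc n)) (X \<omega> (Suc n))) \<in> borel_measurable M"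
    by (rule post_cov_measurable[OF K]) auto
  have [measurable]: "(\<lambda>\<omega>. post_weight K (X \<omega>) n (X \<omega> (Suc n)) i) \<in> borel_measurable M" for i
    by (rule post_weight_measurable[OF K]) auto
  have [measurable]: "(\<lambda>\<omega>. f0 (X \<omega> i)) \<in> borel_measurable M" if "i \<in> {1..n}" for i
    using that by (intro measurable_compose[OF X]) auto
  show ?thesis unfolding loo_risk_def by measurable
qed

abbreviation expected_tail ::
  "real \<Rightarrow> real \<Rightarrow> (real \<Rightarrow> real) measure \<Rightarrow> nat \<Rightarrow> (real \<Rightarrow> real) \<Rightarrow> real \<Rightarrow> ennreal" where
  "expected_tail b \<sigma> P n f0 t \<equiv> (\<integral>\<^sup>+ (X, Y). emeasure (posterior \<sigma> P n X Y)
     {f \<in> space P. norm2_rho b (\<lambda>x. f x - f0 x) > ennreal t} \<partial>data_law b \<sigma> n f0)"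

text \<open>Given the design, the noise integrates to \<open>\<sigma>\<^sup>2\<close> times the sum of the squared weights.  The point \<open>x\<close> of the
  squared norm is then an independent draw from the design law, that is, the last coordinate of an
  \<open>(n + 1)\<close>-fold product.\<close>

lemma expected_posterior_tail:
  assumes GP: "GP_law (\<lambda>x. 0) (\<lambda>x x'. \<sigma>\<^sup>2 * K x x') P" and psd: "\<And>I. finite I \<Longrightarrow> psd_on I K"
    and K: "(\<lambda>p. K (fst p) (snd p)) \<in> borel_measurable (borel \<Otimes>\<^sub>M borel)"
    and f0 [measurable]: "f0 \<in> borel_measurable borel"
    and \<sigma>: "\<sigma> > 0" and b: "b > 0" and t: "t > 0"
  shows "expected_tail b \<sigma> P n f0 t
    \<le> ennreal (1 / t\<^sup>2) * (\<integral>\<^sup>+ Z. ennreal (loo_risk \<sigma> K f0 n Z) \<partial>(\<Pi>\<^sub>M i\<in>{1..Suc n}. design_law b))"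
proof -
  let ?R = "design_law b" and ?N = "density lborel (\<lambda>e. ennreal (normal_density 0 \<sigma> e))"
  let ?D = "\<Pi>\<^sub>M i\<in>{1..n}. ?R" and ?E = "\<Pi>\<^sub>M i\<in>{1..n}. ?N"
  interpret R: prob_space ?R using b by (rule prob_space_design_law)
  interpret N: prob_space ?N using \<sigma> by (rule prob_space_normal_density)
  interpret RP: product_sigma_finite "\<lambda>_::nat. ?R" ..
  interpret D: prob_space ?D by (intro prob_space_PiM R.prob_space_axioms)
  interpret E: prob_space ?E by (intro prob_space_PiM N.prob_space_axioms)
  interpret ER: pair_sigma_finite ?E ?R ..
  define r where "r X Y x = (\<Sum>i=1..n. post_weight K X n x i * Y i) - f0 x" for X Y x
  define v where "v X x = \<sigma>\<^sup>2 * post_cov K X n x x" for X x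
  define h where "h X Y = (\<integral>\<^sup>+x. ennreal ((r X Y x)\<^sup>2 + v X x) \<partial>?R)" for X Y
  have Dc: "(\<lambda>X. X i) \<in> borel_measurable ?D" and Ec: "(\<lambda>e. e i) \<in> borel_measurable ?E" if "i \<in> {1..n}" for i
    using measurable_component_singleton[OF that, of "\<lambda>_. ?R"] measurable_component_singleton[OF that, of "\<lambda>_. ?N"]
    by simp_all
  have v0: "v X x \<ge> 0" for X x by (simp add: v_def post_cov_diag_nonneg[OF psd])
  have rv: "(\<lambda>\<omega>. ennreal ((r (X \<omega>) (Y \<omega>) (f \<omega>))\<^sup>2 + v (X \<omega>) (f \<omega>))) \<in> borel_measurable M"
    if "\<And>i. i \<in> {1..n} \<Longrightarrow> (\<lambda>\<omega>. X \<omega> i) \<in> borel_measurable M"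
      "\<And>i. i \<in> {1..n} \<Longrightarrow> (\<lambda>\<omega>. Y \<omega> i) \<in> borel_measurable M" "f \<in> borel_measurable M"
    for X Y :: "_ \<Rightarrow> nat \<Rightarrow> real" and f and M :: "'m measure"
  proof -
    note that(3)[measurable]
    have [measurable]: "(\<lambda>\<omega>. post_weight K (X \<omega>) n (f \<omega>) i) \<in> borel_measurable M" for i
      by (rule post_weight_measurable[OF K that(1,3)])
    have [measurable]: "(\<lambda>\<omega>. post_cov K (X \<omega>) n (f \<omega>) (f \<omega>)) \<in> borel_measurable M"
      by (rule post_cov_measurable[OF K that(1,3,3)])
    have "(\<lambda>\<omega>. \<Sum>i=1..n. post_weight K (X \<omega>) n (f \<omega>) i * Y \<omega> i) \<in> borel_measurable M"
      by (intro borel_measurable_sum borel_measurable_times that(2)) auto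
    then show ?thesis unfolding r_def v_def by measurable
  qed
  have "expected_tail b \<sigma> P n f0 t
    \<le> (\<integral>\<^sup>+ (X, Y). ennreal (1 / t\<^sup>2) * h X Y \<partial>data_law b \<sigma> n f0)"
  proof (rule nn_integral_mono, clarify)
    fix X Y :: "nat \<Rightarrow> real"
    have "space P = space (posterior \<sigma> P n X Y)" by (simp add: posterior_def)
    then show "emeasure (posterior \<sigma> P n X Y) {f \<in> space P. norm2_rho b (\<lambda>x. f x - f0 x) > ennreal t} \<le> ennreal (1 / t\<^sup>2) * h X Y"
      using GP_law_tail_bound[OF posterior_GP_law[OF GP psd \<sigma>, where n=n and X=X and Y=Y] _ f0 t b] v0
      by (simp add: h_def r_def v_def)
  qed
  also have "\<dots> = (\<integral>\<^sup>+ p. ennreal (1 / t\<^sup>2) * h (fst p) (snd p) \<partial>data_law b \<sigma> n f0)"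
    by (simp add: case_prod_beta')
  also have "\<dots> = (\<integral>\<^sup>+ p. ennreal (1 / t\<^sup>2) * h (fst p) (\<lambda>i\<in>{1..n}. f0 (fst p i) + snd p i) \<partial>(?D \<Otimes>\<^sub>M ?E))"
  proof -
    let ?B = "(\<Pi>\<^sub>M i\<in>{1..n}. borel) :: (nat \<Rightarrow> real) measure"
    have "(\<lambda>q. ennreal ((r (fst (fst q)) (snd (fst q)) (snd q))\<^sup>2 + v (fst (fst q)) (snd q))) \<in> borel_measurable ((?B \<Otimes>\<^sub>M ?B) \<Otimes>\<^sub>M ?R)"
      by (rule rv) (auto intro!: measurable_compose[OF measurable_fst] measurable_compose[OF measurable_snd]
          measurable_component_singleton)
    from R.borel_measurable_nn_integral_fst[OF this]
    have [measurable]: "(\<lambda>p. h (fst p) (snd p)) \<in> borel_measurable (?B \<Otimes>\<^sub>M ?B)"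
      unfolding h_def by simp
    have hm: "(\<lambda>p. ennreal (1 / t\<^sup>2) * h (fst p) (snd p)) \<in> borel_measurable (?B \<Otimes>\<^sub>M ?B)"
      by measurable
    have T: "(\<lambda>(X, \<epsilon>). (X, \<lambda>i\<in>{1..n}. f0 (X i) + \<epsilon> i)) \<in> measurable (?D \<Otimes>\<^sub>M ?E) (?B \<Otimes>\<^sub>M ?B)"
    proof -
      have 1: "fst \<in> measurable (?D \<Otimes>\<^sub>M ?E) ?B"
      proof -
        have "sets ?D = sets ?B" by (intro sets_PiM_cong) auto
        from measurable_cong_sets[OF refl this] show ?thesis using measurable_fst[of ?D ?E] by blast
      qed
      have 2: "(\<lambda>p. \<lambda>i\<in>{1..n}. f0 (fst p i) + snd p i) \<in> measurable (?D \<Otimes>\<^sub>M ?E) ?B"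
        by (intro measurable_restrict borel_measurable_add measurable_compose[OF _ f0]
            measurable_compose[OF measurable_fst Dc] measurable_compose[OF measurable_snd Ec])
      from measurable_Pair[OF 1 2] show ?thesis by (simp add: case_prod_beta')
    qed
    show ?thesis
      unfolding data_law_def design_law_def[symmetric]
      by (subst nn_integral_distr[OF T], unfold measurable_distr_eq1, rule hm) (simp add: case_prod_beta')
  qed
  also have "\<dots> = ennreal (1 / t\<^sup>2) * (\<integral>\<^sup>+ X. (\<integral>\<^sup>+ e. h X (\<lambda>i\<in>{1..n}. f0 (X i) + e i) \<partial>?E) \<partial>?D)"
  proof -
    let ?q = "\<lambda>p. \<lambda>i\<in>{1..n}. f0 (fst p i) + snd p i"
    have "(\<lambda>q. ennreal ((r (fst (fst q)) (?q (fst q)) (snd q))\<^sup>2 + v (fst (fst q)) (snd q))) \<in> borel_measurable ((?D \<Otimes>\<^sub>M ?E) \<Otimes>\<^sub>M ?R)"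
      by (rule rv) (auto intro!: borel_measurable_add measurable_compose[OF _ f0]
            measurable_compose[OF measurable_fst] measurable_compose[OF measurable_snd] Dc Ec)
    from R.borel_measurable_nn_integral_fst[OF this]
    have m: "(\<lambda>p. h (fst p) (?q p)) \<in> borel_measurable (?D \<Otimes>\<^sub>M ?E)"
      unfolding h_def by simp
    show ?thesis
      unfolding nn_integral_cmult[OF m] using E.nn_integral_fst[OF m] by simp
  qed
  also have "\<dots> \<le> ennreal (1 / t\<^sup>2) * (\<integral>\<^sup>+ X. (\<integral>\<^sup>+ x. ennreal (loo_risk \<sigma> K f0 n (X(Suc n := x))) \<partial>?R) \<partial>?D)"
  proof (intro mult_left_mono nn_integral_mono)
    fix X assume "X \<in> space ?D"
    have "(\<integral>\<^sup>+ e. h X (\<lambda>i\<in>{1..n}. f0 (X i) + e i) \<partial>?E)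
        = (\<integral>\<^sup>+ x. (\<integral>\<^sup>+ e. ennreal ((r X (\<lambda>i\<in>{1..n}. f0 (X i) + e i) x)\<^sup>2 + v X x) \<partial>?E) \<partial>?R)"
      unfolding h_def
    proof (rule ER.Fubini'[symmetric])
      have "(\<lambda>q. ennreal ((r X (\<lambda>i\<in>{1..n}. f0 (X i) + fst q i) (snd q))\<^sup>2 + v X (snd q))) \<in> borel_measurable (?E \<Otimes>\<^sub>M ?R)"
        by (rule rv) (auto intro!: borel_measurable_add measurable_compose[OF measurable_fst] Ec)
      then show "(\<lambda>(e, x). ennreal ((r X (\<lambda>i\<in>{1..n}. f0 (X i) + e i) x)\<^sup>2 + v X x)) \<in> borel_measurable (?E \<Otimes>\<^sub>M ?R)"
        by (simp add: case_prod_beta')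
    qed
    also have "\<dots> \<le> (\<integral>\<^sup>+ x. ennreal (loo_risk \<sigma> K f0 n (X(Suc n := x))) \<partial>?R)"
    proof (rule nn_integral_mono)
      fix x
      define w where "w = post_weight K X n x"
      define \<beta> where "\<beta> = (\<Sum>i=1..n. w i * f0 (X i)) - f0 x"
      have "(\<integral>\<^sup>+ e. ennreal ((r X (\<lambda>i\<in>{1..n}. f0 (X i) + e i) x)\<^sup>2 + v X x) \<partial>?E)
        = (\<integral>\<^sup>+ e. ennreal ((\<beta> + (\<Sum>i\<in>{1..n}. w i * e i))\<^sup>2) + ennreal (v X x) \<partial>?E)"
        using v0 by (intro nn_integral_cong) (simp add: r_def \<beta>_def w_def distrib_left sum.distrib algebra_simps)
      also have "\<dots> = ennreal (\<beta>\<^sup>2 + \<sigma>\<^sup>2 * (\<Sum>i\<in>{1..n}. (w i)\<^sup>2)) + ennreal (v X x)"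
        by (subst nn_integral_add) (auto simp: nn_integral_noise_sq[OF \<sigma>] E.emeasure_space_1 simp del: One_nat_def)
      also have "\<dots> \<le> ennreal (loo_risk \<sigma> K f0 n (X(Suc n := x)))"
      proof -
        have c: "post_cov K (X(Suc n := x)) n = post_cov K X n" "post_weight K (X(Suc n := x)) n = post_weight K X n"
          by (auto intro!: post_cov_cong post_weight_cong)
        have "(\<Sum>i=1..n. post_weight K X n x i * f0 ((X(Suc n := x)) i)) = (\<Sum>i=1..n. w i * f0 (X i))"
          by (intro sum.cong) (auto simp: w_def)
        then have "loo_risk \<sigma> K f0 n (X(Suc n := x)) = \<beta>\<^sup>2 + 2 * \<sigma>\<^sup>2 * post_cov K X n x x"
          unfolding loo_risk_def c by (simp add: \<beta>_def power2_commute)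
        moreover have "\<sigma>\<^sup>2 * (\<Sum>i\<in>{1..n}. (w i)\<^sup>2) \<le> \<sigma>\<^sup>2 * post_cov K X n x x"
          unfolding w_def by (intro mult_left_mono post_weight_sq_le[OF psd]) auto
        ultimately have "\<beta>\<^sup>2 + \<sigma>\<^sup>2 * (\<Sum>i\<in>{1..n}. (w i)\<^sup>2) + v X x \<le> loo_risk \<sigma> K f0 n (X(Suc n := x))"
          by (simp add: v_def)
        then show ?thesis
          using v0[of X x] by (subst ennreal_plus[symmetric]) (auto intro!: ennreal_leI sum_nonneg add_nonneg_nonneg mult_nonneg_nonneg)
      qed
      finally show "(\<integral>\<^sup>+ e. ennreal ((r X (\<lambda>i\<in>{1..n}. f0 (X i) + e i) x)\<^sup>2 + v X x) \<partial>?E) \<le> ennreal (loo_risk \<sigma> K f0 n (X(Suc n := x)))" .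
    qed
    finally show "(\<integral>\<^sup>+ e. h X (\<lambda>i\<in>{1..n}. f0 (X i) + e i) \<partial>?E) \<le> (\<integral>\<^sup>+ x. ennreal (loo_risk \<sigma> K f0 n (X(Suc n := x))) \<partial>?R)" .
  qed simp
  also have "(\<integral>\<^sup>+ X. (\<integral>\<^sup>+ x. ennreal (loo_risk \<sigma> K f0 n (X(Suc n := x))) \<partial>?R) \<partial>?D)
      = (\<integral>\<^sup>+ Z. ennreal (loo_risk \<sigma> K f0 n Z) \<partial>(\<Pi>\<^sub>M i\<in>insert (Suc n) {1..n}. ?R))"
  proof (rule RP.product_nn_integral_insert[symmetric])
    show "(\<lambda>Z. ennreal (loo_risk \<sigma> K f0 n Z)) \<in> borel_measurable (\<Pi>\<^sub>M i\<in>insert (Suc n) {1..n}. ?R)"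
    proof -
      have "(\<lambda>Z. Z i) \<in> borel_measurable (\<Pi>\<^sub>M i\<in>insert (Suc n) {1..n}. ?R)" if "i \<in> {1..Suc n}" for i
      proof -
        have "i \<in> insert (Suc n) {1..n}" using that by auto
        from measurable_component_singleton[OF this, of "\<lambda>_. ?R"] show ?thesis by (simp only: measurable_design_law)
      qed
      from loo_risk_measurable[OF K f0 this, where \<sigma>=\<sigma>] show ?thesis by measurable
    qed
  qed auto
  also have "insert (Suc n) {1..n} = {1..Suc n}" by auto
  finally show ?thesis .
qed

section \<open>Bounding the leave-one-out risk by exchangeability\<close>

lemma nn_integral_component:
  assumes "\<And>i. i \<in> I \<Longrightarrow> prob_space (M i)" "i \<in> I" "g \<in> borel_measurable (M i)"
  shows "(\<integral>\<^sup>+Z. g (Z i) \<partial>(\<Pi>\<^sub>M i\<in>I. M i)) = (\<integral>\<^sup>+x. g x \<partial>M i)"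
proof -
  have "(\<integral>\<^sup>+x. g x \<partial>M i) = (\<integral>\<^sup>+x. g x \<partial>distr (\<Pi>\<^sub>M i\<in>I. M i) (M i) (\<lambda>Z. Z i))"
    by (subst distr_PiM_component[OF assms(1,2)]) auto
  also have "\<dots> = (\<integral>\<^sup>+Z. g (Z i) \<partial>(\<Pi>\<^sub>M i\<in>I. M i))"
    using assms by (intro nn_integral_distr) auto
  finally show ?thesis by simp
qed

text \<open>The sample \<open>Z\<close> with its \<open>i\<close>-th point moved to the last place, where it plays the fresh point.\<close>

abbreviation swap_last :: "nat \<Rightarrow> nat \<Rightarrow> (nat \<Rightarrow> 'a) \<Rightarrow> nat \<Rightarrow> 'a" where
  "swap_last n i Z \<equiv> (\<lambda>j\<in>{1..Suc n}. Z (Transposition.transpose i (Suc n) j))"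

lemma transpose_in: "i \<in> {1..Suc n} \<Longrightarrow> j \<in> {1..Suc n} \<Longrightarrow> Transposition.transpose i (Suc n) j \<in> {1..Suc n}"
  by (auto simp: Transposition.transpose_def)

text \<open>The product law is invariant under permutations, so each of the \<open>n + 1\<close> points may play the fresh point.\<close>

lemma exchangeable_average:
  assumes R: "prob_space R" and q [measurable]: "q \<in> borel_measurable (\<Pi>\<^sub>M i\<in>{1..Suc n}. R)"
  shows "of_nat (Suc n) * (\<integral>\<^sup>+Z. q Z \<partial>(\<Pi>\<^sub>M i\<in>{1..Suc n}. R)) =
    (\<integral>\<^sup>+Z. (\<Sum>i\<in>{1..Suc n}. q (swap_last n i Z)) \<partial>(\<Pi>\<^sub>M i\<in>{1..Suc n}. R))"
proof -
  interpret R: prob_space R by fact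
  interpret product_prob_space "\<lambda>_::nat. R" ..
  let ?N = "{1..Suc n}" let ?P = "\<Pi>\<^sub>M i\<in>?N. R"
  have m: "swap_last n i \<in> measurable ?P ?P" if "i \<in> ?N" for i
    using that by (intro measurable_restrict measurable_component_singleton transpose_in)
  have eq: "(\<integral>\<^sup>+Z. q (swap_last n i Z) \<partial>?P) = (\<integral>\<^sup>+Z. q Z \<partial>?P)" if i: "i \<in> ?N" for i
  proof -
    have "distr ?P ?P (\<lambda>Z. swap_last n i Z) = ?P"
      using i by (intro distr_reorder) (auto simp: inj_on_def Transposition.transpose_def split: if_splits)
    then have "(\<integral>\<^sup>+Z. q Z \<partial>?P) = (\<integral>\<^sup>+Z. q Z \<partial>distr ?P ?P (\<lambda>Z. swap_last n i Z))" by simp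
    also have "\<dots> = (\<integral>\<^sup>+Z. q (swap_last n i Z) \<partial>?P)"
      by (rule nn_integral_distr[OF m[OF i]]) (unfold measurable_distr_eq1, rule q)
    finally show ?thesis by simp
  qed
  have "(\<integral>\<^sup>+Z. (\<Sum>i\<in>?N. q (swap_last n i Z)) \<partial>?P) = (\<Sum>i\<in>?N. (\<integral>\<^sup>+Z. q (swap_last n i Z) \<partial>?P))"
    by (rule nn_integral_sum) (rule measurable_compose[OF m q])
  also have "\<dots> = (\<Sum>i\<in>?N. (\<integral>\<^sup>+Z. q Z \<partial>?P))" by (intro sum.cong refl eq)
  also have "\<dots> = of_nat (Suc n) * (\<integral>\<^sup>+Z. q Z \<partial>?P)" by simp
  finally show ?thesis by simp
qed

text \<open>Regressing each point of the sample on the others gives a leave-one-out system: the normal equations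
  give the zero entries, the formula for the posterior variance the entry at the left-out index.\<close>

lemma loo_regression:
  fixes K :: "real \<Rightarrow> real \<Rightarrow> real" and Z :: "nat \<Rightarrow> real" and n :: nat
  assumes psd: "\<And>I. finite I \<Longrightarrow> psd_on I K"
  defines "v \<equiv> \<lambda>i j. if Transposition.transpose i (Suc n) j = Suc n then 1
      else - post_weight K (swap_last n i Z) n (Z i) (Transposition.transpose i (Suc n) j)"
  defines "s \<equiv> \<lambda>i. post_cov K (swap_last n i Z) n (Z i) (Z i)"
  shows "leave_one_out {1..Suc n} (\<lambda>i j. K (Z i) (Z j)) v s"
    and "i \<in> {1..Suc n} \<Longrightarrow> loo_risk \<sigma> K f0 n (swap_last n i Z) = (\<Sum>k\<in>{1..Suc n}. v i k * f0 (Z k))\<^sup>2 + 2 * \<sigma>\<^sup>2 * s i"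
proof -
  let ?N = "{1..Suc n}"
  have sym: "K x y = K y x" for x y using post_cov_sym[OF psd, of Z 0] by simp
  have N: "?N = insert (Suc n) {1..n}" by auto
  have last: "swap_last n i Z (Suc n) = Z i" for i by simp
  have re: "(\<Sum>k\<in>?N. v i k * g (Z k)) = g (Z i) - (\<Sum>k=1..n. post_weight K (swap_last n i Z) n (Z i) k * g (swap_last n i Z k))"
    if i: "i \<in> ?N" for i and g :: "real \<Rightarrow> real"
  proof -
    let ?t = "Transposition.transpose i (Suc n)"
    have "(\<Sum>k\<in>?N. v i k * g (Z k)) = (\<Sum>k\<in>?N. v i (?t k) * g (Z (?t k)))"
      using i by (intro sum.reindex_bij_witness[of _ ?t ?t]) (simp_all add: transpose_in del: One_nat_def atLeastAtMost_iff)
    also have "\<dots> = v i (?t (Suc n)) * g (Z (?t (Suc n))) + (\<Sum>k=1..n. v i (?t k) * g (Z (?t k)))"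
      unfolding N by (subst sum.insert) auto
    also have "v i (?t (Suc n)) * g (Z (?t (Suc n))) = g (Z i)" by (simp add: v_def)
    also have "(\<Sum>k=1..n. v i (?t k) * g (Z (?t k))) = (\<Sum>k=1..n. - (post_weight K (swap_last n i Z) n (Z i) k * g (swap_last n i Z k)))"
      by (intro sum.cong refl) (auto simp: v_def)
    finally show ?thesis by (simp add: sum_negf)
  qed
  show "loo_risk \<sigma> K f0 n (swap_last n i Z) = (\<Sum>k\<in>{1..Suc n}. v i k * f0 (Z k))\<^sup>2 + 2 * \<sigma>\<^sup>2 * s i" if "i \<in> ?N"
    unfolding re[OF that] loo_risk_def last s_def ..
  show "leave_one_out ?N (\<lambda>i j. K (Z i) (Z j)) v s"
  proof
    show "finite ?N" by simp
    show "psd_on ?N (\<lambda>i j. K (Z i) (Z j))"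
      by (rule psd_on_pullback[where p=Z]) (auto intro: psd)
    show "v i i = 1" for i by (simp add: v_def)
    fix i j assume i: "i \<in> ?N" and j: "j \<in> ?N"
    let ?t = "Transposition.transpose i (Suc n)" and ?W = "swap_last n i Z"
    have "(\<Sum>k\<in>?N. K (Z j) (Z k) * v i k) = K (Z j) (Z i) - (\<Sum>k=1..n. post_weight K ?W n (Z i) k * K (Z j) (?W k))"
      using re[OF i, of "K (Z j)"] by (simp only: mult.commute)
    also have "\<dots> = K (Z i) (Z j) - (\<Sum>k=1..n. post_weight K ?W n (Z i) k * K (?W k) (Z j))"
      by (simp only: sym[of "Z j"])
    also have "\<dots> = post_cov K ?W n (Z i) (Z j)"
      by (rule post_cov_eq[OF psd, symmetric])
    finally have S: "(\<Sum>k\<in>?N. K (Z j) (Z k) * v i k) = post_cov K ?W n (Z i) (Z j)" .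
    show "v i j + (\<Sum>k\<in>?N. K (Z j) (Z k) * v i k) = (if j = i then 1 + s i else 0)"
    proof (cases "j = i")
      case True
      then show ?thesis unfolding S by (simp add: v_def s_def)
    next
      case False
      then have t: "?t j \<in> {1..n}" using i j by (auto simp: Transposition.transpose_def)
      then have "?W (?t j) = Z j" by simp
      with post_weight_normal_eq[OF psd t, of ?W "Z i"]
      have "post_weight K ?W n (Z i) (?t j) = post_cov K ?W n (Z i) (Z j)" by simp
      then show ?thesis unfolding S using t False by (simp add: v_def)
    qed
  qed
qed

context se_eigensystem
begin

text \<open>The diagonal of the kernel minus its first \<open>J\<close> eigenterms.\<close>

definition diag_rem :: "nat \<Rightarrow> real \<Rightarrow> real" where
  "diag_rem J x = 1 - (\<Sum>k<J. eigval k * (\<phi> k x)\<^sup>2)"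

lemma rem_nonneg: "0 \<le> diag_rem J x"
  using psd_on_diag[OF psd_remainder[of "{x}" J], of x] by (simp add: diag_rem_def se_kernel_def power2_eq_square)

lemma eigfun_measurable [measurable]: "\<phi> k \<in> borel_measurable borel"
proof -
  have "poly p \<in> borel_measurable borel" for p :: "real poly"
    by (intro borel_measurable_continuous_onI continuous_intros)
  note this[measurable]
  show ?thesis unfolding eigfun_Suc by measurable
qed

lemma nn_integral_rem: "(\<integral>\<^sup>+x. ennreal (diag_rem J x) \<partial>design_law b) = ennreal (B ^ J)"
proof -
  have rho1: "has_bochner_integral lborel (rho b) 1"
  proof -
    have "rho b = normal_density 0 (1 / (2 * sqrt b))" by (rule ext) (rule rho_normal[OF b])
    then show ?thesis
      using integrable_normal_density[of "1 / (2 * sqrt b)" 0] integral_normal_density[of "1 / (2 * sqrt b)" 0] b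
      by (simp add: has_bochner_integral_iff)
  qed
  have "has_bochner_integral lborel (\<lambda>x. rho b x - (\<Sum>k<J. eigval k * (rho b x * (\<phi> k x * \<phi> k x))))
      (1 - (\<Sum>k<J. eigval k * (if k = k then 1 else 0)))"
    by (intro has_bochner_integral_diff has_bochner_integral_sum has_bochner_integral_mult_right rho1 eigfun_orthonormal)
  also have "(\<lambda>x. rho b x - (\<Sum>k<J. eigval k * (rho b x * (\<phi> k x * \<phi> k x)))) = (\<lambda>x. diag_rem J x * rho b x)"
    unfolding diag_rem_def left_diff_distrib sum_distrib_right by (simp add: power2_eq_square mult_ac)
  finally have *: "has_bochner_integral lborel (\<lambda>x. diag_rem J x * rho b x) (B ^ J)"
    by (simp add: eigval_sum)
  have [measurable]: "diag_rem J \<in> borel_measurable borel" unfolding diag_rem_def by measurable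
  have "(\<integral>\<^sup>+x. ennreal (diag_rem J x) \<partial>design_law b) = (\<integral>\<^sup>+x. ennreal (diag_rem J x * rho b x) \<partial>lborel)"
    by (rule nn_integral_design_law[OF b]) measurable
  also have "\<dots> = ennreal (B ^ J)"
    using * by (subst nn_integral_eq_integral) (auto simp: has_bochner_integral_iff rem_nonneg rho_nonneg[OF b])
  finally show ?thesis .
qed

text \<open>The truncated series has squared reproducing-kernel norm \<open>\<Sum> \<theta>\<^sub>k\<^sup>2/\<mu>\<^sub>k\<close>; stated by duality, this is the
  Cauchy--Schwarz inequality together with the domination of the eigenterms by the kernel.\<close>

lemma rkhs_bound:
  fixes Z :: "nat \<Rightarrow> real"
  assumes "finite I"
  shows "(\<Sum>i\<in>I. z i * (\<Sum>k<J. \<theta> k * \<phi> k (Z i)))\<^sup>2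
    \<le> (\<Sum>k<J. (\<theta> k)\<^sup>2 / eigval k) * (\<Sum>i\<in>I. \<Sum>j\<in>I. z i * z j * se_kernel a (Z i) (Z j))"
proof -
  define e where "e k = (\<Sum>i\<in>I. z i * \<phi> k (Z i))" for k
  have "(\<Sum>i\<in>I. z i * (\<Sum>k<J. \<theta> k * \<phi> k (Z i))) = (\<Sum>k<J. (\<theta> k / sqrt (eigval k)) * (sqrt (eigval k) * e k))"
  proof -
    have "sqrt (eigval k) \<noteq> 0" for k using eigval_pos[of k] by simp
    then have "(\<Sum>k<J. (\<theta> k / sqrt (eigval k)) * (sqrt (eigval k) * e k)) = (\<Sum>k<J. \<Sum>i\<in>I. z i * (\<theta> k * \<phi> k (Z i)))"
      by (intro sum.cong refl) (simp add: e_def sum_distrib_left mult_ac)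
    also have "\<dots> = (\<Sum>i\<in>I. \<Sum>k<J. z i * (\<theta> k * \<phi> k (Z i)))" by (rule sum.swap)
    finally show ?thesis by (simp add: sum_distrib_left)
  qed
  then have "(\<Sum>i\<in>I. z i * (\<Sum>k<J. \<theta> k * \<phi> k (Z i)))\<^sup>2
      \<le> (\<Sum>k<J. (\<theta> k / sqrt (eigval k))\<^sup>2) * (\<Sum>k<J. (sqrt (eigval k) * e k)\<^sup>2)"
    by (simp only: Cauchy_Schwarz_ineq_sum)
  also have "(\<Sum>k<J. (\<theta> k / sqrt (eigval k))\<^sup>2) = (\<Sum>k<J. (\<theta> k)\<^sup>2 / eigval k)"
    using eigval_pos by (simp add: power_divide less_imp_le)
  also have "(\<Sum>k<J. (sqrt (eigval k) * e k)\<^sup>2) = (\<Sum>k<J. eigval k * (e k)\<^sup>2)"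
    using eigval_pos by (simp add: power_mult_distrib less_imp_le)
  also have "(\<Sum>k<J. (\<theta> k)\<^sup>2 / eigval k) * (\<Sum>k<J. eigval k * (e k)\<^sup>2)
      \<le> (\<Sum>k<J. (\<theta> k)\<^sup>2 / eigval k) * (\<Sum>i\<in>I. \<Sum>j\<in>I. z i * z j * se_kernel a (Z i) (Z j))"
  proof (intro mult_left_mono)
    have psd: "psd_on I (\<lambda>i j. se_kernel a (Z i) (Z j) - (\<Sum>k<J. eigval k * (\<phi> k (Z i) * \<phi> k (Z j))))"
      by (rule psd_on_pullback[where p=Z]) (auto intro: psd_remainder assms)
    have "(\<Sum>i\<in>I. \<Sum>j\<in>I. z i * z j * (\<Sum>k<J. eigval k * (\<phi> k (Z i) * \<phi> k (Z j))))
      = (\<Sum>i\<in>I. \<Sum>j\<in>I. \<Sum>k<J. eigval k * ((z i * \<phi> k (Z i)) * (z j * \<phi> k (Z j))))"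
      by (simp add: sum_distrib_left mult_ac)
    also have "\<dots> = (\<Sum>k<J. \<Sum>i\<in>I. \<Sum>j\<in>I. eigval k * ((z i * \<phi> k (Z i)) * (z j * \<phi> k (Z j))))"
      by (rule sum_swap3)
    also have "\<dots> = (\<Sum>k<J. eigval k * (e k)\<^sup>2)"
      unfolding e_def power2_eq_square sum_product unfolding sum_distrib_left ..
    finally show "(\<Sum>k<J. eigval k * (e k)\<^sup>2) \<le> (\<Sum>i\<in>I. \<Sum>j\<in>I. z i * z j * se_kernel a (Z i) (Z j))"
      using psd_onD(2)[OF psd, of z] by (simp add: right_diff_distrib sum_subtractf)
    show "0 \<le> (\<Sum>k<J. (\<theta> k)\<^sup>2 / eigval k)" using eigval_pos by (intro sum_nonneg divide_nonneg_pos) auto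
  qed
  finally show ?thesis .
qed

text \<open>The bias and trace bounds applied to the leave-one-out system of the sample.  The two truncation levels
  are independent: \<open>J'\<close> splits the regression function and \<open>J\<close> splits the kernel.\<close>

lemma loo_risk_sum:
  fixes Z :: "nat \<Rightarrow> real"
  assumes f0: "\<And>x. f0 x = (\<Sum>k<J'. \<theta> k * \<phi> k x) + r x"
  shows "(\<Sum>i\<in>{1..Suc n}. loo_risk \<sigma> (se_kernel a) f0 n (swap_last n i Z)) \<le>
    4 * (\<Sum>k<J'. (\<theta> k)\<^sup>2 / eigval k) + 4 * (\<Sum>i\<in>{1..Suc n}. (r (Z i))\<^sup>2)
    + 4 * \<sigma>\<^sup>2 * J + 4 * \<sigma>\<^sup>2 * (\<Sum>i\<in>{1..Suc n}. diag_rem J (Z i))"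
proof -
  let ?N = "{1..Suc n}" and ?H = "\<Sum>k<J'. (\<theta> k)\<^sup>2 / eigval k"
  let ?h = "\<lambda>x. \<Sum>k<J'. \<theta> k * \<phi> k x"
  define v where "v i j = (if Transposition.transpose i (Suc n) j = Suc n then 1
      else - post_weight (se_kernel a) (swap_last n i Z) n (Z i) (Transposition.transpose i (Suc n) j))" for i j
  define s where "s i = post_cov (se_kernel a) (swap_last n i Z) n (Z i) (Z i)" for i
  interpret leave_one_out ?N "\<lambda>i j. se_kernel a (Z i) (Z j)" v s
    unfolding v_def s_def by (rule loo_regression) (rule psd_se_kernel)
  have le1: "s i \<le> 1" for i
    using post_cov_diag_le[OF psd_se_kernel, of "swap_last n i Z" n "Z i"] by (simp add: s_def se_kernel_def)
  have H: "0 \<le> ?H" using eigval_pos by (intro sum_nonneg divide_nonneg_pos) auto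
  have bias: "(\<Sum>i\<in>?N. (\<Sum>k\<in>?N. v i k * f0 (Z k))\<^sup>2) \<le> 4 * (?H + (\<Sum>i\<in>?N. (r (Z i))\<^sup>2))"
  proof (rule bias_bound[where h="\<lambda>i. ?h (Z i)"])
    show "(\<Sum>i\<in>?N. z i * ?h (Z i))\<^sup>2 \<le> ?H * (\<Sum>i\<in>?N. \<Sum>j\<in>?N. z i * z j * se_kernel a (Z i) (Z j))" for z
      by (rule rkhs_bound) (rule finite_atLeastAtMost)
  qed (use f0 H le1 in blast)+
  have tr: "(\<Sum>i\<in>?N. s i) \<le> 2 * (card {..<J} + (\<Sum>i\<in>?N. diag_rem J (Z i)))"
  proof -
    let ?R = "\<lambda>i j. se_kernel a (Z i) (Z j) - (\<Sum>k<J. eigval k * (\<phi> k (Z i) * \<phi> k (Z j)))"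
    have "(\<Sum>i\<in>?N. s i) \<le> 2 * (card {..<J} + (\<Sum>i\<in>?N. ?R i i))"
    proof (rule trace_bound[where R="?R" and \<Phi>="\<lambda>k i. sqrt (eigval k) * \<phi> k (Z i)"])
      show "psd_on ?N ?R"
        by (rule psd_on_pullback[where p=Z]) (auto intro: psd_remainder)
      fix i j
      show "se_kernel a (Z i) (Z j) = (\<Sum>k<J. (sqrt (eigval k) * \<phi> k (Z i)) * (sqrt (eigval k) * \<phi> k (Z j))) + ?R i j"
        unfolding sqrt_eigval_mult by simp
    qed (use le1 in auto)
    also have "(\<Sum>i\<in>?N. ?R i i) = (\<Sum>i\<in>?N. diag_rem J (Z i))"
      by (intro sum.cong refl) (simp add: diag_rem_def se_kernel_def power2_eq_square)
    finally show ?thesis .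
  qed
  have "(\<Sum>i\<in>?N. loo_risk \<sigma> (se_kernel a) f0 n (swap_last n i Z))
      = (\<Sum>i\<in>?N. (\<Sum>k\<in>?N. v i k * f0 (Z k))\<^sup>2 + 2 * \<sigma>\<^sup>2 * s i)"
    unfolding v_def s_def by (intro sum.cong refl loo_regression(2)) (auto intro: psd_se_kernel)
  also have "\<dots> = (\<Sum>i\<in>?N. (\<Sum>k\<in>?N. v i k * f0 (Z k))\<^sup>2) + 2 * \<sigma>\<^sup>2 * (\<Sum>i\<in>?N. s i)"
    by (simp only: sum.distrib sum_distrib_left)
  also have "\<dots> \<le> 4 * (?H + (\<Sum>i\<in>?N. (r (Z i))\<^sup>2)) + 2 * \<sigma>\<^sup>2 * (2 * (card {..<J} + (\<Sum>i\<in>?N. diag_rem J (Z i))))"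
    using tr by (intro add_mono bias mult_left_mono) auto
  finally show ?thesis by (simp add: algebra_simps)
qed

lemma expected_loo_risk:
  assumes f0: "\<And>x. f0 x = (\<Sum>k<J'. \<theta> k * \<phi> k x) + r x" and r [measurable]: "r \<in> borel_measurable borel"
    and \<delta>: "(\<integral>\<^sup>+x. ennreal ((r x)\<^sup>2) \<partial>design_law b) \<le> ennreal \<delta>" "0 \<le> \<delta>"
  shows "of_nat (Suc n) * (\<integral>\<^sup>+Z. ennreal (loo_risk \<sigma> (se_kernel a) f0 n Z) \<partial>(\<Pi>\<^sub>M i\<in>{1..Suc n}. design_law b))
    \<le> ennreal (4 * (\<Sum>k<J'. (\<theta> k)\<^sup>2 / eigval k) + 4 * \<sigma>\<^sup>2 * J + Suc n * (4 * \<delta> + 4 * \<sigma>\<^sup>2 * B ^ J))"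
proof -
  let ?N = "{1..Suc n}" and ?H = "\<Sum>k<J'. (\<theta> k)\<^sup>2 / eigval k"
  let ?P = "\<Pi>\<^sub>M i\<in>?N. design_law b"
  interpret R: prob_space "design_law b" using b by (rule prob_space_design_law)
  interpret P: prob_space ?P by (intro prob_space_PiM R.prob_space_axioms)
  have H: "0 \<le> ?H" using eigval_pos by (intro sum_nonneg divide_nonneg_pos) auto
  have n1: "0 \<le> 4 * ?H + 4 * \<sigma>\<^sup>2 * J" using H by simp
  have K: "(\<lambda>p. se_kernel a (fst p) (snd p)) \<in> borel_measurable (borel \<Otimes>\<^sub>M borel)"
    unfolding se_kernel_def by measurable
  have f0m: "f0 \<in> borel_measurable borel"
  proof -
    have "f0 = (\<lambda>x. (\<Sum>k<J'. \<theta> k * \<phi> k x) + r x)" by (rule ext) (rule f0)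
    then show ?thesis by simp
  qed
  have comp: "(\<lambda>Z. Z i) \<in> borel_measurable ?P" if "i \<in> ?N" for i
    using measurable_component_singleton[OF that, of "\<lambda>_. design_law b"] by simp
  have qm: "(\<lambda>Z. ennreal (loo_risk \<sigma> (se_kernel a) f0 n Z)) \<in> borel_measurable ?P"
    using loo_risk_measurable[OF K f0m comp] by simp
  have nonneg: "0 \<le> loo_risk \<sigma> (se_kernel a) f0 n Z" for Z
    unfolding loo_risk_def using post_cov_diag_nonneg[OF psd_se_kernel] by (intro add_nonneg_nonneg mult_nonneg_nonneg) auto
  have [measurable]: "diag_rem J \<in> borel_measurable borel" unfolding diag_rem_def by measurable
  have "of_nat (Suc n) * (\<integral>\<^sup>+Z. ennreal (loo_risk \<sigma> (se_kernel a) f0 n Z) \<partial>?P)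
      = (\<integral>\<^sup>+Z. (\<Sum>i\<in>?N. ennreal (loo_risk \<sigma> (se_kernel a) f0 n (swap_last n i Z))) \<partial>?P)"
    by (rule exchangeable_average[OF R.prob_space_axioms qm])
  also have "\<dots> \<le> (\<integral>\<^sup>+Z. ennreal (4 * ?H + 4 * \<sigma>\<^sup>2 * J) + (\<Sum>i\<in>?N. ennreal 4 * ennreal ((r (Z i))\<^sup>2) + ennreal (4 * \<sigma>\<^sup>2) * ennreal (diag_rem J (Z i))) \<partial>?P)"
  proof (rule nn_integral_mono)
    fix Z :: "nat \<Rightarrow> real"
    have "(\<Sum>i\<in>?N. ennreal (loo_risk \<sigma> (se_kernel a) f0 n (swap_last n i Z))) = ennreal (\<Sum>i\<in>?N. loo_risk \<sigma> (se_kernel a) f0 n (swap_last n i Z))"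
      by (rule sum_ennreal) (rule nonneg)
    also have "\<dots> \<le> ennreal ((4 * ?H + 4 * \<sigma>\<^sup>2 * J) + (\<Sum>i\<in>?N. 4 * (r (Z i))\<^sup>2 + 4 * \<sigma>\<^sup>2 * diag_rem J (Z i)))"
    proof (rule ennreal_leI)
      have "(\<Sum>i\<in>?N. 4 * (r (Z i))\<^sup>2 + 4 * \<sigma>\<^sup>2 * diag_rem J (Z i)) = 4 * (\<Sum>i\<in>?N. (r (Z i))\<^sup>2) + 4 * \<sigma>\<^sup>2 * (\<Sum>i\<in>?N. diag_rem J (Z i))"
        by (simp only: sum.distrib sum_distrib_left)
      then show "(\<Sum>i\<in>?N. loo_risk \<sigma> (se_kernel a) f0 n (swap_last n i Z))
          \<le> (4 * ?H + 4 * \<sigma>\<^sup>2 * J) + (\<Sum>i\<in>?N. 4 * (r (Z i))\<^sup>2 + 4 * \<sigma>\<^sup>2 * diag_rem J (Z i))"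
        using loo_risk_sum[OF f0, of \<sigma> n Z J] by linarith
    qed
    also have "\<dots> = ennreal (4 * ?H + 4 * \<sigma>\<^sup>2 * J) + ennreal (\<Sum>i\<in>?N. 4 * (r (Z i))\<^sup>2 + 4 * \<sigma>\<^sup>2 * diag_rem J (Z i))"
      using n1 rem_nonneg by (intro ennreal_plus sum_nonneg) auto
    also have "ennreal (\<Sum>i\<in>?N. 4 * (r (Z i))\<^sup>2 + 4 * \<sigma>\<^sup>2 * diag_rem J (Z i)) = (\<Sum>i\<in>?N. ennreal (4 * (r (Z i))\<^sup>2 + 4 * \<sigma>\<^sup>2 * diag_rem J (Z i)))"
      using rem_nonneg by (intro sum_ennreal[symmetric]) auto
    also have "\<dots> = (\<Sum>i\<in>?N. ennreal 4 * ennreal ((r (Z i))\<^sup>2) + ennreal (4 * \<sigma>\<^sup>2) * ennreal (diag_rem J (Z i)))"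
      using rem_nonneg by (intro sum.cong refl) (simp add: ennreal_mult)
    finally show "(\<Sum>i\<in>?N. ennreal (loo_risk \<sigma> (se_kernel a) f0 n (swap_last n i Z))) \<le>
      ennreal (4 * ?H + 4 * \<sigma>\<^sup>2 * J) + (\<Sum>i\<in>?N. ennreal 4 * ennreal ((r (Z i))\<^sup>2) + ennreal (4 * \<sigma>\<^sup>2) * ennreal (diag_rem J (Z i)))" .
  qed
  also have "\<dots> = ennreal (4 * ?H + 4 * \<sigma>\<^sup>2 * J) +
      (\<Sum>i\<in>?N. (\<integral>\<^sup>+Z. ennreal 4 * ennreal ((r (Z i))\<^sup>2) + ennreal (4 * \<sigma>\<^sup>2) * ennreal (diag_rem J (Z i)) \<partial>?P))"
  proof -
    have m: "(\<lambda>Z. ennreal 4 * ennreal ((r (Z i))\<^sup>2) + ennreal (4 * \<sigma>\<^sup>2) * ennreal (diag_rem J (Z i))) \<in> borel_measurable ?P" if "i \<in> ?N" for i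
      using comp[OF that] by measurable
    have c: "(\<integral>\<^sup>+Z. ennreal (4 * ?H + 4 * \<sigma>\<^sup>2 * J) \<partial>?P) = ennreal (4 * ?H + 4 * \<sigma>\<^sup>2 * J)"
      by (simp only: nn_integral_const P.emeasure_space_1 mult_1_right)
    show ?thesis
      by (subst nn_integral_add, simp, intro borel_measurable_sum m, assumption) (simp only: nn_integral_sum[OF m] c)
  qed
  also have "\<dots> = ennreal (4 * ?H + 4 * \<sigma>\<^sup>2 * J) +
      (\<Sum>i\<in>?N. (\<integral>\<^sup>+x. ennreal 4 * ennreal ((r x)\<^sup>2) + ennreal (4 * \<sigma>\<^sup>2) * ennreal (diag_rem J x) \<partial>design_law b))"
    by (intro arg_cong2[where f="(+)"] refl sum.cong nn_integral_component) (auto intro: R.prob_space_axioms)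
  also have "(\<integral>\<^sup>+x. ennreal 4 * ennreal ((r x)\<^sup>2) + ennreal (4 * \<sigma>\<^sup>2) * ennreal (diag_rem J x) \<partial>design_law b)
      = ennreal 4 * (\<integral>\<^sup>+x. ennreal ((r x)\<^sup>2) \<partial>design_law b) + ennreal (4 * \<sigma>\<^sup>2) * ennreal (B ^ J)"
    by (subst nn_integral_add) (auto simp: nn_integral_cmult nn_integral_rem)
  also have "ennreal (4 * ?H + 4 * \<sigma>\<^sup>2 * J) + (\<Sum>i\<in>?N. ennreal 4 * (\<integral>\<^sup>+x. ennreal ((r x)\<^sup>2) \<partial>design_law b) + ennreal (4 * \<sigma>\<^sup>2) * ennreal (B ^ J))
      \<le> ennreal (4 * ?H + 4 * \<sigma>\<^sup>2 * J) + (\<Sum>i\<in>?N. ennreal 4 * ennreal \<delta> + ennreal (4 * \<sigma>\<^sup>2) * ennreal (B ^ J))"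
    by (intro add_mono sum_mono mult_left_mono order_refl \<delta>) auto
  also have "\<dots> = ennreal (4 * ?H + 4 * \<sigma>\<^sup>2 * J) + (\<Sum>i\<in>?N. ennreal (4 * \<delta> + 4 * \<sigma>\<^sup>2 * B ^ J))"
    using \<delta>(2) B_bounds by (simp add: ennreal_mult)
  also have "\<dots> = ennreal (4 * ?H + 4 * \<sigma>\<^sup>2 * J) + ennreal (\<Sum>i\<in>?N. 4 * \<delta> + 4 * \<sigma>\<^sup>2 * B ^ J)"
    using \<delta>(2) B_bounds by (subst sum_ennreal) auto
  also have "\<dots> = ennreal (4 * ?H + 4 * \<sigma>\<^sup>2 * J + Suc n * (4 * \<delta> + 4 * \<sigma>\<^sup>2 * B ^ J))"
    using n1 \<delta>(2) B_bounds by (subst ennreal_plus[symmetric]) (auto intro!: sum_nonneg)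
  finally show ?thesis .
qed

end

section \<open>Truncation levels and the contraction rate\<close>

lemma norm2_rho_less:
  assumes "norm2_rho b g < ennreal t" "0 \<le> t"
  shows "(\<integral>\<^sup>+x. ennreal ((g x)\<^sup>2 * rho b x) \<partial>lborel) \<le> ennreal (t\<^sup>2)"
proof (cases "(\<integral>\<^sup>+x. ennreal ((g x)\<^sup>2 * rho b x) \<partial>lborel) = \<infinity>")
  case True
  then show ?thesis using assms by (simp add: norm2_rho_def)
next
  case False
  let ?I = "(\<integral>\<^sup>+x. ennreal ((g x)\<^sup>2 * rho b x) \<partial>lborel)"
  have "ennreal (sqrt (enn2real ?I)) < ennreal t"
    using assms(1) False by (simp add: norm2_rho_def)
  then have "sqrt (enn2real ?I) \<le> t" by (simp add: ennreal_less_iff less_imp_le)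
  then have "enn2real ?I \<le> t\<^sup>2" by (rule sqrt_le_D)
  then have "ennreal (enn2real ?I) \<le> ennreal (t\<^sup>2)" by (rule ennreal_leI)
  also have "ennreal (enn2real ?I) = ?I" using False by (intro ennreal_enn2real) (simp add: less_top)
  finally show ?thesis .
qed

context se_eigensystem
begin

lemma nn_integral_eig_sum_sq:
  assumes "finite A"
  shows "(\<integral>\<^sup>+x. ennreal ((\<Sum>k\<in>A. \<theta> k * \<phi> k x)\<^sup>2) \<partial>design_law b) = ennreal (\<Sum>k\<in>A. (\<theta> k)\<^sup>2)"
proof -
  have "has_bochner_integral lborel (\<lambda>x. \<Sum>k\<in>A. \<Sum>l\<in>A. \<theta> k * \<theta> l * (rho b x * (\<phi> k x * \<phi> l x)))
      (\<Sum>k\<in>A. \<Sum>l\<in>A. \<theta> k * \<theta> l * (if k = l then 1 else 0))"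
    by (intro has_bochner_integral_sum has_bochner_integral_mult_right eigfun_orthonormal)
  also have "(\<lambda>x. \<Sum>k\<in>A. \<Sum>l\<in>A. \<theta> k * \<theta> l * (rho b x * (\<phi> k x * \<phi> l x)))
      = (\<lambda>x. (\<Sum>k\<in>A. \<theta> k * \<phi> k x)\<^sup>2 * rho b x)"
    unfolding power2_eq_square sum_product unfolding sum_distrib_right by (simp add: mult_ac)
  also have "(\<Sum>k\<in>A. \<Sum>l\<in>A. \<theta> k * \<theta> l * (if k = l then 1 else 0)) = (\<Sum>k\<in>A. (\<theta> k)\<^sup>2)"
    using assms by (intro sum.cong refl) (simp add: if_distrib[of "\<lambda>t. _ * t"] power2_eq_square cong: if_cong)
  finally have *: "has_bochner_integral lborel (\<lambda>x. (\<Sum>k\<in>A. \<theta> k * \<phi> k x)\<^sup>2 * rho b x) (\<Sum>k\<in>A. (\<theta> k)\<^sup>2)" .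
  have "(\<integral>\<^sup>+x. ennreal ((\<Sum>k\<in>A. \<theta> k * \<phi> k x)\<^sup>2) \<partial>design_law b)
      = (\<integral>\<^sup>+x. ennreal ((\<Sum>k\<in>A. \<theta> k * \<phi> k x)\<^sup>2 * rho b x) \<partial>lborel)"
    by (rule nn_integral_design_law[OF b]) measurable
  also have "\<dots> = ennreal (\<Sum>k\<in>A. (\<theta> k)\<^sup>2)"
    using * by (subst nn_integral_eq_integral) (auto simp: has_bochner_integral_iff rho_nonneg[OF b])
  finally show ?thesis .
qed

text \<open>The partial sums approximate \<open>g\<close> only in norm, so the tail is compared with a late partial sum; the
  resulting error \<open>\<epsilon>\<close> is arbitrary.\<close>

lemma eig_series_tail:
  assumes ser: "is_eig_series b a \<theta> g"
    and T: "\<And>N. (\<Sum>k\<in>{J..<N}. (\<theta> (Suc k))\<^sup>2) \<le> T" and \<epsilon>: "\<epsilon> > 0"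
  shows "(\<integral>\<^sup>+x. ennreal ((g x - (\<Sum>k<J. \<theta> (Suc k) * \<phi> k x))\<^sup>2) \<partial>design_law b) \<le> ennreal (2 * T + 2 * \<epsilon>)"
proof -
  have [measurable]: "g \<in> borel_measurable borel" using ser by (simp add: is_eig_series_def)
  have lim: "(\<lambda>N. norm2_rho b (\<lambda>x. g x - (\<Sum>j=1..N. \<theta> j * eigfun b a j x))) \<longlonglongrightarrow> 0"
    using ser by (simp add: is_eig_series_def)
  have "\<forall>\<^sub>F N in sequentially. N \<ge> J \<and> norm2_rho b (\<lambda>x. g x - (\<Sum>j=1..N. \<theta> j * eigfun b a j x)) < ennreal (sqrt \<epsilon>)"
    using \<epsilon> by (intro eventually_conj eventually_ge_at_top order_tendstoD(2)[OF lim]) simp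
  then obtain N where N: "N \<ge> J" "norm2_rho b (\<lambda>x. g x - (\<Sum>j=1..N. \<theta> j * eigfun b a j x)) < ennreal (sqrt \<epsilon>)"
    using eventually_happens'[OF sequentially_bot] by blast
  let ?S = "\<lambda>N x. \<Sum>k<N. \<theta> (Suc k) * \<phi> k x"
  have shift: "(\<Sum>j=1..N. \<theta> j * eigfun b a j x) = ?S N x" for x
    by (rule sum.reindex_bij_witness[of _ Suc "\<lambda>j. j - 1"]) auto
  let ?d = "\<lambda>x. \<Sum>k\<in>{J..<N}. \<theta> (Suc k) * \<phi> k x"
  have "(\<integral>\<^sup>+x. ennreal ((g x - ?S N x)\<^sup>2) \<partial>design_law b) = (\<integral>\<^sup>+x. ennreal ((g x - ?S N x)\<^sup>2 * rho b x) \<partial>lborel)"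
    by (rule nn_integral_design_law[OF b]) measurable
  also have "\<dots> \<le> ennreal \<epsilon>"
    using norm2_rho_less[OF N(2)] \<epsilon> unfolding shift by simp
  finally have 1: "(\<integral>\<^sup>+x. ennreal ((g x - ?S N x)\<^sup>2) \<partial>design_law b) \<le> ennreal \<epsilon>" .
  have 2: "(\<integral>\<^sup>+x. ennreal ((?d x)\<^sup>2) \<partial>design_law b) \<le> ennreal T"
    unfolding nn_integral_eig_sum_sq[OF finite_atLeastLessThan, of "\<lambda>k. \<theta> (Suc k)"] by (intro ennreal_leI T)
  have T0: "0 \<le> T" using T[of J] by simp
  have "(\<integral>\<^sup>+x. ennreal ((g x - ?S J x)\<^sup>2) \<partial>design_law b)
     \<le> (\<integral>\<^sup>+x. ennreal 2 * ennreal ((?d x)\<^sup>2) + ennreal 2 * ennreal ((g x - ?S N x)\<^sup>2) \<partial>design_law b)"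
  proof (rule nn_integral_mono)
    fix x
    have "{..<N} = {..<J} \<union> {J..<N}" using N(1) by auto
    moreover have "{..<J} \<inter> {J..<N} = {}" by auto
    ultimately have "?S N x = ?S J x + ?d x"
      by (simp only: sum.union_disjoint[OF finite_lessThan finite_atLeastLessThan])
    then have eq: "g x - ?S J x = (g x - ?S N x) + ?d x" by simp
    have "(g x - ?S J x)\<^sup>2 \<le> 2 * (?d x)\<^sup>2 + 2 * (g x - ?S N x)\<^sup>2"
      unfolding eq using sum_squares_bound[of "g x - ?S N x" "?d x"] by (simp add: power2_sum)
    then have "ennreal ((g x - ?S J x)\<^sup>2) \<le> ennreal (2 * (?d x)\<^sup>2 + 2 * (g x - ?S N x)\<^sup>2)" by (rule ennreal_leI)
    then show "ennreal ((g x - ?S J x)\<^sup>2) \<le> ennreal 2 * ennreal ((?d x)\<^sup>2) + ennreal 2 * ennreal ((g x - ?S N x)\<^sup>2)"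
      by (simp only: ennreal_mult[symmetric] ennreal_plus[symmetric] zero_le_power2 zero_le_numeral mult_nonneg_nonneg)
  qed
  also have "\<dots> = ennreal 2 * (\<integral>\<^sup>+x. ennreal ((?d x)\<^sup>2) \<partial>design_law b) + ennreal 2 * (\<integral>\<^sup>+x. ennreal ((g x - ?S N x)\<^sup>2) \<partial>design_law b)"
    by (subst nn_integral_add) (auto simp: nn_integral_cmult)
  also have "\<dots> \<le> ennreal 2 * ennreal T + ennreal 2 * ennreal \<epsilon>"
    by (intro add_mono mult_left_mono 1 2) auto
  also have "\<dots> = ennreal (2 * T + 2 * \<epsilon>)" using T0 \<epsilon> by (simp add: ennreal_mult)
  finally show ?thesis .
qed

lemma contraction_bound:
  fixes t :: real
  assumes GP: "GP_law (\<lambda>x. 0) (\<lambda>x x'. \<sigma>\<^sup>2 * se_kernel a x x') P"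
    and ser: "is_eig_series b a \<theta> f0" and \<sigma>: "\<sigma> > 0" and t: "t > 0"
    and T: "\<And>N. (\<Sum>k\<in>{J'..<N}. (\<theta> (Suc k))\<^sup>2) \<le> T" and \<epsilon>: "\<epsilon> > 0"
  shows "expected_tail b \<sigma> P n f0 t
    \<le> ennreal ((4 * (\<Sum>k<J'. (\<theta> (Suc k))\<^sup>2 / eigval k) + 4 * \<sigma>\<^sup>2 * J + Suc n * (8 * T + 8 * \<epsilon> + 4 * \<sigma>\<^sup>2 * B ^ J)) / (Suc n * t\<^sup>2))"
    (is "?L \<le> ennreal (?E / _)")
proof -
  have f0m [measurable]: "f0 \<in> borel_measurable borel" using ser by (simp add: is_eig_series_def)
  have K: "(\<lambda>p. se_kernel a (fst p) (snd p)) \<in> borel_measurable (borel \<Otimes>\<^sub>M borel)"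
    unfolding se_kernel_def by measurable
  let ?I = "\<integral>\<^sup>+ Z. ennreal (loo_risk \<sigma> (se_kernel a) f0 n Z) \<partial>(\<Pi>\<^sub>M i\<in>{1..Suc n}. design_law b)"
  have T0: "0 \<le> T" using T[of J'] by simp
  have E0: "0 \<le> ?E" 
    using T0 \<epsilon> B_bounds eigval_pos by (intro add_nonneg_nonneg mult_nonneg_nonneg sum_nonneg) (auto simp: less_imp_le)
  have "of_nat (Suc n) * ?I \<le> ennreal (4 * (\<Sum>k<J'. (\<theta> (Suc k))\<^sup>2 / eigval k) + 4 * \<sigma>\<^sup>2 * J + Suc n * (4 * (2 * T + 2 * \<epsilon>) + 4 * \<sigma>\<^sup>2 * B ^ J))"
    by (rule expected_loo_risk[where r="\<lambda>x. f0 x - (\<Sum>k<J'. \<theta> (Suc k) * \<phi> k x)"])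
      (use T0 \<epsilon> eig_series_tail[OF ser T \<epsilon>] in auto)
  then have *: "of_nat (Suc n) * ?I \<le> ennreal ?E" by (simp add: algebra_simps)
  have "?I = ennreal (1 / Suc n) * (of_nat (Suc n) * ?I)"
  proof -
    have "ennreal (1 / Suc n) * of_nat (Suc n) = ennreal (1 / Suc n * Suc n)"
      by (subst ennreal_mult) (auto simp: ennreal_of_nat_eq_real_of_nat)
    then show ?thesis by (simp add: mult.assoc[symmetric] del: of_nat_Suc)
  qed
  also have "\<dots> \<le> ennreal (1 / Suc n) * ennreal ?E" by (intro mult_left_mono *) simp
  finally have I: "?I \<le> ennreal (1 / Suc n) * ennreal ?E" .
  have "?L \<le> ennreal (1 / t\<^sup>2) * ?I"
    by (rule expected_posterior_tail[where K="se_kernel a"]) (rule GP K f0m \<sigma> b t | erule psd_se_kernel)+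
  also have "\<dots> \<le> ennreal (1 / t\<^sup>2) * (ennreal (1 / Suc n) * ennreal ?E)" by (intro mult_left_mono I) simp
  also have "\<dots> = ennreal (1 / t\<^sup>2 * (1 / Suc n * ?E))"
    using E0 by (simp only: ennreal_mult[symmetric] zero_le_divide_1_iff zero_le_power2 of_nat_0_le_iff mult_nonneg_nonneg)
  also have "1 / t\<^sup>2 * (1 / Suc n * ?E) = ?E / (Suc n * t\<^sup>2)" by simp
  finally show ?thesis .
qed

text \<open>A constant with \<open>c + b \<le> width * a\<close> for \<open>a \<ge> 1\<close>; it converts powers of \<open>B\<close> into exponentials of \<open>J / a\<close>.\<close>

definition width :: real where "width = 2 * b + sqrt (2 * b)"

lemma width_pos: "width > 0" using b by (simp add: width_def add_pos_pos)

lemma c_le: assumes "1 \<le> a" shows "c + b \<le> width * a"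
proof -
  have "c \<le> sqrt (b\<^sup>2) + sqrt (2 * b * a\<^sup>2)" unfolding c_def using b by (intro sqrt_add_le_add_sqrt) auto
  also have "\<dots> = b + sqrt (2 * b) * a" using a b by (simp add: real_sqrt_mult)
  finally have "c + b \<le> 2 * b * 1 + sqrt (2 * b) * a" by simp
  also have "\<dots> \<le> 2 * b * a + sqrt (2 * b) * a" using assms b by (intro add_right_mono mult_left_mono) auto
  finally show ?thesis by (simp add: width_def algebra_simps)
qed

lemma one_minus_B_ge: assumes "1 \<le> a" shows "2 * b / width / a \<le> 1 - B"
proof -
  have "2 * b / (width * a) \<le> 2 * b / (c + b)"
    using c_le[OF assms] b c_pos by (intro divide_left_mono) (auto intro!: mult_pos_pos add_pos_pos width_pos a)
  then show ?thesis by (simp add: one_minus_B)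
qed

lemma B_power_le: assumes "1 \<le> a" shows "B ^ J \<le> exp (- (2 * b / width * J / a))"
proof -
  have "B \<le> exp (- (1 - B))" using exp_ge_add_one_self[of "- (1 - B)"] by simp
  also have "\<dots> \<le> exp (- (2 * b / width / a))" using one_minus_B_ge[OF assms] by simp
  finally have "B ^ J \<le> exp (- (2 * b / width / a)) ^ J" using B_bounds by (intro power_mono) auto
  then show ?thesis by (simp add: exp_of_nat_mult[symmetric] mult_ac)
qed

lemma inverse_eigval_le:
  assumes "1 \<le> a" "k \<le> J"
  shows "1 / eigval k \<le> a * width / (2 * b) * exp (width * J / a)"
proof -
  have cb: "c - b > 0" using c_gt by simp
  have "(c - b) * (width * a) \<ge> (c - b) * (c + b)" using c_le[OF assms(1)] cb by (intro mult_left_mono) auto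
  then have "(c - b) * width * a \<ge> 2 * b * a * a" unfolding c_diff by (simp add: power2_eq_square mult_ac)
  then have "(c - b) * width \<ge> 2 * b * a" using a by (simp add: mult_le_cancel_right)
  then have w: "2 * b / (c - b) \<le> width / a" using a cb by (simp add: field_simps)
  have "1 / B = 1 + 2 * b / (c - b)" using cb b by (simp add: B_def field_simps)
  also have "\<dots> \<le> exp (2 * b / (c - b))" by (rule exp_ge_add_one_self)
  also have "\<dots> \<le> exp (width / a)" using w by simp
  finally have "(1 / B) ^ J \<le> exp (width / a) ^ J" using B_bounds by (intro power_mono) auto
  then have 1: "(1 / B) ^ J \<le> exp (width * J / a)" by (simp add: exp_of_nat_mult[symmetric] mult_ac)
  have "(1 / B) ^ k \<le> (1 / B) ^ J" using B_bounds assms(2) by (intro power_increasing) auto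
  with 1 have 2: "(1 / B) ^ k \<le> exp (width * J / a)" by simp
  have "1 / (1 - B) \<le> 1 / (2 * b / width / a)"
    using one_minus_B_ge[OF assms(1)] B_bounds b a width_pos by (intro divide_left_mono) auto
  then have 3: "1 / (1 - B) \<le> a * width / (2 * b)" by (simp add: mult.commute)
  have "1 / eigval k = 1 / (1 - B) * (1 / B) ^ k" by (simp add: eigval_def power_divide)
  also have "\<dots> \<le> a * width / (2 * b) * exp (width * J / a)"
    using 2 3 B_bounds a b width_pos by (intro mult_mono) auto
  finally show ?thesis .
qed

end

text \<open>One constant serves for the norm of the coefficient sequence and for its tails, whose decay is the
  smoothness condition.\<close>

lemma sobolev_bounds:
  assumes "\<theta> \<in> sobolev \<alpha>" "\<alpha> > 0"
  obtains S where "S \<ge> 0" "\<And>J. (\<Sum>k<J. (\<theta> (Suc k))\<^sup>2) \<le> S"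
    "\<And>J N x. 0 < x \<Longrightarrow> x \<le> real (Suc J) \<Longrightarrow> (\<Sum>k\<in>{J..<N}. (\<theta> (Suc k))\<^sup>2) \<le> S * x powr (- 2 * \<alpha>)"
proof -
  define S1 where "S1 = infsum (\<lambda>j. (\<theta> j)\<^sup>2) {1..}"
  define S2 where "S2 = infsum (\<lambda>j. real j powr (2 * \<alpha>) * (\<theta> j)\<^sup>2) {1..}"
  have sum1: "(\<lambda>j. (\<theta> j)\<^sup>2) summable_on {1..}" and sum2: "(\<lambda>j. real j powr (2 * \<alpha>) * (\<theta> j)\<^sup>2) summable_on {1..}"
    using assms(1) by (auto simp: sobolev_def)
  have S: "0 \<le> S1" "0 \<le> S2" unfolding S1_def S2_def by (auto intro!: infsum_nonneg)
  show thesis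
  proof (rule that[of "S1 + S2"])
    show "0 \<le> S1 + S2" using S by simp
    fix J
    have "(\<Sum>k<J. (\<theta> (Suc k))\<^sup>2) = (\<Sum>j\<in>Suc ` {..<J}. (\<theta> j)\<^sup>2)" by (simp add: sum.reindex)
    also have "\<dots> \<le> S1" unfolding S1_def by (intro finite_sum_le_infsum sum1) auto
    finally show "(\<Sum>k<J. (\<theta> (Suc k))\<^sup>2) \<le> S1 + S2" using S by simp
    fix N and x :: real assume x: "0 < x" "x \<le> real (Suc J)"
    have "(\<Sum>k\<in>{J..<N}. (\<theta> (Suc k))\<^sup>2) \<le> (\<Sum>k\<in>{J..<N}. x powr (- 2 * \<alpha>) * (real (Suc k) powr (2 * \<alpha>) * (\<theta> (Suc k))\<^sup>2))"
    proof (rule sum_mono)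
      fix k assume "k \<in> {J..<N}"
      then have "x \<le> real (Suc k)" using x(2) by simp
      then have "x powr (2 * \<alpha>) \<le> real (Suc k) powr (2 * \<alpha>)" using x(1) assms(2) by (intro powr_mono2) auto
      then have "x powr (- 2 * \<alpha>) * x powr (2 * \<alpha>) \<le> x powr (- 2 * \<alpha>) * real (Suc k) powr (2 * \<alpha>)"
        by (intro mult_left_mono) auto
      moreover have "x powr (- 2 * \<alpha>) * x powr (2 * \<alpha>) = 1" using x(1) by (simp add: powr_add[symmetric])
      ultimately have "1 * (\<theta> (Suc k))\<^sup>2 \<le> (x powr (- 2 * \<alpha>) * real (Suc k) powr (2 * \<alpha>)) * (\<theta> (Suc k))\<^sup>2"
        by (intro mult_right_mono) auto
      then show "(\<theta> (Suc k))\<^sup>2 \<le> x powr (- 2 * \<alpha>) * (real (Suc k) powr (2 * \<alpha>) * (\<theta> (Suc k))\<^sup>2)"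
        by (simp add: mult.assoc)
    qed
    also have "\<dots> = x powr (- 2 * \<alpha>) * (\<Sum>j\<in>Suc ` {J..<N}. real j powr (2 * \<alpha>) * (\<theta> j)\<^sup>2)"
      by (subst sum.reindex) (auto simp: sum_distrib_left)
    also have "\<dots> \<le> x powr (- 2 * \<alpha>) * S2"
      unfolding S2_def by (intro mult_left_mono finite_sum_le_infsum sum2) auto
    also have "\<dots> \<le> (S1 + S2) * x powr (- 2 * \<alpha>)" using S by (simp add: mult.commute mult_right_mono)
    finally show "(\<Sum>k\<in>{J..<N}. (\<theta> (Suc k))\<^sup>2) \<le> (S1 + S2) * x powr (- 2 * \<alpha>)" .
  qed
qed


text \<open>The truncation levels are \<open>J' = \<lceil>a\<rceil>\<close> for the regression function, so that \<open>B\<close> to the power \<open>- J'\<close> stays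
  bounded, and \<open>J = \<lceil>q a log n\<rceil>\<close> for the kernel, which is large enough for \<open>B\<^sup>J \<le> 1/n\<close>.  All
  contributions are then \<open>O(a log n)\<close>, against \<open>n \<epsilon>\<^sub>n\<^sup>2 = a (log n)\<^sup>2\<close>.\<close>

lemma (in se_eigensystem) contraction_bound_explicit:
  fixes n :: nat and M \<alpha> S \<sigma> :: real
  assumes a1: "1 \<le> a" and n: "n \<ge> 3" and M: "M > 0" and \<sigma>: "\<sigma> > 0"
    and an: "a powr (- 2 * \<alpha>) = a / n" and rate: "(rate \<alpha> n)\<^sup>2 = a / n * (ln n)\<^sup>2" "rate \<alpha> n > 0"
    and S: "S \<ge> 0" "\<And>J. (\<Sum>k<J. (\<theta> (Suc k))\<^sup>2) \<le> S"
      "\<And>J N x. 0 < x \<Longrightarrow> x \<le> real (Suc J) \<Longrightarrow> (\<Sum>k\<in>{J..<N}. (\<theta> (Suc k))\<^sup>2) \<le> S * x powr (- 2 * \<alpha>)"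
    and GP: "GP_law (\<lambda>x. 0) (\<lambda>x x'. \<sigma>\<^sup>2 * se_kernel a x x') P"
    and ser: "is_eig_series b a \<theta> f0"
  defines "q \<equiv> width / (2 * b)"
  shows "expected_tail b \<sigma> P n f0 (M * rate \<alpha> n)
    \<le> ennreal ((4 * (S * q * exp (2 * width)) + 4 * \<sigma>\<^sup>2 * (q + 1) + 16 * (S + 1) + 8 * \<sigma>\<^sup>2) / (M\<^sup>2 * ln n))"
proof -
  define l where "l = ln (real n)"
  have l: "l \<ge> 1"
  proof -
    have "exp 1 \<le> real n" using n exp_le by linarith
    then show ?thesis unfolding l_def using n by (subst ln_ge_iff) auto
  qed
  have q: "q > 0" using width_pos b by (simp add: q_def)
  have n0: "real n > 0" using n by simp
  have al: "a \<le> a * l" "1 \<le> a * l"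
    using mult_left_mono[OF l, of a] a1 by (auto intro: order_trans[OF a1])
  define J' where "J' = nat \<lceil>a\<rceil>"
  define J where "J = nat \<lceil>a * l * q\<rceil>"
  have J': "a \<le> real J'" "real J' \<le> a + 1" using a by (auto simp: J'_def)
  have "0 \<le> a * l * q" using a l q by simp
  then have J: "a * l * q \<le> real J" "real J \<le> a * l * q + 1" by (auto simp: J_def)
  let ?T = "S * (a / n)" and ?e = "a / n"
  let ?H = "\<Sum>k<J'. (\<theta> (Suc k))\<^sup>2 / eigval k"
  have T: "(\<Sum>k\<in>{J'..<N}. (\<theta> (Suc k))\<^sup>2) \<le> ?T" for N
    using S(3)[of a J' N] a J'(1) an by simp
  have H: "?H \<le> a * (S * q * exp (2 * width))"
  proof -
    have "width * J' / a \<le> 2 * width"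
    proof -
      have "width * J' \<le> width * (2 * a)" using J'(2) a1 width_pos by (intro mult_left_mono) auto
      then show ?thesis using a by (simp add: divide_le_eq)
    qed
    then have ex: "exp (width * J' / a) \<le> exp (2 * width)" by simp
    have "?H \<le> (\<Sum>k<J'. (\<theta> (Suc k))\<^sup>2 * (a * q * exp (2 * width)))"
    proof (rule sum_mono)
      fix k assume "k \<in> {..<J'}"
      then have "1 / eigval k \<le> a * width / (2 * b) * exp (width * J' / a)"
        using inverse_eigval_le[OF a1, of k J'] by simp
      also have "\<dots> \<le> a * q * exp (2 * width)"
        unfolding q_def using ex a b width_pos by (simp add: mult_left_mono divide_right_mono)
      finally have "(\<theta> (Suc k))\<^sup>2 * (1 / eigval k) \<le> (\<theta> (Suc k))\<^sup>2 * (a * q * exp (2 * width))"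
        by (rule mult_left_mono) simp
      then show "(\<theta> (Suc k))\<^sup>2 / eigval k \<le> (\<theta> (Suc k))\<^sup>2 * (a * q * exp (2 * width))" by simp
    qed
    also have "\<dots> = (\<Sum>k<J'. (\<theta> (Suc k))\<^sup>2) * (a * q * exp (2 * width))" by (rule sum_distrib_right[symmetric])
    also have "\<dots> \<le> S * (a * q * exp (2 * width))" using S(2) a q by (intro mult_right_mono) auto
    finally show ?thesis by (simp add: mult_ac)
  qed
  have BJ: "B ^ J \<le> 1 / n"
  proof -
    have "l \<le> 2 * b / width * J / a"
    proof -
      have "l * a = a * l * q * (2 * b / width)" using b width_pos by (simp add: q_def)
      also have "\<dots> \<le> real J * (2 * b / width)"
        using J(1) b width_pos by (intro mult_right_mono) auto
      also have "\<dots> = 2 * b / width * J" by (rule mult.commute)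
      finally show ?thesis unfolding pos_le_divide_eq[OF a] .
    qed
    then have "B ^ J \<le> exp (- l)" using B_power_le[OF a1, of J] by (smt (verit) exp_le_cancel_iff)
    also have "\<dots> = 1 / n" using n0 by (simp add: l_def exp_minus inverse_eq_divide)
    finally show ?thesis .
  qed
  define A where "A = 4 * (S * q * exp (2 * width)) + 4 * \<sigma>\<^sup>2 * (q + 1) + 16 * (S + 1) + 8 * \<sigma>\<^sup>2"
  let ?E = "4 * ?H + 4 * \<sigma>\<^sup>2 * J + Suc n * (8 * ?T + 8 * ?e + 4 * \<sigma>\<^sup>2 * B ^ J)"
  have E: "?E \<le> a * l * A"
  proof -
    have e1: "4 * ?H \<le> a * l * (4 * (S * q * exp (2 * width)))"
    proof -
      have "a * (S * q * exp (2 * width)) \<le> a * l * (S * q * exp (2 * width))"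
        using al(1) S(1) q by (intro mult_right_mono) auto
      with H show ?thesis by simp
    qed
    have e2: "4 * \<sigma>\<^sup>2 * J \<le> a * l * (4 * \<sigma>\<^sup>2 * (q + 1))"
    proof -
      have "real J \<le> a * l * (q + 1)" using J(2) al(2) by (simp add: algebra_simps)
      then have "4 * \<sigma>\<^sup>2 * J \<le> 4 * \<sigma>\<^sup>2 * (a * l * (q + 1))" by (intro mult_left_mono) auto
      then show ?thesis by (simp add: mult_ac)
    qed
    have e3: "Suc n * (8 * ?T + 8 * ?e + 4 * \<sigma>\<^sup>2 * B ^ J) \<le> a * l * (16 * (S + 1) + 8 * \<sigma>\<^sup>2)"
    proof -
      have "4 * \<sigma>\<^sup>2 * B ^ J \<le> 4 * \<sigma>\<^sup>2 * (1 / n)" by (intro mult_left_mono BJ) auto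
      then have "8 * ?T + 8 * ?e + 4 * \<sigma>\<^sup>2 * B ^ J \<le> (8 * (S + 1) * a + 4 * \<sigma>\<^sup>2) / n"
        by (simp add: add_divide_distrib algebra_simps)
      then have "Suc n * (8 * ?T + 8 * ?e + 4 * \<sigma>\<^sup>2 * B ^ J) \<le> (2 * real n) * ((8 * (S + 1) * a + 4 * \<sigma>\<^sup>2) / n)"
        using n a S(1) B_bounds by (intro mult_mono) auto
      also have "\<dots> = 16 * (S + 1) * a + 8 * \<sigma>\<^sup>2 * 1"
      proof -
        have X: "(2 * real n) * (X / n) = 2 * X" for X using n0 by simp
        show ?thesis unfolding X by (simp add: algebra_simps)
      qed
      also have "\<dots> \<le> 16 * (S + 1) * (a * l) + 8 * \<sigma>\<^sup>2 * (a * l)"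
        using al S(1) by (intro add_mono mult_left_mono) auto
      finally show ?thesis by (simp add: algebra_simps)
    qed
    show ?thesis using e1 e2 e3 unfolding A_def by (simp add: distrib_left)
  qed
  have t: "M * rate \<alpha> n > 0" using M rate(2) by simp
  have e0: "?e > 0" using a n0 by simp
  have t2: "real n * (M * rate \<alpha> n)\<^sup>2 = a * l * (M\<^sup>2 * l)"
    unfolding power_mult_distrib rate(1) l_def[symmetric] using n0 by (simp add: power2_eq_square)
  have A0: "A \<ge> 0" using S(1) q by (simp add: A_def)
  have "?E / (Suc n * (M * rate \<alpha> n)\<^sup>2) \<le> a * l * A / (real n * (M * rate \<alpha> n)\<^sup>2)"
    using E t a l A0 n0 by (intro frac_le) (auto intro!: mult_right_mono mult_pos_pos)
  also have "\<dots> = A / (M\<^sup>2 * l)" unfolding t2 using a l by simp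
  finally have "?E / (Suc n * (M * rate \<alpha> n)\<^sup>2) \<le> A / (M\<^sup>2 * l)" .
  with contraction_bound[OF GP ser \<sigma> t T e0, of n J] show ?thesis
    unfolding A_def[symmetric] l_def[symmetric] by (meson ennreal_leI order_trans)
qed

theorem theorem4p2:
  fixes \<alpha> b \<sigma> :: real
    and \<theta>0 :: "nat \<Rightarrow> real"
    and f0 :: "nat \<Rightarrow> real \<Rightarrow> real"
    and prior :: "nat \<Rightarrow> (real \<Rightarrow> real) measure"
  assumes "\<sigma> > 0" and "b > 0" and "b \<noteq> 1 / 2"
    and "\<alpha> > 0" and "\<alpha> > 1 / (4 * (1 - 2 * b))"
    and prior: "\<And>n. n \<ge> 1 \<Longrightarrow>
      GP_law (\<lambda>x. 0) (\<lambda>x x'. \<sigma>\<^sup>2 * se_kernel (bandwidth \<alpha> n) x x') (prior n)"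
    and "\<theta>0 \<in> sobolev \<alpha>"
    and f0: "\<And>n. n \<ge> 1 \<Longrightarrow> is_eig_series b (bandwidth \<alpha> n) \<theta>0 (f0 n)"
  shows "\<exists>M0>0. \<forall>M\<ge>M0.
    (\<lambda>n. \<integral>\<^sup>+ (X, Y). emeasure (posterior \<sigma> (prior n) n X Y)
            {f \<in> space (prior n). norm2_rho b (\<lambda>x. f x - f0 n x) > ennreal (M * rate \<alpha> n)}
          \<partial>data_law b \<sigma> n (f0 n)) \<longlonglongrightarrow> 0"
proof (intro exI[of _ 1] conjI allI impI)
  fix M :: real assume "1 \<le> M"
  then have M: "M > 0" by simp
  obtain S where S: "S \<ge> 0" "\<And>J. (\<Sum>k<J. (\<theta>0 (Suc k))\<^sup>2) \<le> S"
    "\<And>J N x. 0 < x \<Longrightarrow> x \<le> real (Suc J) \<Longrightarrow> (\<Sum>k\<in>{J..<N}. (\<theta>0 (Suc k))\<^sup>2) \<le> S * x powr (- 2 * \<alpha>)"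
    using sobolev_bounds[OF \<open>\<theta>0 \<in> sobolev \<alpha>\<close> \<open>\<alpha> > 0\<close>] by metis
  define w where "w = 2 * b + sqrt (2 * b)"
  define A where "A = 4 * (S * (w / (2 * b)) * exp (2 * w)) + 4 * \<sigma>\<^sup>2 * (w / (2 * b) + 1) + 16 * (S + 1) + 8 * \<sigma>\<^sup>2"
  let ?L = "\<lambda>n. expected_tail b \<sigma> (prior n) n (f0 n) (M * rate \<alpha> n)"
  have bound: "?L n \<le> ennreal (A / (M\<^sup>2 * ln n))" if n: "n \<ge> 3" for n
  proof -
    have n1: "real n > 1" using n by simp
    have \<alpha>1: "2 * \<alpha> + 1 > 0" using \<open>\<alpha> > 0\<close> by simp
    have a1: "1 \<le> bandwidth \<alpha> n" unfolding bandwidth_def using n1 \<alpha>1 by (intro ge_one_powr_ge_zero) auto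
    interpret se_eigensystem "bandwidth \<alpha> n" b "sqrt (b\<^sup>2 + 2 * b * (bandwidth \<alpha> n)\<^sup>2)"
      by unfold_locales (use a1 \<open>b > 0\<close> in auto)
    have ex: "1 / (2 * \<alpha> + 1) * (- 2 * \<alpha>) = 1 / (2 * \<alpha> + 1) - 1" "- \<alpha> / (2 * \<alpha> + 1) * 2 = 1 / (2 * \<alpha> + 1) - 1"
      using \<alpha>1 by (auto simp: field_simps)
    have an: "bandwidth \<alpha> n powr (- 2 * \<alpha>) = bandwidth \<alpha> n / n"
      unfolding bandwidth_def powr_powr ex using n1 by (simp add: powr_diff)
    have rate: "(rate \<alpha> n)\<^sup>2 = bandwidth \<alpha> n / n * (ln n)\<^sup>2"
    proof -
      have "(real n powr (- \<alpha> / (2 * \<alpha> + 1)))\<^sup>2 = real n powr (- \<alpha> / (2 * \<alpha> + 1) * 2)"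
        by (simp only: power2_eq_square powr_add[symmetric] mult_2_right)
      also have "\<dots> = bandwidth \<alpha> n / n" unfolding ex bandwidth_def using n1 by (simp add: powr_diff)
      finally show ?thesis by (simp add: rate_def power_mult_distrib)
    qed
    have rate0: "rate \<alpha> n > 0" using n1 by (simp add: rate_def)
    have "width = w" by (simp add: width_def w_def)
    then show ?thesis
      using contraction_bound_explicit[OF a1 n M \<open>\<sigma> > 0\<close> an rate rate0 S prior f0] n
      unfolding A_def by simp
  qed
  show "?L \<longlonglongrightarrow> 0"
  proof (rule tendsto_sandwich[OF _ _ tendsto_const])
    show "\<forall>\<^sub>F n in sequentially. ?L n \<le> ennreal (A / (M\<^sup>2 * ln n))"
      using eventually_ge_at_top[of 3] by eventually_elim (rule bound)
    have "(\<lambda>n. A / (M\<^sup>2 * ln (real n))) \<longlonglongrightarrow> 0" using M by real_asymp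
    then show "(\<lambda>n. ennreal (A / (M\<^sup>2 * ln n))) \<longlonglongrightarrow> 0"
      using tendsto_ennrealI by fastforce
  qed simp
qed simp

end
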